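(* Let $n\ge1$ and $k\in\{1,\dots,n\}$. The following five Riemannian manifolds are, up to a constant factor, isometric to one another, i.e. for any two of them, $(M,g)$ and $(M',g')$, there are a diffeomorphism $\psi:M\to M'$ and a constant $c>0$ with $\psi^*g'=c\,g$: (1) the orthogonal model $\mathrm{O}(n)/(\mathrm{O}(k)\times\mathrm{O}(n-k))$; (2) the Stiefel model $\mathrm{V}(k,n)/\mathrm{O}(k)$; (3) the full-rank model $\mathbb{R}^{n\times k}_k/\mathrm{GL}(k)$; (4) the projection model $\{P\in\mathbb{R}^{n\times n}:P^{\mathsf T}=P=P^2,\ \operatorname{tr}(P)=k\}$; (5) the involution model $\{Q\in\mathrm{O}(n):Q^{\mathsf T}=Q,\ \operatorname{tr}(Q)=2k-n\}$; each equipped with its natural Riemannian metric as specified in the context.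
   Context: $\mathrm{V}(k,n)=\{Y\in\mathbb{R}^{n\times k}:Y^{\mathsf T}Y=I\}$; $\mathbb{R}^{n\times k}_k$ is the set of $n\times k$ real matrices of rank $k$. All group actions are by right multiplication ($\mathrm{O}(k)\times\mathrm{O}(n-k)$ embedded block-diagonally in $\mathrm{O}(n)$). Natural Riemannian metrics: (1) The tangent space at $[V]$ is identified with $\bigl\{V\begin{bmatrix}0&B\\-B^{\mathsf T}&0\end{bmatrix}:B\in\mathbb{R}^{k\times(n-k)}\bigr\}$ (horizontal lifts at $V$), and the inner product of the vectors with parameters $B_1,B_2$ is $\operatorname{tr}(B_1^{\mathsf T}B_2)$. (2) The tangent space at $[Y]$ is identified with $\{\Delta\in\mathbb{R}^{n\times k}:Y^{\mathsf T}\Delta=0\}$ (horizontal lifts at $Y$), with inner product $\operatorname{tr}(\Delta_1^{\mathsf T}\Delta_2)$. (3) The tangent space at $[A]$ is identified with $\{Z\in\mathbb{R}^{n\times k}:A^{\mathsf T}Z=0\}$ (horizontal lifts at $A$), with inner product $\operatorname{tr}\bigl((A^{\mathsf T}A)^{-1}Z_1^{\mathsf T}Z_2\bigr)$. (4) As a submanifold of $\mathbb{R}^{n\times n}$, with inner product $\operatorname{tr}(XY)$ on tangent vectors (symmetric matrices). (5) As a submanifold of $\mathbb{R}^{n\times n}$, with inner product $\operatorname{tr}(XY)$ on tangent vectors (symmetric matrices). *)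

theory Defs
  imports "HOL-Analysis.Analysis"
begin

text \<open>
  Manifolds are given by a topology together with, for each open set \<open>U\<close>, the smooth real functions
  on \<open>U\<close>; a map is smooth if it is continuous and pulls smooth functions back to smooth functions.
  Functions are total in HOL; only their values on \<open>U\<close> matter.
\<close>

record 'a smooth_space =
  space_top :: "'a topology"
  smooth_fun :: "'a set \<Rightarrow> ('a \<Rightarrow> real) \<Rightarrow> bool"

abbreviation points :: "('a, 'z) smooth_space_scheme \<Rightarrow> 'a set" where
  "points M \<equiv> topspace (space_top M)"

definition smooth_near :: "('a, 'z) smooth_space_scheme \<Rightarrow> 'a \<Rightarrow> ('a \<Rightarrow> real) \<Rightarrow> bool" where
  "smooth_near M p f \<longleftrightarrow> (\<exists>U. p \<in> U \<and> smooth_fun M U f)"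

definition smooth_map ::
  "('a, 'y) smooth_space_scheme \<Rightarrow> ('b, 'z) smooth_space_scheme \<Rightarrow> ('a \<Rightarrow> 'b) \<Rightarrow> bool" where
  "smooth_map M N \<psi> \<longleftrightarrow>
     continuous_map (space_top M) (space_top N) \<psi> \<and>
     (\<forall>V f. smooth_fun N V f \<longrightarrow> smooth_fun M {x \<in> points M. \<psi> x \<in> V} (f \<circ> \<psi>))"

definition diffeomorphism ::
  "('a, 'y) smooth_space_scheme \<Rightarrow> ('b, 'z) smooth_space_scheme \<Rightarrow> ('a \<Rightarrow> 'b) \<Rightarrow> bool" where
  "diffeomorphism M N \<psi> \<longleftrightarrow>
     smooth_map M N \<psi> \<and>
     (\<exists>\<theta>. smooth_map N M \<theta> \<and> (\<forall>x \<in> points M. \<theta> (\<psi> x) = x) \<and> (\<forall>y \<in> points N. \<psi> (\<theta> y) = y))"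

definition restrict_to :: "('a, 'z) smooth_space_scheme \<Rightarrow> 'a set \<Rightarrow> 'a smooth_space" where
  "restrict_to M U =
     \<lparr>space_top = subtopology (space_top M) U, smooth_fun = (\<lambda>V f. V \<subseteq> U \<and> smooth_fun M V f)\<rparr>"

text \<open>\<open>Ck m\<close> is \<open>C\<^sup>m\<close>; in finite dimension, continuity of all iterated directional derivatives
  of a differentiable function is the usual condition.\<close>

primrec Ck :: "nat \<Rightarrow> 'a::euclidean_space set \<Rightarrow> ('a \<Rightarrow> real) \<Rightarrow> bool" where
  "Ck 0 V F \<longleftrightarrow> continuous_on V F"
| "Ck (Suc m) V F \<longleftrightarrow>
     (\<exists>F'. (\<forall>x \<in> V. (F has_derivative F' x) (at x)) \<and> (\<forall>v. Ck m V (\<lambda>x. F' x v)))"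

text \<open>A subset of Euclidean space, with the functions that extend locally to smooth functions of
  the ambient space. For an embedded submanifold this is its submanifold structure; for an open set
  it is the standard structure.\<close>

definition embedded :: "'a::euclidean_space set \<Rightarrow> 'a smooth_space" where
  "embedded S =
     \<lparr>space_top = top_of_set S,
      smooth_fun = (\<lambda>U f. openin (top_of_set S) U \<and>
        (\<forall>x \<in> U. \<exists>V F. open V \<and> x \<in> V \<and> (\<forall>m. Ck m V F) \<and> (\<forall>y \<in> U \<inter> V. f y = F y)))\<rparr>"

text \<open>The quotient along \<open>\<pi>\<close>: quotient topology, and \<open>f\<close> is smooth iff \<open>f \<circ> \<pi>\<close> is. For a free and
  proper action of a Lie group and its orbit map, this is the unique structure making \<open>\<pi>\<close> a smooth
  submersion.\<close>

definition quotient_top :: "'a topology \<Rightarrow> ('a \<Rightarrow> 'b) \<Rightarrow> 'b topology" where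
  "quotient_top X \<pi> = topology (\<lambda>U. U \<subseteq> \<pi> ` topspace X \<and> openin X {x \<in> topspace X. \<pi> x \<in> U})"

lemma openin_quotient_top:
  "openin (quotient_top X \<pi>) U \<longleftrightarrow> U \<subseteq> \<pi> ` topspace X \<and> openin X {x \<in> topspace X. \<pi> x \<in> U}"
proof -
  have int: "{x \<in> topspace X. \<pi> x \<in> S \<inter> T} = {x \<in> topspace X. \<pi> x \<in> S} \<inter> {x \<in> topspace X. \<pi> x \<in> T}"
    for S T by blast
  have un: "{x \<in> topspace X. \<pi> x \<in> \<Union>\<K>} = (\<Union>K\<in>\<K>. {x \<in> topspace X. \<pi> x \<in> K})" for \<K>
    by blast
  have "istopology (\<lambda>U. U \<subseteq> \<pi> ` topspace X \<and> openin X {x \<in> topspace X. \<pi> x \<in> U})"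
    unfolding istopology_def int un by blast
  then show ?thesis
    by (simp add: quotient_top_def)
qed

lemma topspace_quotient_top: "topspace (quotient_top X \<pi>) = \<pi> ` topspace X"
proof -
  have "{x \<in> topspace X. \<pi> x \<in> \<pi> ` topspace X} = topspace X"
    by blast
  then have "openin (quotient_top X \<pi>) (\<pi> ` topspace X)"
    by (simp add: openin_quotient_top)
  then show ?thesis
    by (metis openin_quotient_top openin_subset openin_topspace subset_antisym)
qed

definition quotient_space :: "('a, 'z) smooth_space_scheme \<Rightarrow> ('a \<Rightarrow> 'b) \<Rightarrow> 'b smooth_space" where
  "quotient_space M \<pi> =
     \<lparr>space_top = quotient_top (space_top M) \<pi>,
      smooth_fun = (\<lambda>U f. openin (quotient_top (space_top M) \<pi>) U \<and>
        smooth_fun M {x \<in> points M. \<pi> x \<in> U} (f \<circ> \<pi>))\<rparr>"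

text \<open>A tangent vector at \<open>p\<close> is the velocity of a smooth curve through \<open>p\<close>, acting on the functions
  smooth near \<open>p\<close> (and, by convention, by \<open>0\<close> on all other functions, so that equality of tangent
  vectors is equality in HOL).\<close>

type_synonym 'a tvec = "('a \<Rightarrow> real) \<Rightarrow> real"

definition velocity :: "('a, 'z) smooth_space_scheme \<Rightarrow> (real \<Rightarrow> 'a) \<Rightarrow> 'a tvec" where
  "velocity M \<gamma> = (\<lambda>f. if smooth_near M (\<gamma> 0) f then deriv (\<lambda>t. f (\<gamma> t)) 0 else 0)"

definition tangent_space :: "('a, 'z) smooth_space_scheme \<Rightarrow> 'a \<Rightarrow> 'a tvec set" where
  "tangent_space M p =
     {velocity M \<gamma> | \<gamma>. \<gamma> 0 = p \<and> (\<exists>\<epsilon>>0. smooth_map (embedded {-\<epsilon><..<\<epsilon>}) M \<gamma>)}"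

definition differential ::
  "('b, 'z) smooth_space_scheme \<Rightarrow> ('a \<Rightarrow> 'b) \<Rightarrow> 'a \<Rightarrow> 'a tvec \<Rightarrow> 'b tvec" where
  "differential N \<psi> p D = (\<lambda>f. if smooth_near N (\<psi> p) f then D (f \<circ> \<psi>) else 0)"

text \<open>The element of the ambient Euclidean space corresponding to a tangent vector of an embedded
  submanifold, i.e. the value on it of the differential of the inclusion, computed from the
  derivatives of the coordinate functions.\<close>

definition ambient_vector :: "'a::euclidean_space tvec \<Rightarrow> 'a" where
  "ambient_vector D = (\<Sum>b\<in>Basis. D (\<lambda>y. y \<bullet> b) *\<^sub>R b)"

record 'a riemannian_space = "'a smooth_space" +
  metric :: "'a \<Rightarrow> 'a tvec \<Rightarrow> 'a tvec \<Rightarrow> real"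

text \<open>Manifolds are modelled on a linear subspace \<open>W\<close> of a Euclidean space instead of
  \<open>\<real>\<^sup>d\<close>, so that the dimension \<open>d = dim W\<close> need not be a type and may be \<open>0\<close>.\<close>

definition smooth_manifold ::
  "'e::euclidean_space set \<Rightarrow> ('a, 'z) smooth_space_scheme \<Rightarrow> bool" where
  "smooth_manifold W M \<longleftrightarrow>
     subspace W \<and>
     Hausdorff_space (space_top M) \<and>
     second_countable (space_top M) \<and>
     (\<forall>U f. smooth_fun M U f \<longleftrightarrow>
        openin (space_top M) U \<and> (\<forall>p \<in> U. \<exists>V. p \<in> V \<and> V \<subseteq> U \<and> smooth_fun M V f)) \<and>
     (\<forall>p \<in> points M. \<exists>U W' \<phi>. openin (space_top M) U \<and> p \<in> U \<and> openin (top_of_set W) W' \<and>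
        diffeomorphism (restrict_to M U) (embedded W') \<phi>)"

definition vector_field_on ::
  "('a, 'z) smooth_space_scheme \<Rightarrow> 'a set \<Rightarrow> ('a \<Rightarrow> 'a tvec) \<Rightarrow> bool" where
  "vector_field_on M U X \<longleftrightarrow>
     (\<forall>p \<in> U. X p \<in> tangent_space M p) \<and>
     (\<forall>V f. V \<subseteq> U \<and> smooth_fun M V f \<longrightarrow> smooth_fun M V (\<lambda>p. X p f))"

definition riemannian_manifold ::
  "'e::euclidean_space set \<Rightarrow> ('a, 'z) riemannian_space_scheme \<Rightarrow> bool" where
  "riemannian_manifold W M \<longleftrightarrow>
     smooth_manifold W M \<and>
     (\<forall>p \<in> points M. \<forall>D \<in> tangent_space M p. \<forall>D' \<in> tangent_space M p.
        metric M p D D' = metric M p D' D \<and>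
        (\<forall>D'' \<in> tangent_space M p. \<forall>a b.
           metric M p (\<lambda>f. a * D f + b * D' f) D'' = a * metric M p D D'' + b * metric M p D' D'') \<and>
        (D \<noteq> (\<lambda>f. 0) \<longrightarrow> metric M p D D > 0)) \<and>
     (\<forall>U X Y. openin (space_top M) U \<and> vector_field_on M U X \<and> vector_field_on M U Y \<longrightarrow>
        smooth_fun M U (\<lambda>p. metric M p (X p) (Y p)))"

text \<open>Isometric up to a constant factor: \<open>\<psi>\<^sup>*g' = c g\<close>.\<close>

definition homothetic ::
  "('a, 'y) riemannian_space_scheme \<Rightarrow> ('b, 'z) riemannian_space_scheme \<Rightarrow> bool" where
  "homothetic M N \<longleftrightarrow>
     (\<exists>\<psi> c. diffeomorphism M N \<psi> \<and> c > 0 \<and>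
       (\<forall>p \<in> points M. \<forall>D \<in> tangent_space M p. \<forall>D' \<in> tangent_space M p.
          metric N (\<psi> p) (differential N \<psi> p D) (differential N \<psi> p D') = c * metric M p D D'))"

definition submanifold ::
  "'a::euclidean_space set \<Rightarrow> ('a \<Rightarrow> 'a \<Rightarrow> real) \<Rightarrow> 'a riemannian_space" where
  "submanifold S h = smooth_space.extend (embedded S)
     (riemannian_space.fields (\<lambda>p D D'. h (ambient_vector D) (ambient_vector D')))"

text \<open>\<open>E/G\<close> for \<open>G\<close> acting by right multiplication on the submanifold \<open>E\<close> of a matrix space. A tangent
  vector of \<open>E/G\<close> is lifted at a representative \<open>x\<close> to the tangent vector of \<open>E\<close> lying in the horizontal
  space \<open>H x\<close>, and lifts are multiplied by \<open>h x\<close>. The definite description ranges over all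
  representatives and all horizontal lifts, so it denotes a number only if the result does not depend
  on them.\<close>

definition orbit :: "(real^'k^'k) set \<Rightarrow> real^'k^'n \<Rightarrow> (real^'k^'n) set" where
  "orbit G x = (\<lambda>g. x ** g) ` G"

definition is_horizontal_lift ::
  "(real^'k^'n) set \<Rightarrow> (real^'k^'k) set \<Rightarrow> (real^'k^'n \<Rightarrow> (real^'k^'n) set) \<Rightarrow>
   real^'k^'n \<Rightarrow> (real^'k^'n) set tvec \<Rightarrow> real^'k^'n \<Rightarrow> bool" where
  "is_horizontal_lift E G H x D v \<longleftrightarrow>
     (\<exists>L \<in> tangent_space (embedded E) x.
        ambient_vector L = v \<and> v \<in> H x \<and>
        differential (quotient_space (embedded E) (orbit G)) (orbit G) x L = D)"

definition quotient_manifold ::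
  "(real^'k^'n) set \<Rightarrow> (real^'k^'k) set \<Rightarrow> (real^'k^'n \<Rightarrow> (real^'k^'n) set) \<Rightarrow>
   (real^'k^'n \<Rightarrow> real^'k^'n \<Rightarrow> real^'k^'n \<Rightarrow> real) \<Rightarrow> (real^'k^'n) set riemannian_space" where
  "quotient_manifold E G H h = smooth_space.extend (quotient_space (embedded E) (orbit G))
     (riemannian_space.fields (\<lambda>p D D'. THE r. \<exists>x v v'. x \<in> E \<and> orbit G x = p \<and>
        is_horizontal_lift E G H x D v \<and> is_horizontal_lift E G H x D' v' \<and> r = h x v v'))"

text \<open>
  \<open>n\<close> and \<open>k\<close> are the cardinalities of the index types \<open>'n\<close> and \<open>'k\<close>. An injection \<open>\<iota> :: 'k \<Rightarrow> 'n\<close>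
  says which coordinates form the first block, of size \<open>k\<close>; the other \<open>n - k\<close> coordinates, possibly
  none, form the second block. Accordingly a \<open>k \<times> (n - k)\<close> matrix is a \<open>k \<times> n\<close> matrix \<open>B\<close> whose columns
  at the positions in \<open>range \<iota>\<close> vanish; this does not change \<open>tr (B\<^sub>1\<^sup>T B\<^sub>2)\<close>.
\<close>

definition off_block :: "('k::finite \<Rightarrow> 'n::finite) \<Rightarrow> (real^'n^'k) set" where
  "off_block \<iota> = {B. \<forall>a b. B $ a $ \<iota> b = 0}"

text \<open>The block matrix with rows \<open>(0, B)\<close> and \<open>(-B\<^sup>T, 0)\<close>.\<close>

definition skew_block :: "('k::finite \<Rightarrow> 'n::finite) \<Rightarrow> real^'n^'k \<Rightarrow> real^'n^'n" where
  "skew_block \<iota> B = (\<chi> i j.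
     if i \<in> range \<iota> \<and> j \<notin> range \<iota> then B $ inv \<iota> i $ j
     else if i \<notin> range \<iota> \<and> j \<in> range \<iota> then - (B $ inv \<iota> j $ i)
     else 0)"

text \<open>A block diagonal matrix is orthogonal iff both diagonal blocks are, so this is
  \<open>O(k) \<times> O(n - k)\<close>.\<close>

definition block_diag_orthogonal :: "('k::finite \<Rightarrow> 'n::finite) \<Rightarrow> (real^'n^'n) set" where
  "block_diag_orthogonal \<iota> =
     {U. orthogonal_matrix U \<and> (\<forall>i j. (i \<in> range \<iota>) \<noteq> (j \<in> range \<iota>) \<longrightarrow> U $ i $ j = 0)}"

definition off_block_coord :: "('k::finite \<Rightarrow> 'n::finite) \<Rightarrow> real^'n^'n \<Rightarrow> real^'n^'n \<Rightarrow> real^'n^'k" where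
  "off_block_coord \<iota> V X = (THE B. B \<in> off_block \<iota> \<and> X = V ** skew_block \<iota> B)"

definition orthogonal_model :: "('k::finite \<Rightarrow> 'n::finite) \<Rightarrow> (real^'n^'n) set riemannian_space" where
  "orthogonal_model \<iota> = quotient_manifold
     {V. orthogonal_matrix V}
     (block_diag_orthogonal \<iota>)
     (\<lambda>V. {V ** skew_block \<iota> B | B. B \<in> off_block \<iota>})
     (\<lambda>V X\<^sub>1 X\<^sub>2. trace (transpose (off_block_coord \<iota> V X\<^sub>1) ** off_block_coord \<iota> V X\<^sub>2))"

definition stiefel_model :: "(real^'k^'n) set riemannian_space" where
  "stiefel_model = quotient_manifold
     {Y. transpose Y ** Y = mat 1}
     {U. orthogonal_matrix U}
     (\<lambda>Y. {\<Delta>. transpose Y ** \<Delta> = 0})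
     (\<lambda>Y \<Delta>\<^sub>1 \<Delta>\<^sub>2. trace (transpose \<Delta>\<^sub>1 ** \<Delta>\<^sub>2))"

definition full_rank_model :: "(real^'k^'n) set riemannian_space" where
  "full_rank_model = quotient_manifold
     {A. rank A = CARD('k)}
     {X. invertible X}
     (\<lambda>A. {Z. transpose A ** Z = 0})
     (\<lambda>A Z\<^sub>1 Z\<^sub>2. trace (matrix_inv (transpose A ** A) ** (transpose Z\<^sub>1 ** Z\<^sub>2)))"

definition projection_model :: "nat \<Rightarrow> (real^'n^'n) riemannian_space" where
  "projection_model k = submanifold
     {P. transpose P = P \<and> P = P ** P \<and> trace P = real k}
     (\<lambda>X Y. trace (X ** Y))"

definition involution_model :: "nat \<Rightarrow> (real^'n^'n) riemannian_space" where
  "involution_model k = submanifold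
     {Q. orthogonal_matrix Q \<and> transpose Q = Q \<and> trace Q = 2 * real k - real CARD('n)}
     (\<lambda>X Y. trace (X ** Y))"

end

theory Submission
  imports Defs
begin

text \<open>
  Every model maps to the projection model. The map sends a representative \<open>x\<close> to the orthogonal projection
  \<open>F x\<close> onto the column space of the frame \<open>x J\<close>, where \<open>J\<close> selects the first block for the orthogonal model and
  is the identity otherwise; the involution \<open>Q\<close> goes to \<open>(Q + 1) / 2\<close>. The fibres of \<open>F\<close> are the orbits, and
  Gram--Schmidt orthonormalisation provides smooth local sections, so \<open>F\<close> induces a diffeomorphism. If \<open>v\<close> is
  horizontal at \<open>x\<close> and \<open>A = x J\<close>, then the differential of \<open>F\<close> at \<open>v\<close> is \<open>K + K\<^sup>T\<close> with
  \<open>K = (v J) (A\<^sup>T A)\<^sup>-\<^sup>1 A\<^sup>T\<close>, and \<open>K\<^sub>1 K\<^sub>2 = 0\<close> gives \<open>tr ((K\<^sub>1 + K\<^sub>1\<^sup>T) (K\<^sub>2 + K\<^sub>2\<^sup>T)) = 2 tr (K\<^sub>1\<^sup>T K\<^sub>2)\<close>,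
  which is twice the metric of the quotient. Horizontal lifts are velocities of \<open>C(t) x\<close> for a Cayley
  curve \<open>C\<close> of orthogonal matrices. The projection model is itself covered by graph charts, and the
  Riemannian structure is transported along these maps.
\<close>

subsection \<open>Smooth functions on open sets\<close>

text \<open>The projection model is the hub because it is a subset of a matrix space: a tangent
  vector is determined by its ambient matrix, and smoothness means local extension to open sets. For
  the quotients, the Hausdorff property and the charts are not derived from a theorem on free and
  proper actions; they are pulled back along the induced bijection, so that its smoothness in both
  directions is the main task. Two features of the encoding shape the rest. Tangent spaces are sets
  of velocities, so closure under linear combinations requires a curve for each matrix that solves
  the linearised equations; Cayley curves supply it, by conjugating projections and by moving
  frames. The metric of a quotient is a definite description over all representatives and lifts; it
  denotes a number because it equals half of an expression on the projection side that mentions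
  neither. The constants are thus 2 for the quotients and 1/4 for the involutions, the latter being
  the square of the derivative 1/2.\<close>

lemma Ck_subset: "Ck m V F \<Longrightarrow> U \<subseteq> V \<Longrightarrow> Ck m U F"
proof (induction m arbitrary: F)
  case 0
  then show ?case by (auto intro: continuous_on_subset)
next
  case (Suc m)
  then obtain F' where "\<forall>x\<in>V. (F has_derivative F' x) (at x)" "\<forall>v. Ck m V (\<lambda>x. F' x v)"
    by auto
  with Suc show ?case by (auto intro!: exI[of _ F'])
qed

text \<open>Openness of \<open>V\<close> is essential: \<open>has_derivative\<close> at
  \<open>x\<close> looks at a full neighbourhood of \<open>x\<close>, so agreement on
  \<open>V\<close> controls it only if \<open>V\<close> is one.\<close>

lemma Ck_cong:
  assumes "open V" "\<And>x. x \<in> V \<Longrightarrow> F x = G x" "Ck m V F"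
  shows "Ck m V G"
proof (cases m)
  case 0
  then show ?thesis using assms continuous_on_cong[of V V F G] by simp
next
  case (Suc l)
  then obtain F' where F': "\<forall>x\<in>V. (F has_derivative F' x) (at x)" "\<forall>v. Ck l V (\<lambda>x. F' x v)"
    using assms by auto
  have "(G has_derivative F' x) (at x)" if "x \<in> V" for x
    using F'(1) that assms(1,2) by (blast intro: has_derivative_transform_within_open)
  with F' show ?thesis by (auto simp: Suc)
qed

text \<open>\<open>Ck (Suc m)\<close> only asks for directional derivatives of class
  \<open>Ck m\<close>. The product, quotient and chain rules also need the functions themselves to
  be \<open>Ck m\<close>, since these reappear in the formulas for the derivatives.\<close>

lemma Ck_Suc_imp_Ck: "Ck (Suc m) V F \<Longrightarrow> Ck m V F"
proof (induction m arbitrary: F)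
  case 0
  then show ?case
    by (auto intro!: continuous_at_imp_continuous_on intro: has_derivative_continuous)
next
  case (Suc m)
  then obtain F' where F': "\<forall>x\<in>V. (F has_derivative F' x) (at x)" "\<forall>v. Ck (Suc m) V (\<lambda>x. F' x v)"
    using Ck.simps(2)[of "Suc m"] by blast
  then have "\<forall>v. Ck m V (\<lambda>x. F' x v)"
    using Suc.IH by blast
  with F' show ?case by auto
qed

lemma Ck_const: "Ck m V (\<lambda>x. c)"
proof (induction m arbitrary: c)
  case (Suc m)
  then show ?case by (auto intro!: exI[of _ "\<lambda>x v. 0"])
qed simp

lemma Ck_linear:
  assumes "bounded_linear F"
  shows "Ck m V F"
proof (cases m)
  case 0
  then show ?thesis using assms by (simp add: linear_continuous_on)
next
  case (Suc l)
  show ?thesis unfolding Suc Ck.simps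
    by (intro exI[of _ "\<lambda>x. F"]) (auto intro: Ck_const bounded_linear_imp_has_derivative assms)
qed

lemma Ck_add: "Ck m V F \<Longrightarrow> Ck m V G \<Longrightarrow> Ck m V (\<lambda>x. F x + G x)"
proof (induction m arbitrary: F G)
  case 0
  then show ?case by (auto intro: continuous_intros)
next
  case (Suc m)
  then obtain F' G' where
    "\<forall>x\<in>V. (F has_derivative F' x) (at x)" "\<forall>v. Ck m V (\<lambda>x. F' x v)"
    "\<forall>x\<in>V. (G has_derivative G' x) (at x)" "\<forall>v. Ck m V (\<lambda>x. G' x v)"
    by auto
  with Suc.IH show ?case
    by (auto intro!: exI[of _ "\<lambda>x v. F' x v + G' x v"] has_derivative_add)
qed

lemma Ck_mult: "Ck m V F \<Longrightarrow> Ck m V G \<Longrightarrow> Ck m V (\<lambda>x. F x * G x)"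
proof (induction m arbitrary: F G)
  case 0
  then show ?case by (auto intro: continuous_intros)
next
  case (Suc m)
  then obtain F' G' where
    *: "\<forall>x\<in>V. (F has_derivative F' x) (at x)" "\<forall>v. Ck m V (\<lambda>x. F' x v)"
    "\<forall>x\<in>V. (G has_derivative G' x) (at x)" "\<forall>v. Ck m V (\<lambda>x. G' x v)"
    by auto
  have "Ck m V F" "Ck m V G"
    using Suc.prems by (blast intro: Ck_Suc_imp_Ck)+
  with * Suc.IH show ?case
    by (auto intro!: exI[of _ "\<lambda>x v. F x * G' x v + F' x v * G x"] has_derivative_mult Ck_add)
qed

lemma Ck_sum: "finite I \<Longrightarrow> (\<And>i. i \<in> I \<Longrightarrow> Ck m V (F i)) \<Longrightarrow> Ck m V (\<lambda>x. \<Sum>i\<in>I. F i x)"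
  by (induction I rule: finite_induct) (auto simp: Ck_const Ck_add)

lemma Ck_prod: "finite I \<Longrightarrow> (\<And>i. i \<in> I \<Longrightarrow> Ck m V (F i)) \<Longrightarrow> Ck m V (\<lambda>x. \<Prod>i\<in>I. F i x)"
  by (induction I rule: finite_induct) (auto simp: Ck_const Ck_mult)

text \<open>The derivative is again built from the inverse of \<open>F\<close> and from
  \<open>F'\<close>, so the induction hypothesis for the same function, one order lower, closes the
  step. The square root below is treated in the same way.\<close>

lemma Ck_inverse: "(\<And>x. x \<in> V \<Longrightarrow> F x \<noteq> 0) \<Longrightarrow> Ck m V F \<Longrightarrow> Ck m V (\<lambda>x. inverse (F x))"
proof (induction m)
  case 0
  then show ?case by (auto intro: continuous_intros)
next
  case (Suc m)
  then obtain F' where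
    *: "\<forall>x\<in>V. (F has_derivative F' x) (at x)" "\<forall>v. Ck m V (\<lambda>x. F' x v)"
    by auto
  have "Ck m V (\<lambda>x. inverse (F x))"
    using Suc Ck_Suc_imp_Ck by blast
  then have "Ck m V (\<lambda>x. - 1 * (inverse (F x) * F' x v * inverse (F x)))" for v
    using * by (intro Ck_mult Ck_const) auto
  moreover have "((\<lambda>x. inverse (F x)) has_derivative (\<lambda>v. - (inverse (F x) * F' x v * inverse (F x)))) (at x)"
    if "x \<in> V" for x
    using * Suc.prems(1) that by (intro Deriv.has_derivative_inverse) auto
  ultimately show ?case
    by (auto intro!: exI[of _ "\<lambda>x v. - (inverse (F x) * F' x v * inverse (F x))"])
qed

lemma Ck_sqrt: "(\<And>x. x \<in> V \<Longrightarrow> F x > 0) \<Longrightarrow> Ck m V F \<Longrightarrow> Ck m V (\<lambda>x. sqrt (F x))"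
proof (induction m)
  case 0
  then show ?case by (auto intro: continuous_intros)
next
  case (Suc m)
  then obtain F' where
    *: "\<forall>x\<in>V. (F has_derivative F' x) (at x)" "\<forall>v. Ck m V (\<lambda>x. F' x v)"
    by auto
  have "Ck m V (\<lambda>x. sqrt (F x))"
    using Suc Ck_Suc_imp_Ck by blast
  then have "Ck m V (\<lambda>x. inverse (sqrt (F x)))"
    using Suc.prems(1) by (intro Ck_inverse) force+
  then have **: "Ck m V (\<lambda>x. (inverse (sqrt (F x)) * (1 / 2)) * F' x v)" for v
    using * by (intro Ck_mult Ck_const) auto
  have "((\<lambda>x. sqrt (F x)) has_derivative (\<lambda>v. (inverse (sqrt (F x)) * (1 / 2)) * F' x v)) (at x)"
    if "x \<in> V" for x
  proof -
    have "(sqrt has_derivative (*) (inverse (sqrt (F x)) * (1 / 2))) (at (F x))"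
      using DERIV_real_sqrt[OF Suc.prems(1)[OF that]] by (simp add: has_field_derivative_def)
    with * that show ?thesis
      by (intro has_derivative_compose[of F "F' x" x UNIV sqrt "(*) (inverse (sqrt (F x)) * (1 / 2))"]) auto
  qed
  with ** show ?case
    by (auto intro!: exI[of _ "\<lambda>x v. (inverse (sqrt (F x)) * (1 / 2)) * F' x v"])
qed

text \<open>By the chain rule the derivative in direction \<open>v\<close> is the sum over
  \<open>b\<close> of \<open>h b x v * F' (g x) b\<close>. Expanding over the basis keeps the
  direction in \<open>F'\<close> constant, so each \<open>\<lambda>x. F' x b\<close> is a fixed
  \<open>Ck m\<close> function to which the induction hypothesis applies; hence the induction over
  arbitrary \<open>F\<close>.\<close>

lemma Ck_compose:
  fixes g :: "'a::euclidean_space \<Rightarrow> 'b::euclidean_space"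
  assumes "\<And>x. x \<in> V \<Longrightarrow> g x \<in> W"
  shows "Ck m W F \<Longrightarrow> (\<And>b. b \<in> Basis \<Longrightarrow> Ck m V (\<lambda>x. g x \<bullet> b)) \<Longrightarrow> Ck m V (\<lambda>x. F (g x))"
proof (induction m arbitrary: F)
  case 0
  have "continuous_on V g"
    using 0 by (subst continuous_on_componentwise) simp
  with 0 assms show ?case
    by (auto intro: continuous_on_compose2)
next
  case (Suc m)
  then obtain F' where
    F': "\<forall>x\<in>W. (F has_derivative F' x) (at x)" "\<forall>v. Ck m W (\<lambda>x. F' x v)"
    by auto
  from Suc.prems(2) have "\<forall>b\<in>Basis. \<exists>h. (\<forall>x\<in>V. ((\<lambda>x. g x \<bullet> b) has_derivative h x) (at x)) \<and> (\<forall>v. Ck m V (\<lambda>x. h x v))"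
    by simp
  then obtain h where
    h: "\<And>b x. b \<in> Basis \<Longrightarrow> x \<in> V \<Longrightarrow> ((\<lambda>x. g x \<bullet> b) has_derivative h b x) (at x)"
       "\<And>b v. b \<in> Basis \<Longrightarrow> Ck m V (\<lambda>x. h b x v)"
    by metis
  have comp: "Ck m V (\<lambda>x. F' (g x) b)" for b
  proof (rule Suc.IH)
    show "Ck m W (\<lambda>x. F' x b)"
      using F'(2) by blast
    show "Ck m V (\<lambda>x. g x \<bullet> c)" if "c \<in> Basis" for c
      using Suc.prems(2)[OF that] by (rule Ck_Suc_imp_Ck)
  qed
  have der: "((\<lambda>x. F (g x)) has_derivative (\<lambda>v. \<Sum>b\<in>Basis. h b x v * F' (g x) b)) (at x)" if "x \<in> V" for x
  proof -
    let ?g' = "\<lambda>v. \<Sum>b\<in>Basis. h b x v *\<^sub>R b"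
    have "(g has_derivative ?g') (at x)"
      using h(1) that by (subst has_derivative_componentwise_within) (auto simp: inner_sum_left inner_Basis if_distrib cong: if_cong)
    moreover have F'x: "(F has_derivative F' (g x)) (at (g x))"
      using F' assms that by auto
    ultimately have "((\<lambda>x. F (g x)) has_derivative (\<lambda>v. F' (g x) (?g' v))) (at x)"
      using has_derivative_compose by blast
    moreover have "F' (g x) (?g' v) = (\<Sum>b\<in>Basis. h b x v * F' (g x) b)" for v
      using has_derivative_linear[OF F'x] by (simp add: linear_sum linear_scale)
    ultimately show ?thesis by simp
  qed
  have "Ck m V (\<lambda>x. \<Sum>b\<in>Basis. h b x v * F' (g x) b)" for v
    by (intro Ck_sum Ck_mult h(2) comp) auto
  with der show ?case
    by (auto intro!: exI[of _ "\<lambda>x v. \<Sum>b\<in>Basis. h b x v * F' (g x) b"])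
qed

definition smooth_on :: "'a::euclidean_space set \<Rightarrow> ('a \<Rightarrow> 'b::euclidean_space) \<Rightarrow> bool" where
  "smooth_on V g \<longleftrightarrow> (\<forall>m. \<forall>b\<in>Basis. Ck m V (\<lambda>x. g x \<bullet> b))"

lemma smooth_on_real: "smooth_on V F \<longleftrightarrow> (\<forall>m. Ck m V F)" for F :: "'a::euclidean_space \<Rightarrow> real"
  by (simp add: smooth_on_def)

lemma smooth_on_matrix:
  "smooth_on V g \<longleftrightarrow> (\<forall>i j. smooth_on V (\<lambda>x. g x $ i $ j))"
  for g :: "'a::euclidean_space \<Rightarrow> real^'m^'n"
  by (auto simp: smooth_on_def Basis_vec_def inner_axis)

lemma smooth_on_subset: "smooth_on V g \<Longrightarrow> U \<subseteq> V \<Longrightarrow> smooth_on U g"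
  using Ck_subset unfolding smooth_on_def by blast

lemma smooth_on_cong:
  "smooth_on V f \<Longrightarrow> open V \<Longrightarrow> (\<And>x. x \<in> V \<Longrightarrow> f x = g x) \<Longrightarrow> smooth_on V g"
  unfolding smooth_on_def by (metis (mono_tags, lifting) Ck_cong)

lemma smooth_on_compose:
  assumes "smooth_on W f" "smooth_on V g" "\<And>x. x \<in> V \<Longrightarrow> g x \<in> W"
  shows "smooth_on V (\<lambda>x. f (g x))"
  using assms Ck_compose[of V g W] unfolding smooth_on_def by blast

lemma smooth_on_linear:
  assumes "linear g"
  shows "smooth_on V g"
  unfolding smooth_on_def
  by (intro allI ballI Ck_linear bounded_linear_compose[OF bounded_linear_inner_left])
     (simp add: assms linear_conv_bounded_linear[symmetric])

lemma smooth_on_id: "smooth_on V (\<lambda>x. x)"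
  by (intro smooth_on_linear linear_ident)

lemma smooth_on_const: "smooth_on V (\<lambda>x. c)"
  by (simp add: smooth_on_def Ck_const)

lemma smooth_on_add: "smooth_on V f \<Longrightarrow> smooth_on V g \<Longrightarrow> smooth_on V (\<lambda>x. f x + g x)"
  by (simp add: smooth_on_def inner_add_left Ck_add)

lemma smooth_on_scaleR:
  "smooth_on V r \<Longrightarrow> smooth_on V g \<Longrightarrow> smooth_on V (\<lambda>x. r x *\<^sub>R g x)"
  by (simp add: smooth_on_def Ck_mult)

lemma smooth_on_mult:
  "smooth_on V f \<Longrightarrow> smooth_on V g \<Longrightarrow> smooth_on V (\<lambda>x. f x * g x)"
  for f g :: "'a::euclidean_space \<Rightarrow> real"
  by (simp add: smooth_on_def Ck_mult)

lemma smooth_on_uminus: "smooth_on V f \<Longrightarrow> smooth_on V (\<lambda>x. - f x)"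
  using smooth_on_scaleR[OF smooth_on_const, of V f "-1"] by simp

lemma smooth_on_diff: "smooth_on V f \<Longrightarrow> smooth_on V g \<Longrightarrow> smooth_on V (\<lambda>x. f x - g x)"
  using smooth_on_add[OF _ smooth_on_uminus] by fastforce

lemma smooth_on_sum:
  "finite I \<Longrightarrow> (\<And>i. i \<in> I \<Longrightarrow> smooth_on V (f i)) \<Longrightarrow> smooth_on V (\<lambda>x. \<Sum>i\<in>I. f i x)"
  by (simp add: smooth_on_def inner_sum_left Ck_sum)

lemma smooth_on_prod:
  "finite I \<Longrightarrow> (\<And>i. i \<in> I \<Longrightarrow> smooth_on V (f i)) \<Longrightarrow> smooth_on V (\<lambda>x. \<Prod>i\<in>I. f i x)"
  for f :: "'i \<Rightarrow> 'a::euclidean_space \<Rightarrow> real"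
  by (simp add: smooth_on_real Ck_prod)

lemma smooth_on_divide:
  fixes f g :: "'a::euclidean_space \<Rightarrow> real"
  assumes "smooth_on V f" "smooth_on V g" "\<And>x. x \<in> V \<Longrightarrow> g x \<noteq> 0"
  shows "smooth_on V (\<lambda>x. f x / g x)"
  using assms unfolding divide_inverse smooth_on_real by (intro allI Ck_mult Ck_inverse) auto

lemma smooth_on_sqrt:
  fixes f :: "'a::euclidean_space \<Rightarrow> real"
  assumes "smooth_on V f" "\<And>x. x \<in> V \<Longrightarrow> f x > 0"
  shows "smooth_on V (\<lambda>x. sqrt (f x))"
  using assms unfolding smooth_on_real by (intro allI Ck_sqrt) auto

lemma smooth_on_imp_differentiable:
  assumes "smooth_on V g" "x \<in> V"
  shows "g differentiable (at x)"
proof -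
  have "(\<lambda>x. g x \<bullet> b) differentiable (at x)" if "b \<in> Basis" for b
  proof -
    have "Ck (Suc 0) V (\<lambda>x. g x \<bullet> b)"
      using assms that smooth_on_def by blast
    with assms show ?thesis by (auto simp: differentiable_def)
  qed
  then show ?thesis
    using differentiable_componentwise_within[of g x UNIV] by simp
qed

lemma smooth_on_imp_continuous_on: "smooth_on V g \<Longrightarrow> continuous_on V g"
  by (meson continuous_at_imp_continuous_on differentiable_imp_continuous_within smooth_on_imp_differentiable)

lemma smooth_on_imp_open_vimage:
  assumes "smooth_on V g" "open V" "open W"
  shows "open {x \<in> V. g x \<in> W}"
proof -
  have "{x \<in> V. g x \<in> W} = g -` W \<inter> V" by auto
  then show ?thesis
    using assms continuous_open_vimage smooth_on_imp_continuous_on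
    by (metis continuous_on_open_vimage)
qed

section \<open>Smoothness of matrix multiplication, determinant and inverse\<close>

lemma smooth_on_matrix_mult:
  "smooth_on V f \<Longrightarrow> smooth_on V g \<Longrightarrow> smooth_on V (\<lambda>x. f x ** g x)"
  for f :: "'a::euclidean_space \<Rightarrow> real^'m^'n" and g :: "'a \<Rightarrow> real^'l^'m"
  unfolding smooth_on_matrix[of V f] smooth_on_matrix[of V g] smooth_on_matrix[of V "\<lambda>x. f x ** g x"]
  by (auto simp: matrix_matrix_mult_def intro!: smooth_on_sum smooth_on_mult)

lemma smooth_on_transpose:
  "smooth_on V f \<Longrightarrow> smooth_on V (\<lambda>x. transpose (f x))"
  for f :: "'a::euclidean_space \<Rightarrow> real^'m^'n"
  unfolding smooth_on_matrix[of V f] smooth_on_matrix[of V "\<lambda>x. transpose (f x)"]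
  by (auto simp: transpose_def)

lemma smooth_on_det:
  fixes f :: "'a::euclidean_space \<Rightarrow> real^'n^'n"
  assumes "\<And>i j. smooth_on V (\<lambda>x. f x $ i $ j)"
  shows "smooth_on V (\<lambda>x. det (f x))"
  unfolding det_def
  by (intro smooth_on_sum smooth_on_mult smooth_on_const smooth_on_prod assms finite_permutations)
     auto

lemma matrix_inv_mult:
  assumes "invertible (A::real^'n^'n)"
  shows "A ** matrix_inv A = mat 1" "matrix_inv A ** A = mat 1"
  using someI_ex[of "\<lambda>A'. A ** A' = mat 1 \<and> A' ** A = mat 1"] assms
  unfolding invertible_def matrix_inv_def by blast+

text \<open>Cramer's rule exhibits the entries of the inverse as quotients of polynomials in the
  entries, which is what makes inversion smooth.\<close>

lemma matrix_inv_nth_cramer: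
  fixes A :: "real^'n^'n"
  assumes "det A \<noteq> 0"
  shows "matrix_inv A $ i $ j = det (\<chi> a b. if b = i then axis j 1 $ a else A $ a $ b) / det A"
proof -
  have "A ** matrix_inv A = mat 1"
    using assms by (simp add: invertible_det_nz matrix_inv_mult)
  then have "A *v (matrix_inv A *v axis j 1) = axis j 1"
    by (simp add: matrix_vector_mul_assoc)
  then have "matrix_inv A *v axis j 1 = (\<chi> k. det (\<chi> a b. if b = k then axis j 1 $ a else A $ a $ b) / det A)"
    using cramer[OF assms] by blast
  moreover have "(matrix_inv A *v axis j 1) $ i = matrix_inv A $ i $ j"
    by (simp add: matrix_vector_mult_basis column_def)
  ultimately show ?thesis by simp
qed

lemma smooth_on_matrix_inv:
  fixes f :: "'a::euclidean_space \<Rightarrow> real^'n^'n"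
  assumes "smooth_on V f" "open V" "\<And>x. x \<in> V \<Longrightarrow> det (f x) \<noteq> 0"
  shows "smooth_on V (\<lambda>x. matrix_inv (f x))"
  unfolding smooth_on_matrix[of V "\<lambda>x. matrix_inv (f x)"]
proof (intro allI)
  fix i j
  let ?C = "\<lambda>x. \<chi> a b. if b = i then axis j 1 $ a else f x $ a $ b"
  have f: "smooth_on V (\<lambda>x. f x $ a $ b)" for a b
    using assms(1) smooth_on_matrix by blast
  have "smooth_on V (\<lambda>x. ?C x $ a $ b)" for a b
    by (cases "b = i") (simp_all add: smooth_on_const f)
  then have "smooth_on V (\<lambda>x. det (?C x) / det (f x))"
    by (intro smooth_on_divide smooth_on_det f assms(3))
  then show "smooth_on V (\<lambda>x. matrix_inv (f x) $ i $ j)"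
    by (rule smooth_on_cong) (auto simp: assms matrix_inv_nth_cramer)
qed

lemmas smooth_intros = smooth_on_id smooth_on_const smooth_on_add smooth_on_diff smooth_on_uminus
  smooth_on_scaleR smooth_on_mult smooth_on_matrix_mult smooth_on_transpose

subsection \<open>Subsets of Euclidean space as smooth spaces\<close>

text \<open>The condition on functions in \<open>embedded\<close>, for vector values and detached
  from the topology.\<close>

definition smooth_ext :: "'a::euclidean_space set \<Rightarrow> ('a \<Rightarrow> 'b::euclidean_space) \<Rightarrow> bool" where
  "smooth_ext S g \<longleftrightarrow>
     (\<forall>x\<in>S. \<exists>V G. open V \<and> x \<in> V \<and> smooth_on V G \<and> (\<forall>y\<in>S \<inter> V. g y = G y))"

lemma smooth_extE:
  assumes "smooth_ext S g" "x \<in> S"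
  obtains V G where "open V" "x \<in> V" "smooth_on V G" "\<And>y. y \<in> S \<Longrightarrow> y \<in> V \<Longrightarrow> g y = G y"
proof -
  from assms have "\<exists>V G. open V \<and> x \<in> V \<and> smooth_on V G \<and> (\<forall>y\<in>S \<inter> V. g y = G y)"
    by (simp add: smooth_ext_def)
  then show thesis
  proof (elim exE conjE)
    fix V G
    assume "open V" "x \<in> V" "smooth_on V G" "\<forall>y\<in>S \<inter> V. g y = G y"
    then show thesis
      by (intro that[of V G]) auto
  qed
qed

lemma space_top_embedded [simp]: "space_top (embedded S) = top_of_set S"
  by (simp add: embedded_def)

lemma smooth_fun_embedded:
  "smooth_fun (embedded S) U f \<longleftrightarrow> openin (top_of_set S) U \<and> smooth_ext U f"
  by (simp add: embedded_def smooth_ext_def smooth_on_real)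

lemma smooth_ext_subset:
  assumes "smooth_ext S g" "T \<subseteq> S"
  shows "smooth_ext T g"
  unfolding smooth_ext_def
proof
  fix x assume "x \<in> T"
  with assms(2) have "x \<in> S" by blast
  obtain V G where "open V" "x \<in> V" "smooth_on V G" "\<And>y. y \<in> S \<Longrightarrow> y \<in> V \<Longrightarrow> g y = G y"
    using smooth_extE[OF assms(1) \<open>x \<in> S\<close>] by blast
  with assms(2) show "\<exists>V G. open V \<and> x \<in> V \<and> smooth_on V G \<and> (\<forall>y\<in>T \<inter> V. g y = G y)"
    by (intro exI[of _ V] exI[of _ G]) auto
qed

lemma smooth_ext_cong: "smooth_ext S f \<Longrightarrow> (\<And>x. x \<in> S \<Longrightarrow> f x = g x) \<Longrightarrow> smooth_ext S g"
  unfolding smooth_ext_def by simp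

lemma smooth_on_imp_smooth_ext: "smooth_on V g \<Longrightarrow> open V \<Longrightarrow> S \<subseteq> V \<Longrightarrow> smooth_ext S g"
  unfolding smooth_ext_def by (intro ballI exI[of _ V] exI[of _ g]) auto

lemma smooth_ext_local:
  assumes "\<And>p. p \<in> S \<Longrightarrow> \<exists>V. open V \<and> p \<in> V \<and> smooth_ext (S \<inter> V) g"
  shows "smooth_ext S g"
  unfolding smooth_ext_def
proof
  fix p assume p: "p \<in> S"
  then obtain V where V: "open V" "p \<in> V" "smooth_ext (S \<inter> V) g"
    using assms by blast
  with p obtain V' G where "open V'" "p \<in> V'" "smooth_on V' G"
    "\<And>y. y \<in> S \<inter> V \<Longrightarrow> y \<in> V' \<Longrightarrow> g y = G y"
    using smooth_extE[OF V(3), of p] by blast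
  with V show "\<exists>V G. open V \<and> p \<in> V \<and> smooth_on V G \<and> (\<forall>y\<in>S \<inter> V. g y = G y)"
    by (intro exI[of _ "V \<inter> V'"] exI[of _ G]) (auto intro: smooth_on_subset)
qed

lemma smooth_ext_imp_continuous_on:
  assumes "smooth_ext S g"
  shows "continuous_on S g"
  unfolding continuous_on_def
proof
  fix x assume x: "x \<in> S"
  obtain V G where V: "open V" "x \<in> V" "smooth_on V G" "\<And>y. y \<in> S \<Longrightarrow> y \<in> V \<Longrightarrow> g y = G y"
    using smooth_extE[OF assms x] by blast
  have "isCont G x"
    using V smooth_on_imp_continuous_on continuous_on_eq_continuous_at by blast
  then have "(G \<longlongrightarrow> G x) (at x within S)"
    using continuous_at_imp_continuous_at_within continuous_within by blast
  moreover have "\<forall>\<^sub>F y in at x within S. G y = g y"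
    using V by (auto simp: eventually_at_topological)
  ultimately show "(g \<longlongrightarrow> g x) (at x within S)"
    using V x Lim_transform_eventually by metis
qed

lemma smooth_ext_compose:
  assumes f: "smooth_ext T f" and g: "smooth_ext S g" and gT: "\<And>x. x \<in> S \<Longrightarrow> g x \<in> T"
  shows "smooth_ext S (\<lambda>x. f (g x))"
  unfolding smooth_ext_def
proof
  fix x assume x: "x \<in> S"
  obtain V G where V: "open V" "x \<in> V" "smooth_on V G" "\<And>y. y \<in> S \<Longrightarrow> y \<in> V \<Longrightarrow> g y = G y"
    using smooth_extE[OF g x] by blast
  obtain W F where W: "open W" "g x \<in> W" "smooth_on W F" "\<And>y. y \<in> T \<Longrightarrow> y \<in> W \<Longrightarrow> f y = F y"
    using smooth_extE[OF f gT[OF x]] by blast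
  let ?U = "{y \<in> V. G y \<in> W}"
  have "open ?U"
    using V W smooth_on_imp_open_vimage by blast
  moreover have "smooth_on ?U (\<lambda>y. F (G y))"
    by (rule smooth_on_compose[OF W(3) smooth_on_subset[OF V(3)]]) auto
  moreover have "f (g y) = F (G y)" if "y \<in> S \<inter> ?U" for y
    using that V(4)[of y] W(4)[of "g y"] gT[of y] by simp
  ultimately show "\<exists>V F. open V \<and> x \<in> V \<and> smooth_on V F \<and> (\<forall>y\<in>S \<inter> V. f (g y) = F y)"
    using V(2,4) W(2) x by (intro exI[of _ ?U] exI[of _ "\<lambda>y. F (G y)"]) simp
qed

text \<open>The assumption \<open>op\<close> speaks of every set, so the two local extensions can be
  cut down to a common neighbourhood before they are combined; sums, products and later the trace
  form are instances.\<close>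

lemma smooth_ext_binop:
  fixes S :: "'a::euclidean_space set"
  assumes "smooth_ext S f" "smooth_ext S g"
    and op: "\<And>(V :: 'a set) F G. smooth_on V F \<Longrightarrow> smooth_on V G \<Longrightarrow> smooth_on V (\<lambda>x. h (F x) (G x))"
  shows "smooth_ext S (\<lambda>x. h (f x) (g x))"
  unfolding smooth_ext_def
proof
  fix x assume x: "x \<in> S"
  obtain V G where V: "open V" "x \<in> V" "smooth_on V G" "\<And>y. y \<in> S \<Longrightarrow> y \<in> V \<Longrightarrow> g y = G y"
    using smooth_extE[OF assms(2) x] by blast
  obtain W F where W: "open W" "x \<in> W" "smooth_on W F" "\<And>y. y \<in> S \<Longrightarrow> y \<in> W \<Longrightarrow> f y = F y"
    using smooth_extE[OF assms(1) x] by blast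
  have "smooth_on (V \<inter> W) (\<lambda>x. h (F x) (G x))"
    by (rule op[OF smooth_on_subset[OF W(3)] smooth_on_subset[OF V(3)]]) auto
  then show "\<exists>V H. open V \<and> x \<in> V \<and> smooth_on V H \<and> (\<forall>y\<in>S \<inter> V. h (f y) (g y) = H y)"
    using V W by (intro exI[of _ "V \<inter> W"] exI[of _ "\<lambda>x. h (F x) (G x)"]) auto
qed

lemma smooth_ext_add: "smooth_ext S f \<Longrightarrow> smooth_ext S g \<Longrightarrow> smooth_ext S (\<lambda>x. f x + g x)"
  by (rule smooth_ext_binop[where h = "(+)"]) (auto intro: smooth_on_add)

lemma smooth_ext_mult:
  "smooth_ext S f \<Longrightarrow> smooth_ext S g \<Longrightarrow> smooth_ext S (\<lambda>x. f x * g x)"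
  for f g :: "'a::euclidean_space \<Rightarrow> real"
  by (rule smooth_ext_binop[where h = "(*)"]) (auto intro: smooth_on_mult)

lemma smooth_ext_scaleR:
  "smooth_ext S r \<Longrightarrow> smooth_ext S g \<Longrightarrow> smooth_ext S (\<lambda>x. r x *\<^sub>R g x)"
  by (rule smooth_ext_binop[where h = "(*\<^sub>R)"]) (auto intro: smooth_on_scaleR)

lemma smooth_ext_const: "smooth_ext S (\<lambda>x. c)"
  using smooth_on_imp_smooth_ext[OF smooth_on_const] by blast

lemma smooth_ext_sum:
  "finite I \<Longrightarrow> (\<And>i. i \<in> I \<Longrightarrow> smooth_ext S (f i)) \<Longrightarrow> smooth_ext S (\<lambda>x. \<Sum>i\<in>I. f i x)"
proof (induction I rule: finite_induct)
  case empty
  then show ?case by (simp add: smooth_ext_const)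
next
  case (insert i I)
  then have "smooth_ext S (\<lambda>x. f i x + (\<Sum>i\<in>I. f i x))"
    by (intro smooth_ext_add) auto
  with insert show ?case by simp
qed

lemma smooth_ext_componentwise:
  assumes "\<And>b. b \<in> Basis \<Longrightarrow> smooth_ext S (\<lambda>x. g x \<bullet> b)"
  shows "smooth_ext S g"
proof -
  have "smooth_ext S (\<lambda>x. \<Sum>b\<in>Basis. (g x \<bullet> b) *\<^sub>R b)"
    by (intro smooth_ext_sum smooth_ext_scaleR assms smooth_ext_const) auto
  then show ?thesis
    by (simp add: euclidean_representation)
qed

lemma smooth_map_points: "smooth_map M N f \<Longrightarrow> x \<in> points M \<Longrightarrow> f x \<in> points N"
  by (auto simp: smooth_map_def continuous_map_def Pi_iff)

text \<open>Pulling back the coordinate functions recovers local extensions of \<open>g\<close>;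
  conversely, extensions compose. The definition by pullbacks thus reduces to the usual notion of a
  smooth map between subsets of Euclidean spaces.\<close>

lemma smooth_map_embedded_iff:
  "smooth_map (embedded S) (embedded T) g \<longleftrightarrow> g ` S \<subseteq> T \<and> smooth_ext S g"
proof (intro iffI conjI)
  assume g: "smooth_map (embedded S) (embedded T) g"
  then show gT: "g ` S \<subseteq> T"
    by (simp add: smooth_map_def continuous_map_def image_subset_iff Pi_iff)
  show "smooth_ext S g"
  proof (rule smooth_ext_componentwise)
    fix b :: 'b assume b: "b \<in> Basis"
    have "smooth_fun (embedded T) T (\<lambda>y. y \<bullet> b)"
      by (auto simp: smooth_fun_embedded linear_iff inner_add_left
          intro!: smooth_on_imp_smooth_ext[of UNIV] smooth_on_linear)
    then have "smooth_fun (embedded S) {x \<in> S. g x \<in> T} ((\<lambda>y. y \<bullet> b) \<circ> g)"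
      using g unfolding smooth_map_def by force
    moreover have "{x \<in> S. g x \<in> T} = S"
      using gT by auto
    ultimately show "smooth_ext S (\<lambda>x. g x \<bullet> b)"
      by (simp add: smooth_fun_embedded o_def)
  qed
next
  assume g: "g ` S \<subseteq> T \<and> smooth_ext S g"
  then have cont: "continuous_map (top_of_set S) (top_of_set T) g"
    by (auto simp: smooth_ext_imp_continuous_on continuous_map_in_subtopology)
  show "smooth_map (embedded S) (embedded T) g"
    unfolding smooth_map_def
  proof (intro conjI allI impI)
    fix V f assume f: "smooth_fun (embedded T) V f"
    then have "openin (top_of_set S) {x \<in> S. g x \<in> V}"
      using openin_continuous_map_preimage[OF cont, of V] by (simp add: smooth_fun_embedded)
    moreover have "smooth_ext {x \<in> S. g x \<in> V} (\<lambda>x. f (g x))"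
      by (rule smooth_ext_compose[of V]) (use f g in \<open>auto simp: smooth_fun_embedded intro: smooth_ext_subset\<close>)
    ultimately show "smooth_fun (embedded S) {x \<in> points (embedded S). g x \<in> V} (f \<circ> g)"
      by (simp add: smooth_fun_embedded o_def)
  qed (use cont in simp)
qed

lemma restrict_to_embedded:
  assumes "openin (top_of_set S) U"
  shows "restrict_to (embedded S) U = embedded U"
proof -
  have "U \<subseteq> S"
    using assms openin_imp_subset by blast
  then have "subtopology (top_of_set S) U = top_of_set U"
    by (simp add: subtopology_subtopology Int_absorb1)
  moreover have "V \<subseteq> U \<and> openin (top_of_set S) V \<longleftrightarrow> openin (top_of_set U) V" for V
    using assms \<open>U \<subseteq> S\<close> by (metis openin_imp_subset openin_subset_trans openin_trans)
  ultimately show ?thesis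
    unfolding restrict_to_def by (simp add: embedded_def fun_eq_iff) blast
qed

lemma smooth_fun_embedded_local:
  "smooth_fun (embedded S) U f \<longleftrightarrow>
     openin (top_of_set S) U \<and> (\<forall>p\<in>U. \<exists>V. p \<in> V \<and> V \<subseteq> U \<and> smooth_fun (embedded S) V f)"
  (is "_ \<longleftrightarrow> _ \<and> ?local")
proof
  assume R: "openin (top_of_set S) U \<and> ?local"
  have "smooth_ext U f"
  proof (rule smooth_ext_local)
    fix p assume "p \<in> U"
    with R obtain V where V: "p \<in> V" "V \<subseteq> U" "openin (top_of_set S) V" "smooth_ext V f"
      unfolding smooth_fun_embedded by blast
    then obtain O' where "open O'" "V = S \<inter> O'"
      by (auto simp: openin_open)
    moreover have "U \<inter> O' \<subseteq> V"
      using R openin_imp_subset calculation by blast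
    ultimately show "\<exists>V. open V \<and> p \<in> V \<and> smooth_ext (U \<inter> V) f"
      using V smooth_ext_subset by blast
  qed
  with R show "smooth_fun (embedded S) U f"
    by (simp add: smooth_fun_embedded)
qed (auto simp: smooth_fun_embedded)

lemma smooth_map_embedded_cong:
  assumes f: "smooth_map (embedded S) N f" and eq: "\<And>x. x \<in> S \<Longrightarrow> f x = g x"
  shows "smooth_map (embedded S) N g"
  unfolding smooth_map_def
proof (intro conjI allI impI)
  show "continuous_map (space_top (embedded S)) (space_top N) g"
    using f eq by (auto simp: smooth_map_def intro: continuous_map_eq)
next
  fix V h assume "smooth_fun N V h"
  then have "smooth_fun (embedded S) {x \<in> S. f x \<in> V} (h \<circ> f)"
    using f by (force simp: smooth_map_def)
  moreover have "{x \<in> S. f x \<in> V} = {x \<in> S. g x \<in> V}"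
    using eq by auto
  ultimately show "smooth_fun (embedded S) {x \<in> points (embedded S). g x \<in> V} (h \<circ> g)"
    using eq by (auto simp: smooth_fun_embedded elim!: smooth_ext_cong)
qed

text \<open>Locality comes from the source alone, so \<open>N\<close> may be a quotient space. This
  is what glues the inverse of the induced map from pieces given by local sections.\<close>

lemma smooth_map_embedded_local:
  assumes "\<And>p. p \<in> S \<Longrightarrow> \<exists>V. open V \<and> p \<in> V \<and> smooth_map (embedded (S \<inter> V)) N f"
  shows "smooth_map (embedded S) N f"
proof -
  \<comment> \<open>Used twice: for preimages of open sets and for preimages of domains of smooth
    functions.\<close>
  have open_sub: "openin (top_of_set S) {x \<in> S. f x \<in> W}"
    if W: "\<And>V. open V \<Longrightarrow> smooth_map (embedded (S \<inter> V)) N f \<Longrightarrow>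
      openin (top_of_set (S \<inter> V)) {x \<in> S \<inter> V. f x \<in> W}" for W
  proof (subst openin_subopen, intro ballI)
    fix x assume x: "x \<in> {x \<in> S. f x \<in> W}"
    then obtain V where V: "open V" "x \<in> V" "smooth_map (embedded (S \<inter> V)) N f"
      using assms by blast
    then have "openin (top_of_set S) {x \<in> S \<inter> V. f x \<in> W}"
      using W[OF V(1,3)] openin_trans[of "S \<inter> V" _ S] by (auto simp: openin_open_Int)
    with x V show "\<exists>T. openin (top_of_set S) T \<and> x \<in> T \<and> T \<subseteq> {x \<in> S. f x \<in> W}"
      by (intro exI[of _ "{x \<in> S \<inter> V. f x \<in> W}"]) auto
  qed
  show ?thesis
    unfolding smooth_map_def
  proof (intro conjI allI impI)
    have "f x \<in> points N" if x: "x \<in> S" for x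
    proof -
      obtain V where "open V" "x \<in> V" "smooth_map (embedded (S \<inter> V)) N f"
        using assms[OF x] by blast
      with x show ?thesis
        using smooth_map_points[of "embedded (S \<inter> V)" N f x] by simp
    qed
    moreover have "openin (top_of_set S) {x \<in> S. f x \<in> W}" if "openin (space_top N) W" for W
      by (rule open_sub) (use that in \<open>auto simp: smooth_map_def dest!: openin_continuous_map_preimage\<close>)
    ultimately show "continuous_map (space_top (embedded S)) (space_top N) f"
      by (simp add: continuous_map_def)
  next
    fix W h assume h: "smooth_fun N W h"
    have loc: "openin (top_of_set (S \<inter> V)) {x \<in> S \<inter> V. f x \<in> W} \<and> smooth_ext {x \<in> S \<inter> V. f x \<in> W} (h \<circ> f)"
      if "smooth_map (embedded (S \<inter> V)) N f" for V
    proof -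
      have "smooth_fun (embedded (S \<inter> V)) {x \<in> S \<inter> V. f x \<in> W} (h \<circ> f)"
        using that h by (simp add: smooth_map_def)
      then show ?thesis
        by (simp only: smooth_fun_embedded)
    qed
    have "smooth_ext {x \<in> S. f x \<in> W} (h \<circ> f)"
    proof (rule smooth_ext_local)
      fix p assume "p \<in> {x \<in> S. f x \<in> W}"
      then obtain V where V: "open V" "p \<in> V" "smooth_map (embedded (S \<inter> V)) N f"
        using assms by blast
      moreover have "{x \<in> S. f x \<in> W} \<inter> V = {x \<in> S \<inter> V. f x \<in> W}"
        by auto
      ultimately show "\<exists>V. open V \<and> p \<in> V \<and> smooth_ext ({x \<in> S. f x \<in> W} \<inter> V) (h \<circ> f)"
        using loc by metis
    qed
    with open_sub[of W] loc show "smooth_fun (embedded S) {x \<in> points (embedded S). f x \<in> W} (h \<circ> f)"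
      by (simp add: smooth_fun_embedded)
  qed
qed

subsection \<open>Smooth maps, velocities and homotheties\<close>

lemma smooth_map_pullback:
  "smooth_map M N f \<Longrightarrow> smooth_fun N V g \<Longrightarrow> smooth_fun M {x \<in> points M. f x \<in> V} (g \<circ> f)"
  by (simp add: smooth_map_def)

lemma smooth_map_compose:
  assumes f: "smooth_map M N f" and g: "smooth_map N K g"
  shows "smooth_map M K (g \<circ> f)"
  unfolding smooth_map_def
proof (intro conjI allI impI)
  show "continuous_map (space_top M) (space_top K) (g \<circ> f)"
    using f g continuous_map_compose unfolding smooth_map_def by blast
next
  fix V h assume "smooth_fun K V h"
  then have "smooth_fun M {x \<in> points M. f x \<in> {y \<in> points N. g y \<in> V}} ((h \<circ> g) \<circ> f)"
    by (intro smooth_map_pullback[OF f] smooth_map_pullback[OF g])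
  moreover have "{x \<in> points M. f x \<in> {y \<in> points N. g y \<in> V}} = {x \<in> points M. (g \<circ> f) x \<in> V}"
    using smooth_map_points[OF f] by auto
  ultimately show "smooth_fun M {x \<in> points M. (g \<circ> f) x \<in> V} (h \<circ> (g \<circ> f))"
    by (simp add: o_assoc)
qed

lemma diffeomorphism_compose:
  assumes "diffeomorphism M N f" "diffeomorphism N K g"
  shows "diffeomorphism M K (g \<circ> f)"
proof -
  obtain f' g' where
    "smooth_map N M f'" "\<forall>x\<in>points M. f' (f x) = x" "\<forall>y\<in>points N. f (f' y) = y"
    "smooth_map K N g'" "\<forall>x\<in>points N. g' (g x) = x" "\<forall>y\<in>points K. g (g' y) = y"
    using assms unfolding diffeomorphism_def by blast
  then show ?thesis
    using assms unfolding diffeomorphism_def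
    by (intro conjI exI[of _ "f' \<circ> g'"]) (auto intro: smooth_map_compose dest: smooth_map_points)
qed

definition smooth_curve :: "('a, 'z) smooth_space_scheme \<Rightarrow> (real \<Rightarrow> 'a) \<Rightarrow> bool" where
  "smooth_curve M \<gamma> \<longleftrightarrow> (\<exists>\<epsilon>>0. smooth_map (embedded {-\<epsilon><..<\<epsilon>}) M \<gamma>)"

lemma tangent_space_iff:
  "D \<in> tangent_space M p \<longleftrightarrow> (\<exists>\<gamma>. D = velocity M \<gamma> \<and> \<gamma> 0 = p \<and> smooth_curve M \<gamma>)"
  by (auto simp: tangent_space_def smooth_curve_def)

lemma tangent_spaceE:
  assumes "D \<in> tangent_space M p"
  obtains \<gamma> where "D = velocity M \<gamma>" "\<gamma> 0 = p" "smooth_curve M \<gamma>"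
  using assms by (auto simp: tangent_space_iff)

lemma smooth_curve_points: "smooth_curve M \<gamma> \<Longrightarrow> \<gamma> 0 \<in> points M"
  by (auto simp: smooth_curve_def dest!: smooth_map_points[where x = 0])

lemma smooth_curve_compose: "smooth_curve M \<gamma> \<Longrightarrow> smooth_map M N f \<Longrightarrow> smooth_curve N (f \<circ> \<gamma>)"
  using smooth_map_compose unfolding smooth_curve_def by blast

lemma smooth_near_compose:
  "smooth_map M N f \<Longrightarrow> p \<in> points M \<Longrightarrow> smooth_near N (f p) g \<Longrightarrow> smooth_near M p (g \<circ> f)"
  unfolding smooth_near_def
  by (elim exE conjE) (rule exI, rule conjI[rotated], erule (1) smooth_map_pullback, simp)

lemma differential_velocity:
  assumes "smooth_map M N f" "\<gamma> 0 \<in> points M"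
  shows "differential N f (\<gamma> 0) (velocity M \<gamma>) = velocity N (f \<circ> \<gamma>)"
  using smooth_near_compose[OF assms] by (auto simp: differential_def velocity_def fun_eq_iff)

text \<open>\<open>deriv\<close> at 0 sees only the germ of the curve; the values of a total
  function far from 0 are arbitrary.\<close>

lemma velocity_cong:
  assumes "e > 0" "\<And>t. -e < t \<Longrightarrow> t < e \<Longrightarrow> \<gamma> t = \<delta> t"
  shows "velocity M \<gamma> = velocity M \<delta>"
proof -
  have "\<forall>\<^sub>F t in nhds 0. \<gamma> t = \<delta> t"
    using assms by (auto simp: eventually_nhds intro!: exI[of _ "{-e<..<e}"])
  then have "deriv (\<lambda>t. f (\<gamma> t)) 0 = deriv (\<lambda>t. f (\<delta> t)) 0" for f :: "'a \<Rightarrow> real"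
    by (intro deriv_cong_ev) (auto elim: eventually_mono)
  then have "velocity M \<gamma> f = velocity M \<delta> f" for f
    using assms(1) assms(2)[of 0] by (simp add: velocity_def)
  then show ?thesis
    by blast
qed

lemma differential_in_tangent_space:
  assumes "smooth_map M N f" "D \<in> tangent_space M p"
  shows "differential N f p D \<in> tangent_space N (f p)"
proof -
  obtain \<gamma> where \<gamma>: "D = velocity M \<gamma>" "\<gamma> 0 = p" "smooth_curve M \<gamma>"
    using assms(2) by (rule tangent_spaceE)
  then have "differential N f p D = velocity N (f \<circ> \<gamma>)"
    using differential_velocity[of M N f \<gamma>] assms(1) smooth_curve_points[OF \<gamma>(3)] by simp
  with \<gamma> show ?thesis
    unfolding tangent_space_iff using smooth_curve_compose[OF \<gamma>(3) assms(1)] by auto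
qed

lemma differential_compose:
  assumes "smooth_map M N f" "smooth_map N K g" "D \<in> tangent_space M p"
  shows "differential K (g \<circ> f) p D = differential K g (f p) (differential N f p D)"
proof -
  obtain \<gamma> where \<gamma>: "D = velocity M \<gamma>" "\<gamma> 0 = p" "smooth_curve M \<gamma>"
    using assms(3) by (rule tangent_spaceE)
  then have p: "\<gamma> 0 \<in> points M"
    using smooth_curve_points by blast
  have "differential N f p D = velocity N (f \<circ> \<gamma>)"
    using differential_velocity[of M N f \<gamma>] assms(1) p \<gamma> by simp
  moreover have "differential K g (f p) (velocity N (f \<circ> \<gamma>)) = velocity K (g \<circ> (f \<circ> \<gamma>))"
    using differential_velocity[of N K g "f \<circ> \<gamma>"] assms(2) smooth_map_points[OF assms(1) p] \<gamma> by simp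
  moreover have "differential K (g \<circ> f) p D = velocity K ((g \<circ> f) \<circ> \<gamma>)"
    using differential_velocity[of M K "g \<circ> f" \<gamma>] smooth_map_compose[OF assms(1,2)] p \<gamma> by simp
  ultimately show ?thesis
    by (simp add: o_assoc)
qed

text \<open>\<open>f\<close> is known to be the identity on the points only; this suffices because a
  smooth curve stays among the points for small times.\<close>

lemma differential_id:
  assumes "\<And>x. x \<in> points M \<Longrightarrow> f x = x" "smooth_map M M f" "D \<in> tangent_space M p"
  shows "differential M f p D = D"
proof -
  obtain \<gamma> where \<gamma>: "D = velocity M \<gamma>" "\<gamma> 0 = p" "smooth_curve M \<gamma>"
    using assms(3) by (rule tangent_spaceE)
  then obtain e where e: "e > 0" "smooth_map (embedded {-e<..<e}) M \<gamma>"
    by (auto simp: smooth_curve_def)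
  have "\<gamma> t \<in> points M" if "-e < t" "t < e" for t
    using smooth_map_points[OF e(2), of t] that by simp
  then have "velocity M (f \<circ> \<gamma>) = velocity M \<gamma>"
    using assms(1) by (intro velocity_cong[OF e(1)]) simp
  with \<gamma> show ?thesis
    using differential_velocity[of M M f \<gamma>] assms(2) smooth_curve_points[OF \<gamma>(3)] by simp
qed

lemma differential_inverse:
  assumes "smooth_map M N f" "smooth_map N M g" "\<And>x. x \<in> points M \<Longrightarrow> g (f x) = x"
    and "D \<in> tangent_space M p"
  shows "differential M g (f p) (differential N f p D) = D"
proof -
  have "differential M (g \<circ> f) p D = D"
    by (rule differential_id) (auto simp: assms intro: smooth_map_compose[OF assms(1,2)])
  then show ?thesis
    using differential_compose[OF assms(1,2,4)] by simp
qed

lemma homothetic_sym: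
  assumes "homothetic M N"
  shows "homothetic N M"
proof -
  obtain f c where f: "diffeomorphism M N f" and c: "c > 0" and
    metric: "\<And>p D D'. p \<in> points M \<Longrightarrow> D \<in> tangent_space M p \<Longrightarrow> D' \<in> tangent_space M p \<Longrightarrow>
      metric N (f p) (differential N f p D) (differential N f p D') = c * metric M p D D'"
    using assms unfolding homothetic_def by blast
  obtain g where g: "smooth_map N M g" "\<And>x. x \<in> points M \<Longrightarrow> g (f x) = x" "\<And>y. y \<in> points N \<Longrightarrow> f (g y) = y"
    and f': "smooth_map M N f"
    using f unfolding diffeomorphism_def by blast
  have "metric M (g q) (differential M g q D) (differential M g q D') = 1 / c * metric N q D D'"
    if q: "q \<in> points N" and D: "D \<in> tangent_space N q" "D' \<in> tangent_space N q" for q D D'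
    using metric[OF smooth_map_points[OF g(1) q]
        differential_in_tangent_space[OF g(1) D(1)] differential_in_tangent_space[OF g(1) D(2)]]
      differential_inverse[OF g(1) f' g(3) D(1)] differential_inverse[OF g(1) f' g(3) D(2)] g(3)[OF q] c
    by simp
  moreover have "diffeomorphism N M g"
    using f' g unfolding diffeomorphism_def by blast
  ultimately show ?thesis
    using c unfolding homothetic_def by (intro exI[of _ g] exI[of _ "1 / c"]) simp
qed

lemma homothetic_trans:
  assumes "homothetic M N" "homothetic N K"
  shows "homothetic M K"
proof -
  obtain f c where f: "diffeomorphism M N f" "c > 0" and
    metric_f: "\<And>p D D'. p \<in> points M \<Longrightarrow> D \<in> tangent_space M p \<Longrightarrow> D' \<in> tangent_space M p \<Longrightarrow>
      metric N (f p) (differential N f p D) (differential N f p D') = c * metric M p D D'"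
    using assms(1) unfolding homothetic_def by blast
  obtain g d where g: "diffeomorphism N K g" "d > 0" and
    metric_g: "\<And>p D D'. p \<in> points N \<Longrightarrow> D \<in> tangent_space N p \<Longrightarrow> D' \<in> tangent_space N p \<Longrightarrow>
      metric K (g p) (differential K g p D) (differential K g p D') = d * metric N p D D'"
    using assms(2) unfolding homothetic_def by blast
  have sm: "smooth_map M N f" "smooth_map N K g"
    using f g by (auto simp: diffeomorphism_def)
  have "metric K ((g \<circ> f) p) (differential K (g \<circ> f) p D) (differential K (g \<circ> f) p D')
      = (d * c) * metric M p D D'"
    if p: "p \<in> points M" "D \<in> tangent_space M p" "D' \<in> tangent_space M p" for p D D'
    using metric_g[OF smooth_map_points[OF sm(1) p(1)]
        differential_in_tangent_space[OF sm(1) p(2)] differential_in_tangent_space[OF sm(1) p(3)]]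
      metric_f[OF p] differential_compose[OF sm p(2)] differential_compose[OF sm p(3)]
    by simp
  with diffeomorphism_compose[OF f(1) g(1)] f(2) g(2) show ?thesis
    unfolding homothetic_def by (intro exI[of _ "g \<circ> f"] exI[of _ "d * c"]) simp
qed

section \<open>Transport of smooth and Riemannian structure along a diffeomorphism\<close>

lemma smooth_map_restrict:
  assumes f: "smooth_map M N f"
    and UV: "\<And>x. x \<in> points M \<Longrightarrow> f x \<in> V \<longleftrightarrow> x \<in> U"
  shows "smooth_map (restrict_to M U) (restrict_to N V) f"
  unfolding smooth_map_def
proof (intro conjI allI impI)
  have "continuous_map (space_top M) (space_top N) f"
    using f by (simp add: smooth_map_def)
  then have "continuous_map (subtopology (space_top M) U) (subtopology (space_top N) V) f"
    using UV by (auto simp: continuous_map_in_subtopology continuous_map_from_subtopology)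
  then show "continuous_map (space_top (restrict_to M U)) (space_top (restrict_to N V)) f"
    by (simp add: restrict_to_def)
next
  fix T g assume g: "smooth_fun (restrict_to N V) T g"
  then have T: "T \<subseteq> V" "smooth_fun N T g"
    by (simp_all add: restrict_to_def)
  then have eq: "{x \<in> points M. x \<in> U \<and> f x \<in> T} = {x \<in> points M. f x \<in> T}"
    using UV by auto
  have "smooth_fun M {x \<in> points M. x \<in> U \<and> f x \<in> T} (g \<circ> f)"
    unfolding eq by (rule smooth_map_pullback[OF f T(2)])
  then show "smooth_fun (restrict_to M U) {x \<in> points (restrict_to M U). f x \<in> T} (g \<circ> f)"
    by (simp add: restrict_to_def conj_ac subset_iff)
qed

text \<open>Functions being total, a space could in principle distinguish functions with equal
  values on \<open>U\<close>. Transport along \<open>f\<close> with inverse \<open>g\<close>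
  replaces \<open>h\<close> by \<open>h \<circ> g \<circ> f\<close>, which agrees with
  \<open>h\<close> on the points only, so this has to be excluded.\<close>

definition values_only :: "('a, 'z) smooth_space_scheme \<Rightarrow> bool" where
  "values_only M \<longleftrightarrow> (\<forall>U f g. smooth_fun M U f \<longrightarrow> (\<forall>x\<in>U. f x = g x) \<longrightarrow> smooth_fun M U g)"

lemma values_only_cong:
  "values_only M \<Longrightarrow> smooth_fun M U f \<Longrightarrow> (\<And>x. x \<in> U \<Longrightarrow> f x = g x) \<Longrightarrow> smooth_fun M U g"
  unfolding values_only_def by metis

lemma smooth_fun_transfer:
  assumes f: "smooth_map M N f" and g: "smooth_map N M g" and gf: "\<And>x. x \<in> points M \<Longrightarrow> g (f x) = x"
    and M: "values_only M" and U: "openin (space_top M) U"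
  shows "smooth_fun M U h \<longleftrightarrow> smooth_fun N {y \<in> points N. g y \<in> U} (h \<circ> g)"
proof
  assume "smooth_fun M U h"
  then show "smooth_fun N {y \<in> points N. g y \<in> U} (h \<circ> g)"
    by (rule smooth_map_pullback[OF g])
next
  assume "smooth_fun N {y \<in> points N. g y \<in> U} (h \<circ> g)"
  then have *: "smooth_fun M {x \<in> points M. f x \<in> {y \<in> points N. g y \<in> U}} (h \<circ> g \<circ> f)"
    by (rule smooth_map_pullback[OF f])
  have eq: "{x \<in> points M. f x \<in> {y \<in> points N. g y \<in> U}} = U"
    using gf smooth_map_points[OF f] openin_subset[OF U] by auto
  from * have "smooth_fun M U (h \<circ> g \<circ> f)"
    unfolding eq .
  then show "smooth_fun M U h"
    by (rule values_only_cong[OF M]) (use gf openin_subset[OF U] in auto)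
qed

text \<open>A chart at \<open>f p\<close> composed with \<open>f\<close> is a chart at
  \<open>p\<close>; the local character of smoothness is checked on \<open>N\<close> and pulled back
  by \<open>smooth_fun_transfer\<close>.\<close>

lemma smooth_manifold_transfer:
  assumes N: "smooth_manifold W N" and diff: "diffeomorphism M N f" and M: "values_only M"
    and M_open: "\<And>U h. smooth_fun M U h \<Longrightarrow> openin (space_top M) U"
  shows "smooth_manifold W M"
proof -
  obtain g where g: "smooth_map N M g" and gf: "\<And>x. x \<in> points M \<Longrightarrow> g (f x) = x"
    and fg: "\<And>y. y \<in> points N \<Longrightarrow> f (g y) = y" and f: "smooth_map M N f"
    using diff unfolding diffeomorphism_def by blast
  have cont: "continuous_map (space_top M) (space_top N) f" "continuous_map (space_top N) (space_top M) g"
    using f g by (simp_all add: smooth_map_def)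
  have vimage_open: "openin (space_top N) {y \<in> points N. g y \<in> U}" if "openin (space_top M) U" for U
    using openin_continuous_map_preimage[OF cont(2) that] .
  have homeo: "space_top M homeomorphic_space space_top N"
    using cont gf fg unfolding homeomorphic_space_def homeomorphic_maps_def by blast
  have haus: "Hausdorff_space (space_top M)"
    using N homeomorphic_Hausdorff_space[OF homeo] by (simp add: smooth_manifold_def)
  have "second_countable (space_top M)"
  proof (rule second_countable_open_map_image)
    show "second_countable (space_top N)"
      using N by (simp add: smooth_manifold_def)
    show "continuous_map (space_top N) (space_top M) g"
      by (rule cont)
    have "homeomorphic_map (space_top N) (space_top M) g"
      using cont gf fg homeomorphic_maps_map[of "space_top N" "space_top M" g f]
      by (simp add: homeomorphic_maps_def)
    then show "open_map (space_top N) (space_top M) g" "g ` points N = points M"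
      by (simp_all add: homeomorphic_imp_open_map homeomorphic_imp_surjective_map)
  qed
  moreover have "smooth_fun M U h \<longleftrightarrow>
      openin (space_top M) U \<and> (\<forall>p\<in>U. \<exists>V. p \<in> V \<and> V \<subseteq> U \<and> smooth_fun M V h)" (is "_ \<longleftrightarrow> _ \<and> ?local")
    for U h
  proof
    assume U: "openin (space_top M) U \<and> ?local"
    have ex: "\<exists>V. q \<in> V \<and> V \<subseteq> {y \<in> points N. g y \<in> U} \<and> smooth_fun N V (h \<circ> g)"
      if q: "q \<in> {y \<in> points N. g y \<in> U}" for q
    proof -
      obtain V where V: "g q \<in> V" "V \<subseteq> U" "smooth_fun M V h"
        using U q by blast
      show ?thesis
        by (rule exI[of _ "{y \<in> points N. g y \<in> V}"]) (use q V smooth_map_pullback[OF g] in auto)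
    qed
    have sheaf: "\<forall>U f. smooth_fun N U f \<longleftrightarrow>
        openin (space_top N) U \<and> (\<forall>p \<in> U. \<exists>V. p \<in> V \<and> V \<subseteq> U \<and> smooth_fun N V f)"
      using N unfolding smooth_manifold_def by (elim conjE)
    have "smooth_fun N {y \<in> points N. g y \<in> U} (h \<circ> g)"
      by (rule sheaf[THEN spec, THEN spec, THEN iffD2], intro conjI ballI vimage_open ex)
        (rule conjunct1[OF U])
    then show "smooth_fun M U h"
      using smooth_fun_transfer[OF f g gf M] U by simp
  qed (use M_open in auto)
  moreover have "\<exists>U W' \<phi>. openin (space_top M) U \<and> p \<in> U \<and> openin (top_of_set W) W' \<and>
        diffeomorphism (restrict_to M U) (embedded W') \<phi>" if p: "p \<in> points M" for p
  proof -
    obtain U W' \<phi> where U: "openin (space_top N) U" "f p \<in> U" "openin (top_of_set W) W'"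
      "diffeomorphism (restrict_to N U) (embedded W') \<phi>"
      using N smooth_map_points[OF f p] unfolding smooth_manifold_def by blast
    let ?U = "{x \<in> points M. f x \<in> U}"
    have "diffeomorphism (restrict_to M ?U) (restrict_to N U) f"
      unfolding diffeomorphism_def
    proof (intro conjI exI[of _ g] ballI)
      show "smooth_map (restrict_to M ?U) (restrict_to N U) f"
        by (rule smooth_map_restrict[OF f]) simp
      show "smooth_map (restrict_to N U) (restrict_to M ?U) g"
        by (rule smooth_map_restrict[OF g]) (use fg smooth_map_points[OF g] in auto)
    qed (use fg gf in \<open>auto simp: restrict_to_def\<close>)
    then have "diffeomorphism (restrict_to M ?U) (embedded W') (\<phi> \<circ> f)"
      using U(4) by (rule diffeomorphism_compose)
    then show ?thesis
      using U p openin_continuous_map_preimage[OF cont(1) U(1)]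
      by (intro exI[of _ ?U] exI[of _ W'] exI[of _ "\<phi> \<circ> f"]) simp
  qed
  moreover have "subspace W"
    using N by (simp add: smooth_manifold_def)
  ultimately show ?thesis
    using haus unfolding smooth_manifold_def by blast
qed

lemma smooth_nearI:
  assumes "smooth_fun N V h" "q \<in> V"
  shows "smooth_near N q h"
  using assms unfolding smooth_near_def by blast

text \<open>The homothety relates the metrics on tangent vectors of \<open>M\<close> only. Linearity
  of the metric therefore requires that linear combinations of tangent vectors of \<open>M\<close>
  are again velocities; \<open>N_tangent\<close> provides this on \<open>N\<close>, and the
  differential of the inverse carries it to \<open>M\<close>. \<open>N_scale\<close> absorbs the
  factor \<open>1 / c\<close>.\<close>

lemma riemannian_manifold_transfer:
  assumes N: "riemannian_manifold W N" and hom: "homothetic M N"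
    and M: "values_only M" "\<And>U h. smooth_fun M U h \<Longrightarrow> openin (space_top M) U"
    and N_values: "values_only N"
    and N_scale: "\<And>U h r. smooth_fun N U h \<Longrightarrow> smooth_fun N U (\<lambda>x. r * h x)"
    and N_tangent: "\<And>q D D' a b. D \<in> tangent_space N q \<Longrightarrow> D' \<in> tangent_space N q \<Longrightarrow>
      (\<lambda>h. a * D h + b * D' h) \<in> tangent_space N q"
  shows "riemannian_manifold W M"
proof -
  obtain f c where diff: "diffeomorphism M N f" and c: "c > 0" and
    metric: "\<And>p D D'. p \<in> points M \<Longrightarrow> D \<in> tangent_space M p \<Longrightarrow> D' \<in> tangent_space M p \<Longrightarrow>
      metric N (f p) (differential N f p D) (differential N f p D') = c * metric M p D D'"
    using hom unfolding homothetic_def by blast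
  obtain g where g: "smooth_map N M g" and gf: "\<And>x. x \<in> points M \<Longrightarrow> g (f x) = x"
    and fg: "\<And>y. y \<in> points N \<Longrightarrow> f (g y) = y" and f: "smooth_map M N f"
    using diff unfolding diffeomorphism_def by blast
  note df = differential_in_tangent_space[OF f]
  have N_sym: "metric N q D D' = metric N q D' D"
    and N_lin: "metric N q (\<lambda>h. a * D h + b * D' h) D'' = a * metric N q D D'' + b * metric N q D' D''"
    and N_pos: "D \<noteq> (\<lambda>h. 0) \<Longrightarrow> metric N q D D > 0"
    if "q \<in> points N" "D \<in> tangent_space N q" "D' \<in> tangent_space N q" "D'' \<in> tangent_space N q"
    for q D D' D'' a b
    using N that unfolding riemannian_manifold_def by blast+
  have N_smooth: "smooth_fun N U (\<lambda>p. metric N p (X p) (Y p))"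
    if "openin (space_top N) U" "vector_field_on N U X" "vector_field_on N U Y" for U X Y
    using N that unfolding riemannian_manifold_def by blast
  have metric_M: "metric M p D D' = metric N (f p) (differential N f p D) (differential N f p D') / c"
    if "p \<in> points M" "D \<in> tangent_space M p" "D' \<in> tangent_space M p" for p D D'
    using metric[OF that] c by simp
  have df_comb: "differential N f p (\<lambda>h. a * D h + b * D' h) =
      (\<lambda>h. a * differential N f p D h + b * differential N f p D' h)" for p D D' a b
    by (auto simp: differential_def fun_eq_iff)
  have dg_comb: "differential M g q (\<lambda>h. a * D h + b * D' h) =
      (\<lambda>h. a * differential M g q D h + b * differential M g q D' h)" for q D D' a b
    by (auto simp: differential_def fun_eq_iff)
  have dgf: "differential M g (f p) (differential N f p D) = D"
    if "D \<in> tangent_space M p" for p D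
    using differential_inverse[OF f g gf that] by simp
  have M_tangent: "(\<lambda>h. a * D h + b * D' h) \<in> tangent_space M p"
    if p: "p \<in> points M" and D: "D \<in> tangent_space M p" "D' \<in> tangent_space M p" for p D D' a b
  proof -
    let ?E = "\<lambda>h. a * differential N f p D h + b * differential N f p D' h"
    have "differential M g (f p) ?E \<in> tangent_space M (g (f p))"
      by (intro differential_in_tangent_space[OF g] N_tangent df D)
    then show ?thesis
      unfolding dg_comb dgf[OF D(1)] dgf[OF D(2)] gf[OF p] .
  qed
  have M_smooth: "smooth_fun M U (\<lambda>p. metric M p (X p) (Y p))"
    if U: "openin (space_top M) U" and X: "vector_field_on M U X" and Y: "vector_field_on M U Y" for U X Y
  proof -
    let ?U = "{q \<in> points N. g q \<in> U}"
    have U_points: "p \<in> points M" if "p \<in> U" for p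
      using openin_subset[OF U] that by blast
    \<comment> \<open>The push-forward of a vector field along \<open>f\<close>: its value on
      \<open>h\<close> is that of the original field on \<open>h \<circ> f\<close>, pulled back by
      \<open>g\<close>.\<close>
    have push: "vector_field_on N ?U (\<lambda>q. differential N f (g q) (Z (g q)))"
      if Z: "vector_field_on M U Z" for Z
      unfolding vector_field_on_def
    proof (intro conjI ballI allI impI)
      fix q assume q: "q \<in> ?U"
      then have "Z (g q) \<in> tangent_space M (g q)"
        using Z by (simp add: vector_field_on_def)
      from df[OF this] show "differential N f (g q) (Z (g q)) \<in> tangent_space N q"
        using fg q by simp
    next
      fix V h assume V: "V \<subseteq> ?U \<and> smooth_fun N V h"
      let ?V = "{p \<in> points M. f p \<in> V}"
      have "smooth_fun M ?V (h \<circ> f)"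
        using V smooth_map_pullback[OF f] by blast
      moreover have "?V \<subseteq> U"
        using V gf by force
      ultimately have "smooth_fun M ?V (\<lambda>p. Z p (h \<circ> f))"
        using Z unfolding vector_field_on_def by blast
      then have "smooth_fun N {q \<in> points N. g q \<in> ?V} ((\<lambda>p. Z p (h \<circ> f)) \<circ> g)"
        by (rule smooth_map_pullback[OF g])
      moreover have "{q \<in> points N. g q \<in> ?V} = V"
        using V fg smooth_map_points[OF g] by force
      ultimately have "smooth_fun N V ((\<lambda>p. Z p (h \<circ> f)) \<circ> g)"
        by simp
      then show "smooth_fun N V (\<lambda>q. differential N f (g q) (Z (g q)) h)"
      proof (rule values_only_cong[OF N_values])
        \<comment> \<open>The differential is 0 by convention on functions that are not smooth near
          the point, so the equation needs \<open>h\<close> to be smooth near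
          \<open>q\<close>.\<close>
        fix q assume q: "q \<in> V"
        then have "smooth_near N (f (g q)) h"
          using V fg smooth_nearI[of N V h q] by auto
        then show "((\<lambda>p. Z p (h \<circ> f)) \<circ> g) q = differential N f (g q) (Z (g q)) h"
          by (simp add: differential_def)
      qed
    qed
    have "smooth_fun N ?U (\<lambda>q. metric N q (differential N f (g q) (X (g q))) (differential N f (g q) (Y (g q))))"
      using f g U by (intro N_smooth push X Y) (auto simp: smooth_map_def intro: openin_continuous_map_preimage)
    then have "smooth_fun N ?U (\<lambda>q. 1 / c * metric N q (differential N f (g q) (X (g q))) (differential N f (g q) (Y (g q))))"
      by (rule N_scale)
    then have "smooth_fun N ?U ((\<lambda>p. metric M p (X p) (Y p)) \<circ> g)"
    proof (rule values_only_cong[OF N_values])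
      fix q assume q: "q \<in> ?U"
      then have "X (g q) \<in> tangent_space M (g q)" "Y (g q) \<in> tangent_space M (g q)"
        using X Y by (simp_all add: vector_field_on_def)
      then show "1 / c * metric N q (differential N f (g q) (X (g q))) (differential N f (g q) (Y (g q)))
        = ((\<lambda>p. metric M p (X p) (Y p)) \<circ> g) q"
        using metric_M[of "g q" "X (g q)" "Y (g q)"] smooth_map_points[OF g, of q] fg[of q] q by simp
    qed
    then show ?thesis
      using smooth_fun_transfer[OF f g gf M(1) U] by blast
  qed
  have sm: "smooth_manifold W M"
    by (rule smooth_manifold_transfer[OF _ diff M]) (use N in \<open>unfold riemannian_manifold_def, elim conjE\<close>)
  have M_metric: "metric M p D D' = metric M p D' D"
    "metric M p (\<lambda>h. a * D h + b * D' h) D'' = a * metric M p D D'' + b * metric M p D' D''"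
    "D \<noteq> (\<lambda>h. 0) \<Longrightarrow> metric M p D D > 0"
    if p: "p \<in> points M" and D: "D \<in> tangent_space M p" "D' \<in> tangent_space M p" "D'' \<in> tangent_space M p"
    for p D D' D'' a b
  proof -
    have fp: "f p \<in> points N"
      using smooth_map_points[OF f p] .
    show "metric M p D D' = metric M p D' D"
      using N_sym[OF fp df[OF D(1)] df[OF D(2)] df[OF D(3)]] metric_M p D by simp
    show "metric M p (\<lambda>h. a * D h + b * D' h) D'' = a * metric M p D D'' + b * metric M p D' D''"
      using N_lin[OF fp df[OF D(1)] df[OF D(2)] df[OF D(3)]] metric_M p D M_tangent[OF p D(1,2)]
      by (simp add: df_comb add_divide_distrib)
    \<comment> \<open>A nonzero vector stays nonzero, because the differential of \<open>g\<close>
      sends zero to zero and undoes that of \<open>f\<close>.\<close>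
    assume "D \<noteq> (\<lambda>h. 0)"
    moreover have "differential M g (f p) (\<lambda>h. 0) = (\<lambda>h. 0)"
      by (simp add: differential_def)
    ultimately have "differential N f p D \<noteq> (\<lambda>h. 0)"
      using dgf[OF D(1)] by auto
    then show "metric M p D D > 0"
      using N_pos[OF fp df[OF D(1)] df[OF D(1)] df[OF D(1)]] metric_M p D c by simp
  qed
  show ?thesis
    unfolding riemannian_manifold_def
    by (intro conjI ballI allI impI sm M_metric M_smooth) auto
qed

subsection \<open>Tangent vectors of subsets of Euclidean space\<close>

lemma smooth_curve_embeddedE:
  assumes "smooth_curve (embedded S) \<gamma>"
  obtains v e where "(\<gamma> has_vector_derivative v) (at 0)" "e > 0" "\<And>t. \<bar>t\<bar> < e \<Longrightarrow> \<gamma> t \<in> S"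
proof -
  obtain e where e: "e > 0" "\<gamma> ` {-e<..<e} \<subseteq> S" "smooth_ext {-e<..<e} \<gamma>"
    using assms by (auto simp: smooth_curve_def smooth_map_embedded_iff)
  have "(0::real) \<in> {-e<..<e}"
    using e by simp
  then obtain V G where V: "open V" "0 \<in> V" "smooth_on V G" "\<And>t. t \<in> {-e<..<e} \<Longrightarrow> t \<in> V \<Longrightarrow> \<gamma> t = G t"
    using smooth_extE[OF e(3)] by blast
  then obtain v where "(G has_vector_derivative v) (at 0)"
    using smooth_on_imp_differentiable vector_derivative_works by blast
  then have "(\<gamma> has_vector_derivative v) (at 0)"
    by (rule has_vector_derivative_transform_within_open[of _ _ _ "{-e<..<e} \<inter> V"]) (use e V in auto)
  with e that show thesis
    by (auto simp: image_subset_iff abs_less_iff)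
qed

text \<open>\<open>F'\<close> is the derivative at \<open>p\<close> of one local extension of
  \<open>f\<close>. It is chosen before the curve, so the velocity of every curve through
  \<open>p\<close> acts on \<open>f\<close> through its ambient vector only, and linearly.\<close>

lemma smooth_near_embedded_linear:
  assumes "smooth_near (embedded S) p f"
  obtains F' where "linear F'"
    "\<And>\<gamma> v. smooth_curve (embedded S) \<gamma> \<Longrightarrow> \<gamma> 0 = p \<Longrightarrow> (\<gamma> has_vector_derivative v) (at 0) \<Longrightarrow>
      velocity (embedded S) \<gamma> f = F' v"
proof -
  obtain U where U: "p \<in> U" "openin (top_of_set S) U" "smooth_ext U f"
    using assms by (auto simp: smooth_near_def smooth_fun_embedded)
  then obtain A where A: "open A" "U = S \<inter> A"
    by (auto simp: openin_open)
  obtain V F where V: "open V" "p \<in> V" "smooth_on V F" "\<And>y. y \<in> U \<Longrightarrow> y \<in> V \<Longrightarrow> f y = F y"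
    using smooth_extE[OF U(3,1)] by blast
  obtain F' where F': "(F has_derivative F') (at p)"
    using smooth_on_imp_differentiable[OF V(3,2)] by (auto simp: differentiable_def)
  have "velocity (embedded S) \<gamma> f = F' v"
    if \<gamma>: "smooth_curve (embedded S) \<gamma>" "\<gamma> 0 = p" and v: "(\<gamma> has_vector_derivative v) (at 0)" for \<gamma> v
  proof -
    obtain e where e: "e > 0" "\<And>t. \<bar>t\<bar> < e \<Longrightarrow> \<gamma> t \<in> S"
      using smooth_curve_embeddedE[OF \<gamma>(1)] by metis
    \<comment> \<open>Continuity keeps the curve, for small times, in the region where
      \<open>f\<close> is given by its extension \<open>F\<close>.\<close>
    have "isCont \<gamma> 0"
      using v has_derivative_continuous unfolding has_vector_derivative_def by blast
    then obtain B where B: "open B" "0 \<in> B" "\<And>t. t \<in> B \<Longrightarrow> \<gamma> t \<in> A \<inter> V"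
      using U A V \<gamma> unfolding continuous_at_open by (metis Int_iff open_Int)
    have "((\<lambda>t. F (\<gamma> t)) has_vector_derivative F' v) (at 0)"
      using has_derivative_compose[OF v[unfolded has_vector_derivative_def], of F F'] F' \<gamma>
        linear_scale[OF has_derivative_linear[OF F']]
      by (simp add: has_vector_derivative_def)
    then have "((\<lambda>t. f (\<gamma> t)) has_vector_derivative F' v) (at 0)"
    proof (rule has_vector_derivative_transform_within_open[of _ _ _ "B \<inter> {-e<..<e}"])
      fix t assume t: "t \<in> B \<inter> {-e<..<e}"
      then have "\<gamma> t \<in> S"
        using e(2)[of t] by (simp add: abs_less_iff)
      with t show "F (\<gamma> t) = f (\<gamma> t)"
        using B(3)[of t] A V(4)[of "\<gamma> t"] by simp
    qed (use B e in auto)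
    then have "deriv (\<lambda>t. f (\<gamma> t)) 0 = F' v"
      by (simp add: DERIV_imp_deriv has_real_derivative_iff_has_vector_derivative)
    then show ?thesis
      using assms \<gamma> by (simp add: velocity_def)
  qed
  then show thesis
    using that has_derivative_linear[OF F'] by blast
qed

lemma smooth_fun_coordinate: "smooth_fun (embedded S) S (\<lambda>y. y \<bullet> b)"
  using smooth_on_linear[of "\<lambda>y. y \<bullet> b" UNIV]
  by (auto simp: smooth_fun_embedded linear_iff inner_add_left intro: smooth_on_imp_smooth_ext)

lemma ambient_velocity:
  assumes \<gamma>: "smooth_curve (embedded S) \<gamma>" and v: "(\<gamma> has_vector_derivative v) (at 0)"
  shows "ambient_vector (velocity (embedded S) \<gamma>) = v"
proof -
  have "velocity (embedded S) \<gamma> (\<lambda>y. y \<bullet> b) = v \<bullet> b" for b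
  proof -
    have "smooth_near (embedded S) (\<gamma> 0) (\<lambda>y. y \<bullet> b)"
      unfolding smooth_near_def
      by (rule exI[of _ S]) (use smooth_curve_points[OF \<gamma>] smooth_fun_coordinate in auto)
    moreover have "((\<lambda>t. \<gamma> t \<bullet> b) has_real_derivative v \<bullet> b) (at 0)"
      using bounded_linear.has_vector_derivative[OF bounded_linear_inner_left v]
      by (simp add: has_real_derivative_iff_has_vector_derivative)
    ultimately show ?thesis
      by (simp add: velocity_def DERIV_imp_deriv)
  qed
  then show ?thesis
    by (simp add: ambient_vector_def euclidean_representation)
qed

lemma tangent_embeddedE:
  assumes "D \<in> tangent_space (embedded S) p"
  obtains \<gamma> where "D = velocity (embedded S) \<gamma>" "\<gamma> 0 = p" "smooth_curve (embedded S) \<gamma>"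
    "(\<gamma> has_vector_derivative ambient_vector D) (at 0)"
proof -
  obtain \<gamma> where \<gamma>: "D = velocity (embedded S) \<gamma>" "\<gamma> 0 = p" "smooth_curve (embedded S) \<gamma>"
    using assms by (rule tangent_spaceE)
  obtain v e where "(\<gamma> has_vector_derivative v) (at 0)"
    using smooth_curve_embeddedE[OF \<gamma>(3)] by metis
  then show thesis
    using that \<gamma> ambient_velocity[OF \<gamma>(3)] by blast
qed

lemma tangent_embedded_not_near:
  assumes "D \<in> tangent_space (embedded S) p" "\<not> smooth_near (embedded S) p f"
  shows "D f = 0"
  using assms(2) by (rule_tac tangent_spaceE[OF assms(1)]) (simp add: velocity_def)

lemma tangent_embedded_linear:
  assumes "smooth_near (embedded S) p f"
  obtains F' where "linear F'"
    "\<And>D. D \<in> tangent_space (embedded S) p \<Longrightarrow> D f = F' (ambient_vector D)"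
proof -
  obtain F' where F': "linear F'"
    "\<And>\<gamma> v. smooth_curve (embedded S) \<gamma> \<Longrightarrow> \<gamma> 0 = p \<Longrightarrow> (\<gamma> has_vector_derivative v) (at 0) \<Longrightarrow>
      velocity (embedded S) \<gamma> f = F' v"
    using smooth_near_embedded_linear[OF assms] by blast
  have "D f = F' (ambient_vector D)" if D: "D \<in> tangent_space (embedded S) p" for D
    using tangent_embeddedE[OF D] F'(2) by metis
  with F'(1) that show thesis
    by blast
qed

text \<open>A tangent vector is determined by its ambient vector: on functions smooth near
  \<open>p\<close> it acts through a common linear map, on all others it is 0 by convention. A
  velocity \<open>D''\<close> with the combined ambient vector has to be supplied.\<close>

lemma tangent_embedded_combination:
  assumes "D \<in> tangent_space (embedded S) p" "D' \<in> tangent_space (embedded S) p"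
    "D'' \<in> tangent_space (embedded S) p"
    and eq: "ambient_vector D'' = a *\<^sub>R ambient_vector D + b *\<^sub>R ambient_vector D'"
  shows "D'' = (\<lambda>f. a * D f + b * D' f)"
proof
  fix f
  show "D'' f = a * D f + b * D' f"
  proof (cases "smooth_near (embedded S) p f")
    case True
    obtain F' where F': "linear F'" "\<And>D. D \<in> tangent_space (embedded S) p \<Longrightarrow> D f = F' (ambient_vector D)"
      using tangent_embedded_linear[OF True] by blast
    show ?thesis
      unfolding F'(2)[OF assms(1)] F'(2)[OF assms(2)] F'(2)[OF assms(3)] eq
      using F'(1) by (simp add: linear_add linear_scale)
  next
    case False
    then show ?thesis
      using tangent_embedded_not_near[OF assms(1)] tangent_embedded_not_near[OF assms(2)]
        tangent_embedded_not_near[OF assms(3)] by simp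
  qed
qed

lemma tangent_embedded_eqI:
  assumes "D \<in> tangent_space (embedded S) p" "D' \<in> tangent_space (embedded S) p"
    "ambient_vector D = ambient_vector D'"
  shows "D = D'"
  using tangent_embedded_combination[OF assms(2) assms(2) assms(1), of 1 0] assms(3) by simp

lemma ambient_vector_combination:
  "ambient_vector (\<lambda>f. a * D f + b * D' f) = a *\<^sub>R ambient_vector D + b *\<^sub>R ambient_vector D'"
  by (simp add: ambient_vector_def algebra_simps sum.distrib scaleR_sum_right)

lemma tangent_embedded_zero:
  assumes "D \<in> tangent_space (embedded S) p" "ambient_vector D = 0"
  shows "D = (\<lambda>f. 0)"
  using tangent_embedded_combination[OF assms(1) assms(1) assms(1), of 0 0] assms(2) by simp

subsection \<open>Projection matrices\<close>

notation transpose ("_\<^sup>T" [1000] 1000)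

lemma bounded_bilinear_matrix_mult:
  "bounded_bilinear ((**) :: real^'m^'n \<Rightarrow> real^'l^'m \<Rightarrow> real^'l^'n)"
  by (simp add: bilinear_conv_bounded_bilinear[symmetric] bilinear_def linear_iff)
     (simp add: matrix_matrix_mult_def vec_eq_iff algebra_simps sum.distrib sum_distrib_left)

lemmas matrix_mult_distrib =
  bounded_bilinear.add_left[OF bounded_bilinear_matrix_mult]
  bounded_bilinear.add_right[OF bounded_bilinear_matrix_mult]
  bounded_bilinear.diff_left[OF bounded_bilinear_matrix_mult]
  bounded_bilinear.diff_right[OF bounded_bilinear_matrix_mult]
  bounded_bilinear.minus_left[OF bounded_bilinear_matrix_mult]
  bounded_bilinear.minus_right[OF bounded_bilinear_matrix_mult]
  bounded_bilinear.zero_left[OF bounded_bilinear_matrix_mult]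
  bounded_bilinear.zero_right[OF bounded_bilinear_matrix_mult]
  bounded_bilinear.scaleR_left[OF bounded_bilinear_matrix_mult]
  bounded_bilinear.scaleR_right[OF bounded_bilinear_matrix_mult]

lemma transpose_distrib:
  fixes A B :: "real^'m^'n"
  shows "(A + B)\<^sup>T = A\<^sup>T + B\<^sup>T" "(A - B)\<^sup>T = A\<^sup>T - B\<^sup>T" "(- A)\<^sup>T = - A\<^sup>T"
    "(0 :: real^'m^'n)\<^sup>T = 0"
  by (simp_all add: transpose_def vec_eq_iff)

lemmas matrix_expand = matrix_mul_assoc[symmetric] matrix_mult_distrib transpose_distrib
  matrix_transpose_mul transpose_scalar

text \<open>Products are normalised to be nested to the right, where \<open>A ** B\<close> is not a
  subterm of \<open>A ** (B ** X)\<close>; this form lets a relation such as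
  \<open>P ** P = P\<close> rewrite inside longer products.\<close>

lemma matrix_mult_left_cong: "A ** B = C \<Longrightarrow> A ** (B ** X) = C ** X"
  for A :: "real^'m^'n" and B :: "real^'k^'m" and X :: "real^'l^'k"
  by (simp add: matrix_mul_assoc)

lemma trace_transpose: "trace (A\<^sup>T) = trace A"
  by (simp add: trace_def transpose_def)

text \<open>The squared Frobenius norm. Its positivity drives both the uniqueness argument for
  projections and the positivity of the metric.\<close>

lemma trace_gram: "trace (A\<^sup>T ** A) = (\<Sum>j\<in>UNIV. \<Sum>i\<in>UNIV. (A $ i $ j)\<^sup>2)" for A :: "real^'m^'n"
  by (simp add: trace_def matrix_matrix_mult_def transpose_def power2_eq_square)

lemma trace_gram_pos: "A \<noteq> 0 \<Longrightarrow> trace (A\<^sup>T ** A) > 0" for A :: "real^'m^'n"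
proof -
  assume "A \<noteq> 0"
  then obtain i j where "A $ i $ j \<noteq> 0"
    by (auto simp: vec_eq_iff)
  then have "(\<Sum>i\<in>UNIV. (A $ i $ j)\<^sup>2) > 0"
    by (intro sum_pos2[of UNIV i]) auto
  then show ?thesis
    unfolding trace_gram by (intro sum_pos2[of UNIV j]) (auto intro: sum_nonneg)
qed

lemma matrix_inv_unique:
  fixes A B :: "real^'n^'n"
  assumes "A ** B = mat 1"
  shows "matrix_inv A = B"
proof -
  have "invertible A"
    using assms invertible_right_inverse by blast
  then have "matrix_inv A = matrix_inv A ** (A ** B)"
    by (simp add: assms)
  also have "\<dots> = B"
    using \<open>invertible A\<close> by (simp add: matrix_mul_assoc matrix_inv_mult)
  finally show ?thesis .
qed

lemma transpose_matrix_inv: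
  fixes A :: "real^'n^'n"
  assumes "invertible A"
  shows "(matrix_inv A)\<^sup>T = matrix_inv (A\<^sup>T)"
proof -
  have "A\<^sup>T ** (matrix_inv A)\<^sup>T = mat 1"
    using assms by (simp flip: matrix_transpose_mul add: matrix_inv_mult)
  then show ?thesis
    by (simp add: matrix_inv_unique)
qed

text \<open>\<open>x \<bullet> ((A\<^sup>T ** A) *v x)\<close> is the squared norm of
  \<open>A *v x\<close>, so the Gram matrix and \<open>A\<close> have the same kernel.\<close>

lemma gram_invertible_iff: "invertible (A\<^sup>T ** A) \<longleftrightarrow> rank A = CARD('k)" for A :: "real^'k^'n"
proof
  assume "invertible (A\<^sup>T ** A)"
  then have "(matrix_inv (A\<^sup>T ** A) ** A\<^sup>T) ** A = mat 1"
    by (simp add: matrix_mul_assoc[symmetric] matrix_inv_mult)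
  then show "rank A = CARD('k)"
    using full_rank_injective matrix_left_invertible_injective by blast
next
  assume "rank A = CARD('k)"
  then have inj: "inj ((*v) A)"
    by (simp add: full_rank_injective)
  have "x = y" if "(A\<^sup>T ** A) *v x = (A\<^sup>T ** A) *v y" for x y
  proof -
    have "(A\<^sup>T ** A) *v (x - y) = 0"
      using that by (simp add: matrix_vector_mult_diff_distrib)
    then have "(x - y) \<bullet> (A\<^sup>T *v (A *v (x - y))) = 0"
      unfolding matrix_vector_mul_assoc by simp
    then have "(A *v (x - y)) \<bullet> (A *v (x - y)) = 0"
      using dot_lmul_matrix[of "A *v (x - y)" A "x - y"] by (simp add: inner_commute)
    then have "A *v x = A *v y"
      by (simp add: matrix_vector_mult_diff_distrib)
    with inj show ?thesis
      by (simp add: inj_eq)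
  qed
  then show "invertible (A\<^sup>T ** A)"
    using invertible_left_inverse matrix_left_invertible_injective injI by metis
qed

definition projections :: "nat \<Rightarrow> (real^'n^'n) set" where
  "projections k = {P. P\<^sup>T = P \<and> P = P ** P \<and> trace P = real k}"

lemma projectionsD:
  assumes "P \<in> projections k"
  shows "P\<^sup>T = P" "P ** P = P" "trace P = real k"
  using assms by (auto simp: projections_def)

text \<open>The difference \<open>E\<close> of two nested projections of equal trace is a symmetric idempotent, so
  \<open>tr (E\<^sup>T E) = tr E = 0\<close>.\<close>

lemma projection_eqI:
  assumes "P \<in> projections k" "R \<in> projections k" "P ** R = R"
  shows "P = R"
proof -
  note P = projectionsD[OF assms(1)] and R = projectionsD[OF assms(2)]
  have RP: "R ** P = R"
    using arg_cong[OF assms(3), of transpose] P R by (simp add: matrix_transpose_mul)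
  have "(P - R)\<^sup>T ** (P - R) = P - R"
    using P R RP assms(3) by (simp add: matrix_expand)
  then have "trace ((P - R)\<^sup>T ** (P - R)) = 0"
    using P R by (simp add: trace_sub)
  then show ?thesis
    using trace_gram_pos[of "P - R"] by force
qed

text \<open>The formula of the normal equations for the orthogonal projection onto the span of the
  columns, meaningful if these are independent.\<close>

definition col_proj :: "real^'k^'n \<Rightarrow> real^'n^'n" where
  "col_proj A = A ** matrix_inv (A\<^sup>T ** A) ** A\<^sup>T"

lemma gram_inv_symmetric:
  fixes A :: "real^'k^'n"
  assumes "invertible (A\<^sup>T ** A)"
  shows "(matrix_inv (A\<^sup>T ** A))\<^sup>T = matrix_inv (A\<^sup>T ** A)"
  using transpose_matrix_inv[OF assms] by (simp add: matrix_transpose_mul)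

lemma col_proj_mult:
  fixes A :: "real^'k^'n"
  assumes "invertible (A\<^sup>T ** A)"
  shows "col_proj A ** A = A"
  using assms by (simp add: col_proj_def matrix_mul_assoc[symmetric] matrix_inv_mult)

text \<open>Cyclicity turns the trace into that of the identity matrix of size
  \<open>CARD('k)\<close>.\<close>

lemma col_proj_in_projections:
  fixes A :: "real^'k^'n"
  assumes "invertible (A\<^sup>T ** A)"
  shows "col_proj A \<in> projections CARD('k)"
proof -
  have "(col_proj A)\<^sup>T = col_proj A"
    by (simp add: col_proj_def gram_inv_symmetric[OF assms] matrix_transpose_mul matrix_mul_assoc)
  moreover have "col_proj A ** col_proj A = col_proj A"
  proof -
    have "col_proj A ** col_proj A = (col_proj A ** A) ** matrix_inv (A\<^sup>T ** A) ** A\<^sup>T"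
      by (simp add: col_proj_def matrix_mul_assoc)
    then show ?thesis
      by (simp add: col_proj_mult[OF assms]) (simp add: col_proj_def)
  qed
  moreover have "trace (col_proj A) = trace (A\<^sup>T ** (A ** matrix_inv (A\<^sup>T ** A)))"
    unfolding col_proj_def by (rule trace_mul_sym)
  then have "trace (col_proj A) = real CARD('k)"
    by (simp add: matrix_mul_assoc matrix_inv_mult[OF assms] trace_I)
  ultimately show ?thesis
    by (simp add: projections_def)
qed

text \<open>Since \<open>P\<close> fixes the columns of \<open>A\<close>, it fixes the range of
  \<open>col_proj A\<close>, and nested projections of equal trace coincide. This is how projections
  are recognised in charts, sections and orbits.\<close>

lemma col_proj_eqI:
  fixes A :: "real^'k^'n"
  assumes "P \<in> projections CARD('k)" "invertible (A\<^sup>T ** A)" "P ** A = A"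
  shows "col_proj A = P"
proof -
  have "P ** col_proj A = col_proj A"
    using assms(3) by (simp add: col_proj_def matrix_mul_assoc)
  then show ?thesis
    using projection_eqI[OF assms(1) col_proj_in_projections[OF assms(2)]] by simp
qed

lemma smooth_on_col_proj:
  fixes f :: "'a::euclidean_space \<Rightarrow> real^'k^'n"
  assumes "smooth_on V f" "open V" "\<And>x. x \<in> V \<Longrightarrow> invertible ((f x)\<^sup>T ** f x)"
  shows "smooth_on V (\<lambda>x. col_proj (f x))"
  unfolding col_proj_def
  by (intro smooth_on_matrix_mult smooth_on_matrix_inv smooth_on_transpose assms(1,2))
     (use assms(3) in \<open>simp add: invertible_det_nz\<close>)

lemma open_invertible:
  fixes f :: "'a::euclidean_space \<Rightarrow> real^'k^'k"
  assumes "smooth_on V f" "open V"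
  shows "open {x \<in> V. invertible (f x)}"
proof -
  have "smooth_on V (\<lambda>x. det (f x))"
    using assms(1) smooth_on_matrix by (intro smooth_on_det) blast
  from smooth_on_imp_open_vimage[OF this assms(2), of "- {0}"] show ?thesis
    by (simp add: invertible_det_nz open_Compl)
qed

subsection \<open>Cayley curves\<close>

text \<open>A skew matrix satisfies \<open>z \<bullet> (S *v z) = 0\<close>, so
  \<open>S *v z = z\<close> forces \<open>z = 0\<close>.\<close>

lemma invertible_one_minus_skew:
  fixes S :: "real^'n^'n"
  assumes "S\<^sup>T = - S"
  shows "invertible (mat 1 - S)"
proof -
  have "x = y" if "(mat 1 - S) *v x = (mat 1 - S) *v y" for x y
  proof -
    define z where "z = x - y"
    have "(mat 1 - S) *v z = 0"
      using that by (simp add: z_def matrix_vector_mult_diff_distrib)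
    then have z: "z = S *v z"
      by (simp add: matrix_vector_mult_diff_rdistrib)
    have "z \<bullet> (S *v z) = (S\<^sup>T *v z) \<bullet> z"
      by (simp add: dot_lmul_matrix)
    also have "\<dots> = - (z \<bullet> (S *v z))"
      using matrix_vector_mult_diff_rdistrib[of 0 S z] by (simp add: assms inner_commute)
    finally have "z \<bullet> z = 0"
      using z by simp
    then show ?thesis
      by (simp add: z_def)
  qed
  then show ?thesis
    using invertible_left_inverse matrix_left_invertible_injective injI by metis
qed

text \<open>Transposition exchanges \<open>mat 1 + S\<close> and \<open>mat 1 - S\<close>, and these
  two commute.\<close>

lemma cayley_orthogonal:
  fixes S :: "real^'n^'n"
  assumes "S\<^sup>T = - S"
  shows "orthogonal_matrix ((mat 1 + S) ** matrix_inv (mat 1 - S))"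
proof -
  let ?I = "matrix_inv (mat 1 - S)"
  have inv: "invertible (mat 1 - S)"
    by (rule invertible_one_minus_skew[OF assms])
  have tr: "(mat 1 - S)\<^sup>T = mat 1 + S"
    using assms by (simp add: transpose_distrib)
  have comm: "(mat 1 + S) ** (mat 1 - S) = (mat 1 - S) ** (mat 1 + S)"
    by (simp add: matrix_mult_distrib)
  have "?I\<^sup>T ** (mat 1 + S) = mat 1"
    using arg_cong[OF matrix_inv_mult(1)[OF inv], of transpose] tr by (simp add: matrix_transpose_mul)
  then have "?I\<^sup>T ** ((mat 1 + S) ** X) = X" for X :: "real^'n^'n"
    by (simp add: matrix_mul_assoc)
  moreover have "((mat 1 + S) ** ?I)\<^sup>T ** ((mat 1 + S) ** ?I) = ?I\<^sup>T ** ((mat 1 - S) ** (mat 1 + S) ** ?I)"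
    using assms by (simp add: matrix_transpose_mul transpose_distrib matrix_mul_assoc)
  ultimately have "((mat 1 + S) ** ?I)\<^sup>T ** ((mat 1 + S) ** ?I) = (mat 1 - S) ** ?I"
    unfolding comm[symmetric] by (simp add: matrix_mul_assoc[symmetric])
  then show ?thesis
    by (simp add: orthogonal_matrix matrix_inv_mult[OF inv])
qed

text \<open>A Cayley curve replaces the matrix exponential: it is rational in \<open>t\<close>,
  hence smooth by the smoothness of matrix inversion. Its velocity comes from differentiating
  \<open>C t ** (mat 1 - S t) = mat 1 + S t\<close>, which avoids differentiating an
  inverse.\<close>

lemma orthogonal_curve_exists:
  fixes \<Omega> :: "real^'n^'n"
  assumes "\<Omega>\<^sup>T = - \<Omega>"
  obtains C :: "real \<Rightarrow> real^'n^'n" where "smooth_on UNIV C" "\<And>t. orthogonal_matrix (C t)" "C 0 = mat 1"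
    "(C has_vector_derivative \<Omega>) (at 0)"
proof -
  \<comment> \<open>The factor 1/2 compensates for the two factors of the Cayley transform, each of
    which contributes the velocity of \<open>S\<close> once.\<close>
  define S where "S t = (t / 2) *\<^sub>R \<Omega>" for t :: real
  define C where "C t = (mat 1 + S t) ** matrix_inv (mat 1 - S t)" for t
  have S: "(S t)\<^sup>T = - S t" for t
    using assms by (simp add: S_def transpose_scalar)
  have sm_S: "smooth_on UNIV S"
    unfolding S_def by (intro smooth_on_linear) (simp add: linear_iff algebra_simps add_divide_distrib)
  have sm: "smooth_on UNIV C"
    unfolding C_def
    by (intro smooth_intros smooth_on_matrix_inv sm_S)
       (use invertible_one_minus_skew[OF S] in \<open>auto simp: invertible_det_nz\<close>)
  have C0: "C 0 = mat 1"
    by (simp add: C_def S_def matrix_inv_unique)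
  have "C differentiable (at 0)"
    by (rule smooth_on_imp_differentiable[OF sm]) simp
  then obtain C' where C': "(C has_vector_derivative C') (at 0)"
    using vector_derivative_works by blast
  have S': "(S has_vector_derivative (1 / 2) *\<^sub>R \<Omega>) (at 0)"
    unfolding S_def by (auto intro!: derivative_eq_intros simp: has_vector_derivative_def)
  have "((\<lambda>t. C t ** (mat 1 - S t)) has_vector_derivative
      C 0 ** (0 - (1 / 2) *\<^sub>R \<Omega>) + C' ** (mat 1 - S 0)) (at 0)"
    by (intro bounded_bilinear.has_vector_derivative[OF bounded_bilinear_matrix_mult]
        has_vector_derivative_diff has_vector_derivative_const S' C')
  moreover have "C t ** (mat 1 - S t) = mat 1 + S t" for t
    using matrix_inv_mult(2)[OF invertible_one_minus_skew[OF S]]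
    by (simp add: C_def matrix_mul_assoc[symmetric])
  moreover have "((\<lambda>t. mat 1 + S t) has_vector_derivative 0 + (1 / 2) *\<^sub>R \<Omega>) (at 0)"
    by (intro has_vector_derivative_add has_vector_derivative_const S')
  ultimately have "C 0 ** (0 - (1 / 2) *\<^sub>R \<Omega>) + C' ** (mat 1 - S 0) = 0 + (1 / 2) *\<^sub>R \<Omega>"
    using vector_derivative_unique_at by (metis (no_types, lifting) ext)
  then have "C' = (1 / 2) *\<^sub>R \<Omega> + (1 / 2) *\<^sub>R \<Omega>"
    by (simp add: C0 S_def algebra_simps)
  then have "C' = \<Omega>"
    by (simp flip: scaleR_add_left)
  with sm C0 C' that[of C] cayley_orthogonal[OF S] show thesis
    by (simp add: C_def)
qed

subsection \<open>Gram--Schmidt orthonormalisation\<close>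

text \<open>Expansion over bases reduces every bilinear operation to products of real functions; it
  serves inner products, matrix-vector products and the trace form.\<close>

lemma smooth_on_bilinear:
  fixes f :: "'a::euclidean_space \<Rightarrow> 'b::euclidean_space" and g :: "'a \<Rightarrow> 'c::euclidean_space"
    and h :: "'b \<Rightarrow> 'c \<Rightarrow> 'd::euclidean_space"
  assumes "bilinear h" "smooth_on V f" "smooth_on V g"
  shows "smooth_on V (\<lambda>x. h (f x) (g x))"
proof -
  have expand: "h u v = (\<Sum>b\<in>Basis. \<Sum>c\<in>Basis. ((u \<bullet> b) * (v \<bullet> c)) *\<^sub>R h b c)" for u v
  proof -
    have "h u v = h (\<Sum>b\<in>Basis. (u \<bullet> b) *\<^sub>R b) (\<Sum>c\<in>Basis. (v \<bullet> c) *\<^sub>R c)"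
      by (simp add: euclidean_representation)
    also have "\<dots> = (\<Sum>(b, c)\<in>Basis \<times> Basis. h ((u \<bullet> b) *\<^sub>R b) ((v \<bullet> c) *\<^sub>R c))"
      by (rule bilinear_sum[OF assms(1)])
    also have "\<dots> = (\<Sum>(b, c)\<in>Basis \<times> Basis. ((u \<bullet> b) * (v \<bullet> c)) *\<^sub>R h b c)"
      by (simp add: bilinear_lmul[OF assms(1)] bilinear_rmul[OF assms(1)] mult.commute)
    finally show ?thesis
      by (simp add: sum.cartesian_product)
  qed
  have "smooth_on V (\<lambda>x. \<Sum>b\<in>Basis. \<Sum>c\<in>Basis. ((f x \<bullet> b) * (g x \<bullet> c)) *\<^sub>R h b c)"
    using assms(2,3)
    by (intro smooth_on_sum smooth_on_scaleR smooth_on_mult smooth_on_const finite_Basis)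
       (simp_all add: smooth_on_def)
  then show ?thesis
    by (subst expand)
qed

definition positive_definite :: "real^'m^'m \<Rightarrow> bool" where
  "positive_definite N \<longleftrightarrow> N\<^sup>T = N \<and> (\<forall>x. x \<noteq> 0 \<longrightarrow> x \<bullet> (N *v x) > 0)"

definition block_diagonal :: "'m set \<Rightarrow> real^'m^'m \<Rightarrow> bool" where
  "block_diagonal T N \<longleftrightarrow> (\<forall>i j. (i \<in> T) \<noteq> (j \<in> T) \<longrightarrow> N $ i $ j = 0)"

text \<open>The procedure is applied to the standard basis, for the inner product given by
  \<open>N\<close>. The index type carries no order, so basis vectors are added one at a time along
  a finite set \<open>J\<close>. Positive definite matrices are symmetric and in general do not form
  an open set of matrices, while smoothness needs an open domain; therefore the formulas live on an
  open set \<open>A\<close>, and orthonormality is claimed at positive definite matrices. The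
  support clause guarantees that each new vector is nonzero. The block clause says that vectors of
  different blocks, being orthogonal for a block diagonal \<open>N\<close>, are never mixed.\<close>

lemma gram_schmidt:
  fixes J :: "'m::finite set"
  assumes "finite J"
  shows "\<exists>A (r :: 'm \<Rightarrow> real^'m^'m \<Rightarrow> real^'m). open A \<and> (\<forall>j\<in>J. smooth_on A (r j)) \<and>
    (\<forall>N. positive_definite N \<longrightarrow> N \<in> A \<and>
       (\<forall>i\<in>J. \<forall>j\<in>J. r i N \<bullet> (N *v r j N) = (if i = j then 1 else 0)) \<and>
       (\<forall>j\<in>J. \<forall>i. i \<notin> J \<longrightarrow> r j N $ i = 0) \<and>
       (\<forall>T. block_diagonal T N \<longrightarrow> (\<forall>j\<in>J. \<forall>i. (i \<in> T) \<noteq> (j \<in> T) \<longrightarrow> r j N $ i = 0)))"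
  using assms
proof (induction J rule: finite_induct)
  case empty
  show ?case by (intro exI[of _ UNIV]) auto
next
  case (insert c J)
  obtain A and r :: "'m \<Rightarrow> real^'m^'m \<Rightarrow> real^'m" where H: "open A" "\<forall>j\<in>J. smooth_on A (r j)"
    "\<forall>N. positive_definite N \<longrightarrow> N \<in> A \<and>
       (\<forall>i\<in>J. \<forall>j\<in>J. r i N \<bullet> (N *v r j N) = (if i = j then 1 else 0)) \<and>
       (\<forall>j\<in>J. \<forall>i. i \<notin> J \<longrightarrow> r j N $ i = 0) \<and>
       (\<forall>T. block_diagonal T N \<longrightarrow> (\<forall>j\<in>J. \<forall>i. (i \<in> T) \<noteq> (j \<in> T) \<longrightarrow> r j N $ i = 0))"
    using insert.IH by (elim exE conjE) (rule that)
  have A: "open A" "\<And>N. positive_definite N \<Longrightarrow> N \<in> A"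
    using H by simp_all
  have sm: "smooth_on A (r j)" if "j \<in> J" for j
    using H(2) that by simp
  have orth: "r i N \<bullet> (N *v r j N) = (if i = j then 1 else 0)"
    if "positive_definite N" "i \<in> J" "j \<in> J" for N i j
    using H(3) that by simp
  have supp: "r j N $ i = 0" if "positive_definite N" "j \<in> J" "i \<notin> J" for N i j
    using H(3) that by simp
  have block: "r j N $ i = 0"
    if "positive_definite N" "block_diagonal T N" "j \<in> J" "(i \<in> T) \<noteq> (j \<in> T)" for N T i j
    using H(3)[THEN spec[of _ N]] that by blast
  \<comment> \<open>\<open>w N\<close> is the basis vector at \<open>c\<close> minus its component
    along the earlier vectors, \<open>s N\<close> its squared length, both for the form
    \<open>N\<close>; \<open>A'\<close> is where normalisation by the square root of
    \<open>s\<close> is smooth.\<close>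
  define a where "a N j = r j N \<bullet> (N *v axis c 1)" for N j
  define w where "w N = axis c 1 - (\<Sum>j\<in>J. a N j *\<^sub>R r j N)" for N
  define s where "s N = w N \<bullet> (N *v w N)" for N
  define A' where "A' = {N \<in> A. s N \<in> {0<..}}"
  define r' where "r' j N = (if j = c then (1 / sqrt (s N)) *\<^sub>R w N else r j N)" for j N
  have bil: "bilinear ((*v) :: real^'m^'m \<Rightarrow> real^'m \<Rightarrow> real^'m)" "bilinear ((\<bullet>) :: real^'m \<Rightarrow> real^'m \<Rightarrow> real)"
    by (simp_all add: bilinear_def linear_iff algebra_simps scaleR_matrix_vector_assoc)
  have sm_w: "smooth_on A w"
    unfolding w_def a_def
    by (intro smooth_on_diff smooth_on_const smooth_on_sum smooth_on_scaleR sm insert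
        smooth_on_bilinear[OF bil(2)] smooth_on_bilinear[OF bil(1)] smooth_on_id)
  have sm_s: "smooth_on A s"
    unfolding s_def
    by (intro smooth_on_bilinear[OF bil(2)] smooth_on_bilinear[OF bil(1)] smooth_on_id sm_w)
  have A': "open A'"
    unfolding A'_def by (rule smooth_on_imp_open_vimage[OF sm_s A(1)]) simp
  have "A' \<subseteq> A"
    by (auto simp: A'_def)
  then have sm_r': "smooth_on A' (r' j)" if "j \<in> insert c J" for j
  proof (cases "j = c")
    case True
    have "smooth_on A' (\<lambda>N. (1 / sqrt (s N)) *\<^sub>R w N)"
      by (intro smooth_on_scaleR smooth_on_divide smooth_on_const smooth_on_sqrt
          smooth_on_subset[OF sm_s \<open>A' \<subseteq> A\<close>] smooth_on_subset[OF sm_w \<open>A' \<subseteq> A\<close>])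
         (auto simp: A'_def)
    with True show ?thesis
      by (simp add: r'_def[abs_def])
  next
    case False
    then show ?thesis
      using that smooth_on_subset[OF sm \<open>A' \<subseteq> A\<close>] by (simp add: r'_def[abs_def])
  qed
  have pd: "N \<in> A' \<and>
       (\<forall>i\<in>insert c J. \<forall>j\<in>insert c J. r' i N \<bullet> (N *v r' j N) = (if i = j then 1 else 0)) \<and>
       (\<forall>j\<in>insert c J. \<forall>i. i \<notin> insert c J \<longrightarrow> r' j N $ i = 0) \<and>
       (\<forall>T. block_diagonal T N \<longrightarrow> (\<forall>j\<in>insert c J. \<forall>i. (i \<in> T) \<noteq> (j \<in> T) \<longrightarrow> r' j N $ i = 0))"
    if N: "positive_definite N" for N
  proof -
    have sym: "u \<bullet> (N *v v) = v \<bullet> (N *v u)" for u v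
      using N dot_lmul_matrix[of v N u] transpose_matrix_vector[of N v]
      by (simp add: positive_definite_def inner_commute)
    \<comment> \<open>The earlier vectors vanish at position \<open>c\<close>, so subtracting them
      does not change this entry.\<close>
    have "w N $ c = 1"
      using supp[OF N] insert by (simp add: w_def)
    then have "w N \<noteq> 0"
      by auto
    then have s: "s N > 0"
      using N by (simp add: s_def positive_definite_def)
    have rw: "r i N \<bullet> (N *v w N) = 0" if "i \<in> J" for i
    proof -
      have "r i N \<bullet> (N *v w N) = a N i - (\<Sum>j\<in>J. a N j * (r i N \<bullet> (N *v r j N)))"
        by (simp add: w_def a_def matrix_vector_mult_diff_distrib inner_diff_right inner_sum_right
            linear_sum[OF matrix_vector_mul_linear] matrix_vector_mult_scaleR)
      also have "(\<Sum>j\<in>J. a N j * (r i N \<bullet> (N *v r j N))) = (\<Sum>j\<in>J. if j = i then a N j else 0)"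
        by (intro sum.cong) (auto simp: orth[OF N that])
      finally show ?thesis
        using that insert by simp
    qed
    have "r' i N \<bullet> (N *v r' j N) = (if i = j then 1 else 0)" if "i \<in> insert c J" "j \<in> insert c J" for i j
    proof -
      have "w N \<bullet> (N *v w N) = sqrt (s N) * sqrt (s N)"
        using s by (simp add: s_def)
      then show ?thesis
        using that s insert(2) rw orth[OF N] sym[of "w N" "r j N"]
        by (auto simp: r'_def matrix_vector_mult_scaleR)
    qed
    moreover have "r' j N $ i = 0" if "j \<in> insert c J" "i \<notin> insert c J" for i j
      using that supp[OF N] by (auto simp: r'_def w_def axis_def)
    moreover have "r' j N $ i = 0"
      if T: "block_diagonal T N" and j: "j \<in> insert c J" and ij: "(i \<in> T) \<noteq> (j \<in> T)" for T i j
    proof (cases "j = c")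
      case True
      \<comment> \<open>If \<open>l\<close> and \<open>c\<close> lie in the same block, then
        \<open>r l N\<close> vanishes at \<open>i\<close>; otherwise the coefficient
        \<open>a N l\<close> is 0, because \<open>r l N\<close> and column \<open>c\<close> of
        \<open>N\<close> have disjoint supports.\<close>
      have "a N l *\<^sub>R r l N $ i = 0" if l: "l \<in> J" for l
      proof (cases "(l \<in> T) = (c \<in> T)")
        case True
        then show ?thesis
          using block[OF N T l] ij \<open>j = c\<close> by auto
      next
        case False
        have "r l N $ m * N $ m $ c = 0" for m
          using block[OF N T l, of m] T False by (cases "(m \<in> T) = (l \<in> T)") (auto simp: block_diagonal_def)
        then have "(\<Sum>m\<in>UNIV. r l N $ m * N $ m $ c) = 0"
          by (intro sum.neutral) blast
        then have "a N l = 0"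
          by (simp add: a_def inner_vec_def matrix_vector_mult_basis column_def)
        then show ?thesis
          by simp
      qed
      then have "(\<Sum>l\<in>J. a N l *\<^sub>R r l N $ i) = 0"
        by (intro sum.neutral) blast
      then have "w N $ i = 0"
        using ij True by (auto simp: w_def axis_def)
      with True show ?thesis
        by (simp add: r'_def)
    next
      case False
      with j ij block[OF N T] show ?thesis
        by (auto simp: r'_def)
    qed
    ultimately show ?thesis
      using s A(2)[OF N] by (simp add: A'_def)
  qed
  show ?case
    using A' sm_r' pd by (intro exI[of _ A'] exI[of _ r']) blast
qed

text \<open>The columns of \<open>R N\<close> are the Gram--Schmidt vectors for
  \<open>J = UNIV\<close>; congruence with \<open>R N\<close> turns \<open>N\<close> into the
  identity while respecting every block decomposition that \<open>N\<close> respects.\<close>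

lemma smooth_orthonormalisation:
  obtains A and R :: "real^'m^'m \<Rightarrow> real^'m^'m" where "open A" "smooth_on A R"
    "\<And>N. positive_definite N \<Longrightarrow> N \<in> A" "\<And>N. positive_definite N \<Longrightarrow> (R N)\<^sup>T ** N ** R N = mat 1"
    "\<And>N T. positive_definite N \<Longrightarrow> block_diagonal T N \<Longrightarrow> block_diagonal T (R N)"
proof -
  obtain A and r :: "'m \<Rightarrow> real^'m^'m \<Rightarrow> real^'m" where
    A: "open A" "\<And>j. smooth_on A (r j)" and
    r: "\<And>N. positive_definite N \<Longrightarrow> N \<in> A \<and>
       (\<forall>i j. r i N \<bullet> (N *v r j N) = (if i = j then 1 else 0)) \<and>
       (\<forall>T. block_diagonal T N \<longrightarrow> (\<forall>j i. (i \<in> T) \<noteq> (j \<in> T) \<longrightarrow> r j N $ i = 0))"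
    using gram_schmidt[of "UNIV :: 'm set"] by auto
  define R where "R N = (\<chi> i j. r j N $ i)" for N
  have "smooth_on A (\<lambda>N. r j N $ i)" for i j
    using A(2)[of j] by (auto simp: smooth_on_def Basis_vec_def inner_axis)
  then have "smooth_on A R"
    by (simp add: smooth_on_matrix[of A R] R_def)
  moreover have "(R N)\<^sup>T ** N ** R N = mat 1" if "positive_definite N" for N
  proof -
    have "((R N)\<^sup>T ** N ** R N) $ i $ j = r i N \<bullet> (N *v r j N)" for i j
      unfolding matrix_mul_assoc[symmetric]
      by (simp add: R_def matrix_matrix_mult_def transpose_def inner_vec_def matrix_vector_mult_def)
    then show ?thesis
      using r[OF that] by (simp add: vec_eq_iff mat_def)
  qed
  moreover have "block_diagonal T (R N)" if "positive_definite N" "block_diagonal T N" for N T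
    using r[OF that(1)] that(2) by (auto simp: block_diagonal_def R_def)
  ultimately show thesis
    using that[of A R] A(1) r by blast
qed

subsection \<open>The block embedding and adapted orthonormal frames\<close>

text \<open>The inclusion of the first block. The second block has no index type of its own, so
  block statements are phrased through this matrix and the coordinate projection
  \<open>emb_proj\<close>.\<close>

definition emb :: "('k::finite \<Rightarrow> 'n::finite) \<Rightarrow> real^'k^'n" where
  "emb \<iota> = (\<chi> i a. if i = \<iota> a then 1 else 0)"

definition emb_proj :: "('k::finite \<Rightarrow> 'n::finite) \<Rightarrow> real^'n^'n" where
  "emb_proj \<iota> = emb \<iota> ** (emb \<iota>)\<^sup>T"

lemma mult_emb_nth: "(X ** emb \<iota>) $ i $ b = X $ i $ \<iota> b"
proof -
  have "(X ** emb \<iota>) $ i $ b = (\<Sum>l\<in>UNIV. X $ i $ l * (if l = \<iota> b then 1 else 0))"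
    by (simp add: matrix_matrix_mult_def emb_def)
  also have "\<dots> = (\<Sum>l\<in>UNIV. if l = \<iota> b then X $ i $ l else 0)"
    by (intro sum.cong) auto
  finally show ?thesis
    by simp
qed

lemma emb_gram:
  assumes "inj \<iota>"
  shows "(emb \<iota>)\<^sup>T ** emb \<iota> = mat 1"
  using inj_eq[OF assms] by (auto simp: vec_eq_iff mult_emb_nth mat_def) (auto simp: emb_def transpose_def)

lemma emb_proj_nth:
  assumes "inj \<iota>"
  shows "emb_proj \<iota> $ i $ j = (if i = j \<and> i \<in> range \<iota> then 1 else 0)"
proof -
  have *: "emb_proj \<iota> $ i $ j = (\<Sum>b\<in>UNIV. emb \<iota> $ i $ b * emb \<iota> $ j $ b)"
    by (simp add: emb_proj_def matrix_matrix_mult_def transpose_def)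
  show ?thesis
  proof (cases "i \<in> range \<iota>")
    case True
    then obtain a where a: "i = \<iota> a"
      by blast
    have "emb_proj \<iota> $ i $ j = (\<Sum>b\<in>UNIV. if b = a then (if j = \<iota> a then 1 else 0) else 0)"
      unfolding * by (intro sum.cong) (auto simp: emb_def a inj_eq[OF assms])
    then show ?thesis
      using a by auto
  next
    case False
    then have "emb_proj \<iota> $ i $ j = 0"
      unfolding * by (intro sum.neutral) (auto simp: emb_def)
    with False show ?thesis
      by simp
  qed
qed

lemma emb_proj_simps:
  assumes "inj \<iota>"
  shows "(emb_proj \<iota>)\<^sup>T = emb_proj \<iota>" "emb_proj \<iota> ** emb_proj \<iota> = emb_proj \<iota>"
    "emb_proj \<iota> ** emb \<iota> = emb \<iota>" "(emb \<iota>)\<^sup>T ** emb_proj \<iota> = (emb \<iota>)\<^sup>T"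
    "emb \<iota> ** (emb \<iota>)\<^sup>T = emb_proj \<iota>"
  by (simp_all add: emb_proj_def emb_gram[OF assms] matrix_transpose_mul matrix_mul_assoc[symmetric]
      matrix_mult_left_cong[OF emb_gram[OF assms]])

lemma mult_emb_proj_nth:
  assumes "inj \<iota>"
  shows "(X ** emb_proj \<iota>) $ i $ j = (if j \<in> range \<iota> then X $ i $ j else 0)"
    "(emb_proj \<iota> ** Y) $ i $ j = (if i \<in> range \<iota> then Y $ i $ j else 0)"
proof -
  have "(X ** emb_proj \<iota>) $ i $ j = (\<Sum>l\<in>UNIV. X $ i $ l * emb_proj \<iota> $ l $ j)"
    by (simp add: matrix_matrix_mult_def)
  also have "\<dots> = (\<Sum>l\<in>UNIV. if l = j then (if j \<in> range \<iota> then X $ i $ j else 0) else 0)"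
    by (intro sum.cong) (auto simp: emb_proj_nth[OF assms])
  finally show "(X ** emb_proj \<iota>) $ i $ j = (if j \<in> range \<iota> then X $ i $ j else 0)"
    by simp
  have "(emb_proj \<iota> ** Y) $ i $ j = (\<Sum>l\<in>UNIV. emb_proj \<iota> $ i $ l * Y $ l $ j)"
    by (simp add: matrix_matrix_mult_def)
  also have "\<dots> = (\<Sum>l\<in>UNIV. if l = i then (if i \<in> range \<iota> then Y $ i $ j else 0) else 0)"
    by (intro sum.cong) (auto simp: emb_proj_nth[OF assms])
  finally show "(emb_proj \<iota> ** Y) $ i $ j = (if i \<in> range \<iota> then Y $ i $ j else 0)"
    by simp
qed

text \<open>Trades an entrywise condition for a matrix identity, which algebraic rewriting can
  handle.\<close>

lemma block_diagonal_iff_commute: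
  assumes "inj \<iota>"
  shows "block_diagonal (range \<iota>) X \<longleftrightarrow> emb_proj \<iota> ** X = X ** emb_proj \<iota>"
  unfolding block_diagonal_def vec_eq_iff mult_emb_proj_nth[OF assms] by auto

lemma off_block_iff: "B \<in> off_block \<iota> \<longleftrightarrow> B ** emb \<iota> = 0"
  by (simp add: off_block_def vec_eq_iff mult_emb_nth)

text \<open>The off-block condition confines the two products to the two off-diagonal blocks, so the
  case distinction in \<open>skew_block\<close> becomes matrix algebra.\<close>

lemma skew_block_eq:
  assumes "inj \<iota>" "B \<in> off_block \<iota>"
  shows "skew_block \<iota> B = emb \<iota> ** B - B\<^sup>T ** (emb \<iota>)\<^sup>T"
proof -
  have 1: "(emb \<iota> ** B) $ i $ j = (if i \<in> range \<iota> then B $ inv \<iota> i $ j else 0)" for i j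
  proof -
    have *: "(emb \<iota> ** B) $ i $ j = (\<Sum>a\<in>UNIV. emb \<iota> $ i $ a * B $ a $ j)"
      by (simp add: matrix_matrix_mult_def)
    show ?thesis
    proof (cases "i \<in> range \<iota>")
      case True
      then obtain a where a: "i = \<iota> a"
        by blast
      have "(emb \<iota> ** B) $ i $ j = (\<Sum>b\<in>UNIV. if b = a then B $ a $ j else 0)"
        unfolding * by (intro sum.cong) (auto simp: emb_def a inj_eq[OF assms(1)])
      with a show ?thesis
        using assms(1) by simp
    next
      case False
      then have "(emb \<iota> ** B) $ i $ j = 0"
        unfolding * by (intro sum.neutral) (auto simp: emb_def)
      with False show ?thesis
        by simp
    qed
  qed
  have 2: "(B\<^sup>T ** (emb \<iota>)\<^sup>T) $ i $ j = (if j \<in> range \<iota> then B $ inv \<iota> j $ i else 0)" for i j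
    unfolding matrix_transpose_mul[symmetric] by (simp add: transpose_def 1)
  have "B $ a $ j = 0" if "j \<in> range \<iota>" for a j
    using that assms(2) by (auto simp: off_block_def)
  then show ?thesis
    by (simp add: vec_eq_iff skew_block_def 1 2)
qed

text \<open>The columns are orthonormal bases of the eigenspaces for 1 and 0, arranged so that the
  first block receives the eigenvalue 1. Such an arrangement exists because the trace is the
  dimension of the first eigenspace.\<close>

lemma projection_frame:
  fixes \<iota> :: "'k::finite \<Rightarrow> 'n::finite" and P :: "real^'n^'n"
  assumes inj: "inj \<iota>" and P: "P \<in> projections CARD('k)"
  obtains V where "orthogonal_matrix V" "P ** V = V ** emb_proj \<iota>"
proof -
  note P' = projectionsD[OF P]
  have PP: "P *v (P *v x) = P *v x" for x
    by (simp add: matrix_vector_mul_assoc P')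
  have sub: "subspace {x. P *v x = x}" "subspace {x. P *v x = 0}"
    by (auto simp: subspace_def matrix_vector_right_distrib matrix_vector_mult_scaleR)
  obtain B1 where B1: "B1 \<subseteq> {x. P *v x = x}" "pairwise orthogonal B1" "\<And>x. x \<in> B1 \<Longrightarrow> norm x = 1"
    "independent B1" "card B1 = dim {x. P *v x = x}" "span B1 = {x. P *v x = x}"
    by (rule orthonormal_basis_subspace[OF sub(1)]) (rule that; blast)
  obtain B2 where B2: "B2 \<subseteq> {x. P *v x = 0}" "pairwise orthogonal B2" "\<And>x. x \<in> B2 \<Longrightarrow> norm x = 1"
    "independent B2" "card B2 = dim {x. P *v x = 0}" "span B2 = {x. P *v x = 0}"
    by (rule orthonormal_basis_subspace[OF sub(2)]) (rule that; blast)
  have norm1: "norm x = 1" if "x \<in> B1 \<union> B2" for x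
    using that B1 B2 by auto
  have orth12: "orthogonal x y" if "x \<in> B1" "y \<in> B2" for x y
  proof -
    have "P *v x = x" "P *v y = 0"
      using that B1 B2 by auto
    then have "x \<bullet> y = (P\<^sup>T *v x) \<bullet> y"
      using P' by simp
    also have "\<dots> = x \<bullet> (P *v y)"
      by (simp add: dot_lmul_matrix)
    finally show ?thesis
      using \<open>P *v y = 0\<close> by (simp add: orthogonal_def)
  qed
  have disj: "B1 \<inter> B2 = {}"
    using orth12 norm1 by (force simp: orthogonal_def)
  have orthB: "pairwise orthogonal (B1 \<union> B2)"
    using B1(2) B2(2) orth12 orthogonal_commute unfolding pairwise_def by blast
  have "0 \<notin> B1 \<union> B2"
    using norm1 by force
  then have ind: "independent (B1 \<union> B2)"
    using pairwise_orthogonal_independent orthB by blast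
  have "span (B1 \<union> B2) = UNIV"
  proof -
    have "x \<in> span (B1 \<union> B2)" for x
    proof -
      have "P *v x \<in> span (B1 \<union> B2)" "x - P *v x \<in> span (B1 \<union> B2)"
        using span_mono[of B1 "B1 \<union> B2"] span_mono[of B2 "B1 \<union> B2"] B1(6) B2(6)
        by (auto simp: PP matrix_vector_mult_diff_distrib)
      then show ?thesis
        using span_add by fastforce
    qed
    then show ?thesis
      by blast
  qed
  then have cardB: "card (B1 \<union> B2) = CARD('n)" and fin: "finite (B1 \<union> B2)"
    using dim_eq_card_independent[OF ind] dim_span[of "B1 \<union> B2"] independent_imp_finite[OF ind]
    by simp_all
  define V where "V f = (\<chi> i j. f j $ i)" for f :: "'n \<Rightarrow> real^'n"
  have frame: "orthogonal_matrix (V f)" "P ** V f = V f ** (\<chi> i j. if i = j \<and> f i \<in> B1 then 1 else 0)"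
    if f: "bij_betw f UNIV (B1 \<union> B2)" for f
  proof -
    have col: "column j (V f) = f j" for j
      by (simp add: V_def column_def vec_eq_iff)
    have fB: "f j \<in> B1 \<union> B2" for j
      using f by (auto simp: bij_betw_def)
    have "orthogonal (f i) (f j)" if "i \<noteq> j" for i j
    proof (rule pairwiseD[OF orthB fB fB])
      show "f i \<noteq> f j"
        using f that by (auto simp: bij_betw_def inj_eq)
    qed
    then show "orthogonal_matrix (V f)"
      unfolding orthogonal_matrix_orthonormal_columns col using norm1[OF fB] by simp
    have "(P ** V f) $ i $ j = (P *v f j) $ i" for i j
      by (simp add: V_def matrix_matrix_mult_def matrix_vector_mult_def)
    moreover have "(V f ** (\<chi> i j. if i = j \<and> f i \<in> B1 then 1 else 0)) $ i $ j =
        (\<Sum>l\<in>UNIV. if l = j then (if f j \<in> B1 then f j $ i else 0) else 0)" for i j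
    proof -
      have "(V f ** (\<chi> i j. if i = j \<and> f i \<in> B1 then 1 else 0)) $ i $ j =
          (\<Sum>l\<in>UNIV. f l $ i * (if l = j \<and> f l \<in> B1 then 1 else 0))"
        by (simp add: matrix_matrix_mult_def V_def)
      also have "\<dots> = (\<Sum>l\<in>UNIV. if l = j then (if f j \<in> B1 then f j $ i else 0) else 0)"
        by (intro sum.cong) auto
      finally show ?thesis .
    qed
    moreover have "P *v f j = (if f j \<in> B1 then f j else 0)" for j
      using fB[of j] B1(1) B2(1) by auto
    ultimately show "P ** V f = V f ** (\<chi> i j. if i = j \<and> f i \<in> B1 then 1 else 0)"
      by (simp add: vec_eq_iff)
  qed
  \<comment> \<open>An arbitrary enumeration \<open>f\<close> serves only to diagonalise
    \<open>P\<close> and to read off from the trace that \<open>B1\<close> has as many elements as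
    the first block; the adapted enumeration \<open>u\<close> is assembled afterwards.\<close>
  obtain f :: "'n \<Rightarrow> real^'n" where f: "bij_betw f UNIV (B1 \<union> B2)"
    using cardB fin finite_same_card_bij[of "UNIV :: 'n set" "B1 \<union> B2"] by auto
  define \<Delta> where "\<Delta> = (\<chi> i j. if i = j \<and> f i \<in> B1 then (1 :: real) else 0)"
  have "P = (P ** V f) ** (V f)\<^sup>T"
    using frame(1)[OF f] by (simp add: orthogonal_matrix_def matrix_mul_assoc[symmetric])
  then have "trace P = trace (V f ** \<Delta> ** (V f)\<^sup>T)"
    unfolding frame(2)[OF f] \<Delta>_def by (rule arg_cong)
  also have "\<dots> = trace ((V f)\<^sup>T ** (V f ** \<Delta>))"
    by (rule trace_mul_sym)
  also have "\<dots> = trace \<Delta>"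
    using frame(1)[OF f] by (simp add: matrix_mul_assoc orthogonal_matrix)
  also have "\<dots> = real (card {i. f i \<in> B1})"
    by (simp add: trace_def \<Delta>_def sum.If_cases)
  finally have "card {i. f i \<in> B1} = CARD('k)"
    using P' by simp
  moreover have "f ` {i. f i \<in> B1} = B1"
    using f by (auto simp: bij_betw_def image_iff)
  ultimately have cardB1: "card B1 = card (range \<iota>)"
    using card_image[of f "{i. f i \<in> B1}"] card_image[OF inj] f inj_on_subset[of f UNIV]
    by (force simp: bij_betw_def)
  then have "card B2 = card (- range \<iota>)"
    using card_Un_disjoint[of B1 B2] disj fin cardB by (simp add: Compl_eq_Diff_UNIV card_Diff_subset)
  then obtain g h where "bij_betw g (range \<iota>) B1" "bij_betw h (- range \<iota>) B2"
    using cardB1 fin finite_same_card_bij[of "range \<iota>" B1] finite_same_card_bij[of "- range \<iota>" B2] by auto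
  then have u: "bij_betw (\<lambda>i. if i \<in> range \<iota> then g i else h i) (range \<iota> \<union> - range \<iota>) (B1 \<union> B2)"
    by (rule bij_betw_disjoint_Un) (use disj in auto)
  define u where "u i = (if i \<in> range \<iota> then g i else h i)" for i
  have bij: "bij_betw u UNIV (B1 \<union> B2)"
    using u by (simp add: u_def[abs_def] Un_commute[of "range \<iota>"] Compl_partition2)
  have "u i \<in> B1 \<longleftrightarrow> i \<in> range \<iota>" for i
    using \<open>bij_betw g (range \<iota>) B1\<close> \<open>bij_betw h (- range \<iota>) B2\<close> disj
    by (auto simp: u_def bij_betw_def)
  then have "(\<chi> i j. if i = j \<and> u i \<in> B1 then 1 else 0) = emb_proj \<iota>"
    by (simp add: vec_eq_iff emb_proj_nth[OF inj])
  with frame[OF bij] that show thesis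
    by simp
qed

lemma positive_definite_gram:
  fixes M :: "real^'n^'n"
  assumes "invertible M"
  shows "positive_definite (M\<^sup>T ** M)"
proof -
  have "x \<bullet> ((M\<^sup>T ** M) *v x) > 0" if "x \<noteq> 0" for x
  proof -
    have "inj ((*v) M)"
      using assms invertible_left_inverse[of M] matrix_left_invertible_injective[of M] by blast
    then have "M *v x \<noteq> 0"
      using that by (metis injD matrix_vector_mult_0_right)
    moreover have "x \<bullet> ((M\<^sup>T ** M) *v x) = (M *v x) \<bullet> (M *v x)"
      using dot_lmul_matrix[of "M *v x" M x]
      by (simp add: matrix_vector_mul_assoc[symmetric] inner_commute)
    ultimately show ?thesis
      by simp
  qed
  then show ?thesis
    by (simp add: positive_definite_def matrix_transpose_mul)
qed

text \<open>Near \<open>P\<^sub>0 = V\<^sub>0 D V\<^sub>0\<^sup>T\<close>, the matrix \<open>M = q V\<^sub>0 D + (1 - q) V\<^sub>0 (1 - D)\<close> intertwines \<open>D\<close> with the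
  projection \<open>q\<close>; orthonormalising it by a block diagonal matrix preserves this.\<close>

lemma orthogonal_section:
  fixes \<iota> :: "'k::finite \<Rightarrow> 'n::finite" and P0 :: "real^'n^'n"
  assumes inj: "inj \<iota>" and P0: "P0 \<in> projections CARD('k)"
  obtains A and \<sigma> :: "real^'n^'n \<Rightarrow> real^'n^'n" where "open A" "P0 \<in> A" "smooth_on A \<sigma>"
    "\<And>q. q \<in> A \<Longrightarrow> q \<in> projections CARD('k) \<Longrightarrow> orthogonal_matrix (\<sigma> q)"
    "\<And>q. q \<in> A \<Longrightarrow> q \<in> projections CARD('k) \<Longrightarrow> q ** (\<sigma> q ** emb \<iota>) = \<sigma> q ** emb \<iota>"
proof -
  define D where "D = emb_proj \<iota>"
  note D = emb_proj_simps[OF inj, folded D_def]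
  obtain V0 where V0: "orthogonal_matrix V0" "P0 ** V0 = V0 ** D"
    using projection_frame[OF inj P0] unfolding D_def by metis
  define E where "E = mat 1 - D"
  have E: "E\<^sup>T = E" "E ** E = E" "D ** E = 0" "E ** D = 0"
    using D by (simp_all add: E_def matrix_expand)
  note DE = matrix_mult_left_cong[OF D(2)] matrix_mult_left_cong[OF E(2)]
    matrix_mult_left_cong[OF E(3)] matrix_mult_left_cong[OF E(4)]
  define M where "M q = q ** V0 ** D + (mat 1 - q) ** V0 ** E" for q
  obtain B and R :: "real^'n^'n \<Rightarrow> real^'n^'n" where R: "open B" "smooth_on B R"
    "\<And>N. positive_definite N \<Longrightarrow> N \<in> B" "\<And>N. positive_definite N \<Longrightarrow> (R N)\<^sup>T ** N ** R N = mat 1"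
    "\<And>N T. positive_definite N \<Longrightarrow> block_diagonal T N \<Longrightarrow> block_diagonal T (R N)"
    using smooth_orthonormalisation[where 'm = 'n] by blast
  define A where "A = {q \<in> UNIV. invertible (M q)}"
  define \<sigma> where "\<sigma> q = M q ** R ((M q)\<^sup>T ** M q)" for q
  have sm_M: "smooth_on U M" for U
    unfolding M_def by (intro smooth_intros)
  have "open A"
    unfolding A_def by (rule open_invertible[OF sm_M]) simp
  have pd: "positive_definite ((M q)\<^sup>T ** M q)" if "q \<in> A" for q
    using positive_definite_gram that by (simp add: A_def)
  \<comment> \<open>At \<open>P0\<close> both summands of \<open>M\<close> reproduce the
    corresponding columns of \<open>V0\<close>, so \<open>M\<close> is invertible there and
    \<open>A\<close> is a neighbourhood of \<open>P0\<close>.\<close>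
  have "M P0 = V0"
    using V0(2) D DE by (simp add: M_def E_def matrix_expand)
  then have "P0 \<in> A"
    using V0(1) by (auto simp: A_def orthogonal_matrix_def invertible_def)
  have "smooth_on A \<sigma>"
    unfolding \<sigma>_def
    by (intro smooth_intros sm_M smooth_on_compose[OF R(2)]) (use R(3) pd in auto)
  moreover have "orthogonal_matrix (\<sigma> q) \<and> q ** (\<sigma> q ** emb \<iota>) = \<sigma> q ** emb \<iota>"
    if q: "q \<in> A" "q \<in> projections CARD('k)" for q
  proof
    note q' = projectionsD[OF q(2)]
    let ?N = "(M q)\<^sup>T ** M q"
    have "(\<sigma> q)\<^sup>T ** \<sigma> q = (R ?N)\<^sup>T ** ?N ** R ?N"
      by (simp add: \<sigma>_def matrix_transpose_mul matrix_mul_assoc)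
    then show "orthogonal_matrix (\<sigma> q)"
      using R(4)[OF pd[OF q(1)]] by (simp add: orthogonal_matrix)
    define p where "p = mat 1 - q"
    have p: "p\<^sup>T = p" "p ** p = p" "q ** p = 0" "p ** q = 0"
      using q' by (simp_all add: p_def matrix_expand)
    have Mq: "M q = q ** V0 ** D + p ** V0 ** E"
      by (simp add: M_def p_def)
    note qp = matrix_mult_left_cong[OF q'(2)] matrix_mult_left_cong[OF p(2)]
      matrix_mult_left_cong[OF p(3)] matrix_mult_left_cong[OF p(4)]
    \<comment> \<open>The off-diagonal blocks of the Gram matrix contain the product of
      \<open>q\<close> and \<open>p\<close>, which is 0.\<close>
    have "D ** ?N = ?N ** D"
      by (simp add: Mq matrix_expand qp DE p q' D E)
    then have comm: "D ** R ?N = R ?N ** D"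
      unfolding D_def block_diagonal_iff_commute[OF inj, symmetric] by (rule R(5)[OF pd[OF q(1)]])
    have qM: "q ** (M q ** D) = M q ** D"
      by (simp add: Mq matrix_expand qp DE p q' D E)
    have \<sigma>D: "\<sigma> q ** D = M q ** D ** R ?N"
      using comm by (simp add: \<sigma>_def matrix_mul_assoc[symmetric])
    have "\<sigma> q ** emb \<iota> = \<sigma> q ** D ** emb \<iota>"
      using D by (simp add: matrix_mul_assoc[symmetric])
    moreover have "q ** (\<sigma> q ** D) = \<sigma> q ** D"
      unfolding \<sigma>D matrix_mul_assoc using qM by (simp add: matrix_mul_assoc)
    ultimately show "q ** (\<sigma> q ** emb \<iota>) = \<sigma> q ** emb \<iota>"
      by (simp add: matrix_mul_assoc)
  qed
  ultimately show thesis
    using that \<open>open A\<close> \<open>P0 \<in> A\<close> by blast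
qed

subsection \<open>Tangent vectors of the projection model\<close>

text \<open>The linearisation at \<open>P\<close> of the equations \<open>P\<^sup>T = P\<close> and
  \<open>P ** P = P\<close>.\<close>

definition proj_tangent :: "real^'n^'n \<Rightarrow> (real^'n^'n) set" where
  "proj_tangent P = {X. X\<^sup>T = X \<and> X ** P + P ** X = X}"

text \<open>Geometrically, \<open>X\<close> maps the range of \<open>P\<close> into its
  kernel.\<close>

lemma proj_tangent_sandwich:
  assumes "P ** P = P" "X \<in> proj_tangent P"
  shows "P ** (X ** P) = 0"
proof -
  have "P ** (X ** P + P ** X) = P ** X"
    using assms(2) by (simp add: proj_tangent_def)
  then show ?thesis
    by (simp add: matrix_mult_distrib matrix_mult_left_cong[OF assms(1)])
qed

text \<open>Allows an identity that holds along a curve near 0 to be differentiated; outside a small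
  interval the curve may leave the set on which the identity is known.\<close>

lemma has_vector_derivative_local_unique:
  fixes f g :: "real \<Rightarrow> 'a::real_normed_vector"
  assumes "(f has_vector_derivative a) (at 0)" "(g has_vector_derivative b) (at 0)"
    and "e > 0" "\<And>t. \<bar>t\<bar> < e \<Longrightarrow> f t = g t"
  shows "a = b"
proof -
  have "(g has_vector_derivative a) (at 0)"
    by (rule has_vector_derivative_transform_within_open[OF assms(1), of "{-e<..<e}"])
       (use assms(3,4) in \<open>auto simp: abs_less_iff\<close>)
  then show ?thesis
    using vector_derivative_unique_at assms(2) by blast
qed

lemmas matrix_mult_has_vector_derivative =
  bounded_bilinear.has_vector_derivative[OF bounded_bilinear_matrix_mult]

lemma has_vector_derivative_transpose:
  fixes f :: "real \<Rightarrow> real^'m^'n"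
  assumes "(f has_vector_derivative v) F"
  shows "((\<lambda>t. (f t)\<^sup>T) has_vector_derivative v\<^sup>T) F"
proof (rule bounded_linear.has_vector_derivative[OF _ assms])
  show "bounded_linear (transpose :: real^'m^'n \<Rightarrow> real^'n^'m)"
    by (simp add: linear_conv_bounded_linear[symmetric] linear_iff transpose_distrib transpose_scalar)
qed

lemma ambient_in_proj_tangent:
  assumes "D \<in> tangent_space (embedded (projections k)) P"
  shows "ambient_vector D \<in> proj_tangent P"
proof -
  let ?X = "ambient_vector D"
  obtain \<gamma> where \<gamma>: "\<gamma> 0 = P" "smooth_curve (embedded (projections k)) \<gamma>"
    and X: "(\<gamma> has_vector_derivative ?X) (at 0)"
    using tangent_embeddedE[OF assms] by metis
  obtain e where e: "e > 0" "\<And>t. \<bar>t\<bar> < e \<Longrightarrow> \<gamma> t \<in> projections k"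
    using smooth_curve_embeddedE[OF \<gamma>(2)] by metis
  have "?X\<^sup>T = ?X"
    by (rule has_vector_derivative_local_unique[OF has_vector_derivative_transpose[OF X] X e(1)])
       (use e projectionsD in blast)
  moreover have "\<gamma> 0 ** ?X + ?X ** \<gamma> 0 = ?X"
    by (rule has_vector_derivative_local_unique[OF matrix_mult_has_vector_derivative[OF X X] X e(1)])
       (use e projectionsD in blast)
  ultimately show ?thesis
    using \<gamma>(1) by (simp add: proj_tangent_def add.commute)
qed

lemma smooth_curve_embeddedI:
  assumes "smooth_on UNIV \<gamma>" "\<And>t. \<gamma> t \<in> S"
  shows "smooth_curve (embedded S) \<gamma>"
  unfolding smooth_curve_def smooth_map_embedded_iff
  by (intro exI[of _ 1] conjI smooth_on_imp_smooth_ext[OF assms(1)]) (use assms(2) in auto)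

text \<open>The commutator of \<open>X\<close> and \<open>P\<close> is the infinitesimal rotation
  that moves \<open>P\<close> with velocity \<open>X\<close>. A frame \<open>A\<close> in the range
  of \<open>P\<close> moves under it with velocity \<open>X ** A\<close>, so one generator serves
  the projection and its frames.\<close>

lemma proj_tangent_generator:
  assumes "P\<^sup>T = P" "P ** P = P" "X \<in> proj_tangent P"
  defines "\<Omega> \<equiv> X ** P - P ** X"
  shows "\<Omega>\<^sup>T = - \<Omega>" "P ** A = A \<Longrightarrow> \<Omega> ** A = X ** A" "\<Omega> ** P - P ** \<Omega> = X"
proof -
  note X = proj_tangent_sandwich[OF assms(2,3)]
  have XT: "X\<^sup>T = X" "X ** P + P ** X = X"
    using assms(3) by (simp_all add: proj_tangent_def)
  show "\<Omega>\<^sup>T = - \<Omega>"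
    using assms(1) XT by (simp add: \<Omega>_def matrix_expand)
  show "\<Omega> ** A = X ** A" if A: "P ** A = A"
  proof -
    have "P ** (X ** A) = (P ** (X ** P)) ** A"
      by (simp add: matrix_mul_assoc[symmetric] A)
    then show ?thesis
      using A X by (simp add: \<Omega>_def matrix_expand)
  qed
  show "\<Omega> ** P - P ** \<Omega> = X"
    using assms(2) X XT(2) by (simp add: \<Omega>_def matrix_expand matrix_mult_left_cong[OF assms(2)])
qed

text \<open>Conjugating \<open>P\<close> by a Cayley curve with velocity \<open>\<Omega>\<close>
  stays in the set, since conjugation by orthogonal matrices preserves symmetry, idempotence and
  trace.\<close>

lemma proj_tangent_realised:
  fixes P :: "real^'n^'n"
  assumes P: "P \<in> projections k" and X: "X \<in> proj_tangent P"
  obtains D where "D \<in> tangent_space (embedded (projections k)) P" "ambient_vector D = X"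
proof -
  note P' = projectionsD[OF P]
  define \<Omega> where "\<Omega> = X ** P - P ** X"
  note \<Omega> = proj_tangent_generator[OF P'(1,2) X, folded \<Omega>_def]
  obtain C where C: "smooth_on UNIV C" "\<And>t. orthogonal_matrix (C t)" "C 0 = mat 1"
    "(C has_vector_derivative \<Omega>) (at 0)"
    using orthogonal_curve_exists[OF \<Omega>(1)] by metis
  define \<gamma> where "\<gamma> t = C t ** (P ** (C t)\<^sup>T)" for t
  have "\<gamma> t \<in> projections k" for t
  proof -
    have CC: "(C t)\<^sup>T ** C t = mat 1"
      using C(2) by (simp add: orthogonal_matrix)
    have "trace (\<gamma> t) = trace (P ** (C t)\<^sup>T ** C t)"
      unfolding \<gamma>_def by (simp add: trace_mul_sym[of "C t"])
    then have "trace (\<gamma> t) = trace P"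
      by (simp add: matrix_mul_assoc[symmetric] CC)
    then show ?thesis
      using P' by (simp add: projections_def \<gamma>_def matrix_expand matrix_mult_left_cong[OF CC]
          matrix_mult_left_cong[OF P'(2)])
  qed
  moreover have "smooth_on UNIV \<gamma>"
    unfolding \<gamma>_def by (intro smooth_intros C(1))
  ultimately have sm: "smooth_curve (embedded (projections k)) \<gamma>"
    using smooth_curve_embeddedI by blast
  have "(\<gamma> has_vector_derivative C 0 ** (P ** \<Omega>\<^sup>T + 0 ** (C 0)\<^sup>T) + \<Omega> ** (P ** (C 0)\<^sup>T)) (at 0)"
    unfolding \<gamma>_def
    by (intro matrix_mult_has_vector_derivative has_vector_derivative_transpose
        has_vector_derivative_const C(4))
  then have "(\<gamma> has_vector_derivative X) (at 0)"
    using \<Omega>(1,3) by (simp add: C(3) matrix_mult_distrib)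
  then have "ambient_vector (velocity (embedded (projections k)) \<gamma>) = X"
    by (rule ambient_velocity[OF sm])
  moreover have "\<gamma> 0 = P"
    by (simp add: \<gamma>_def C(3))
  ultimately show thesis
    using that sm unfolding tangent_space_iff by blast
qed

lemma proj_tangent_combination:
  assumes "X \<in> proj_tangent P" "Y \<in> proj_tangent P"
  shows "a *\<^sub>R X + b *\<^sub>R Y \<in> proj_tangent P"
proof -
  have "(a *\<^sub>R X + b *\<^sub>R Y) ** P + P ** (a *\<^sub>R X + b *\<^sub>R Y)
      = a *\<^sub>R (X ** P + P ** X) + b *\<^sub>R (Y ** P + P ** Y)"
    by (simp add: matrix_mult_distrib scaleR_add_right)
  with assms show ?thesis
    by (simp add: proj_tangent_def transpose_distrib transpose_scalar)
qed

text \<open>The combined ambient vector solves the linearised equations, hence is the velocity of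
  some curve, and the ambient vector determines the tangent vector.\<close>

lemma tangent_projections_combination:
  assumes "D \<in> tangent_space (embedded (projections k)) P"
    "D' \<in> tangent_space (embedded (projections k)) P"
  shows "(\<lambda>f. a * D f + b * D' f) \<in> tangent_space (embedded (projections k)) P"
proof -
  have P: "P \<in> projections k"
    using assms(1) smooth_curve_points by (force elim: tangent_spaceE)
  obtain D'' where D'': "D'' \<in> tangent_space (embedded (projections k)) P"
    "ambient_vector D'' = a *\<^sub>R ambient_vector D + b *\<^sub>R ambient_vector D'"
    using proj_tangent_realised[OF P proj_tangent_combination] ambient_in_proj_tangent assms
    by metis
  then show ?thesis
    using tangent_embedded_combination[OF assms D''] by simp
qed

subsection \<open>The projection model is a Riemannian manifold\<close>

lemma same_structure_smooth_map:
  assumes "space_top M = space_top M'" "smooth_fun M = smooth_fun M'"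
  shows "smooth_map M N = smooth_map M' N" "smooth_map K M = smooth_map K M'"
  using assms by (simp_all add: smooth_map_def fun_eq_iff)

text \<open>The models are records with an additional metric field. These notions read only topology
  and smooth functions, so facts about \<open>embedded\<close> and \<open>quotient_space\<close>
  carry over to the records.\<close>

lemma same_structure:
  fixes M :: "('a, 'y) smooth_space_scheme" and M' :: "('a, 'z) smooth_space_scheme"
  assumes eq: "space_top M = space_top M'" "smooth_fun M = smooth_fun M'"
  shows "velocity M = velocity M'" "differential M = differential M'"
    "tangent_space M = tangent_space M'" "restrict_to M = restrict_to M'"
    "vector_field_on M = vector_field_on M'" "values_only M = values_only M'"
    "smooth_manifold W M = smooth_manifold W M'"
    "diffeomorphism M N = diffeomorphism M' N" "diffeomorphism K M = diffeomorphism K M'"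
proof -
  have near: "smooth_near M = smooth_near M'"
    using eq by (simp add: smooth_near_def fun_eq_iff)
  show vel: "velocity M = velocity M'"
    by (simp add: velocity_def fun_eq_iff near)
  show "differential M = differential M'"
    by (simp add: differential_def fun_eq_iff near)
  show tan: "tangent_space M = tangent_space M'"
    by (simp add: tangent_space_def fun_eq_iff vel same_structure_smooth_map[OF eq])
  show restr: "restrict_to M = restrict_to M'"
    using eq by (simp add: restrict_to_def fun_eq_iff)
  show "vector_field_on M = vector_field_on M'"
    using eq by (simp add: vector_field_on_def fun_eq_iff tan)
  show "values_only M = values_only M'"
    using eq by (simp add: values_only_def)
  show "smooth_manifold W M = smooth_manifold W M'"
    using eq by (simp add: smooth_manifold_def restr)
  show "diffeomorphism M N = diffeomorphism M' N" "diffeomorphism K M = diffeomorphism K M'"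
    using eq by (simp_all add: diffeomorphism_def fun_eq_iff same_structure_smooth_map[OF eq])
qed

lemma submanifold_simps:
  "space_top (submanifold S h) = top_of_set S"
  "smooth_fun (submanifold S h) = smooth_fun (embedded S)"
  "metric (submanifold S h) p D D' = h (ambient_vector D) (ambient_vector D')"
  by (simp_all add: submanifold_def smooth_space.extend_def riemannian_space.fields_def embedded_def)

lemmas submanifold_structure =
  same_structure[of "submanifold S h" "embedded S" for S h,
    unfolded submanifold_simps space_top_embedded, OF refl refl]

lemma values_only_embedded: "values_only (embedded S)"
  unfolding values_only_def smooth_fun_embedded using smooth_ext_cong by blast

lemma submanifold_scale:
  assumes "smooth_fun (submanifold S h) U f"
  shows "smooth_fun (submanifold S h) U (\<lambda>x. r * f x)"
  using assms
  by (auto simp: submanifold_simps smooth_fun_embedded intro: smooth_ext_mult smooth_ext_const)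

lemma projection_model_eq: "projection_model k = submanifold (projections k) (\<lambda>X Y. trace (X ** Y))"
  by (simp add: projection_model_def projections_def)

lemma gram_invertible_left_inverse:
  fixes A :: "real^'k^'n"
  assumes "L ** A = mat 1"
  shows "invertible (A\<^sup>T ** A)"
  using assms matrix_left_invertible_injective[of A] full_rank_injective[of A] gram_invertible_iff[of A]
  by auto

text \<open>The chart around \<open>P\<^sub>0\<close> describes a projection by the linear map, from the range of \<open>P\<^sub>0\<close> to its
  orthogonal complement, of which its range is the graph.\<close>

lemma projections_chart:
  fixes \<iota> :: "'k::finite \<Rightarrow> 'n::finite" and P0 :: "real^'n^'n"
  assumes inj: "inj \<iota>" and P0: "P0 \<in> projections CARD('k)"
  shows "\<exists>U \<phi>. openin (top_of_set (projections CARD('k))) U \<and> P0 \<in> U \<and>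
    diffeomorphism (embedded U) (embedded (off_block \<iota>)) \<phi>"
proof -
  define S where "S = (projections CARD('k) :: (real^'n^'n) set)"
  define J where "J = emb \<iota>"
  define D where "D = emb_proj \<iota>"
  define E where "E = mat 1 - D"
  note JD = emb_gram[OF inj, folded J_def] emb_proj_simps[OF inj, folded D_def J_def]
  obtain V where V: "orthogonal_matrix V" "P0 ** V = V ** D"
    using projection_frame[OF inj P0] unfolding D_def by metis
  have VV: "V\<^sup>T ** V = mat 1" "V ** V\<^sup>T = mat 1"
    using V(1) by (simp_all add: orthogonal_matrix_def)
  define Y where "Y = V ** J"
  have YY: "Y\<^sup>T ** Y = mat 1"
    using JD by (simp add: Y_def matrix_expand matrix_mult_left_cong[OF VV(1)])
  have "P0 = (P0 ** V) ** V\<^sup>T"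
    using VV by (simp add: matrix_mul_assoc[symmetric])
  then have P0_eq: "P0 = Y ** Y\<^sup>T"
    unfolding V(2) using JD by (simp add: Y_def matrix_expand matrix_mult_left_cong[OF JD(6)])
  \<comment> \<open>For a projection \<open>P\<close> this is the Gram matrix of
    \<open>P ** Y\<close>; it is invertible iff \<open>P\<close> is injective on the range of
    \<open>P0\<close>.\<close>
  define N where "N P = Y\<^sup>T ** (P ** Y)" for P
  define U where "U = {P \<in> S. invertible (N P)}"
  \<comment> \<open>On \<open>U\<close>, the columns of \<open>P ** (Y ** matrix_inv (N P))\<close>
    span the range of \<open>P\<close> and have \<open>Y\<close>-components \<open>mat 1\<close>;
    their components along the remaining columns of \<open>V\<close> form the transpose of
    \<open>\<phi> P\<close>. Conversely, the columns of \<open>a B\<close> span the graph of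
    \<open>B\<^sup>T\<close>.\<close>
  define \<phi> where "\<phi> P = matrix_inv (N P) ** (Y\<^sup>T ** (P ** (V ** E)))" for P
  define a where "a B = V ** (J + B\<^sup>T)" for B
  define \<psi> where "\<psi> B = col_proj (a B)" for B :: "real^'n^'k"
  have sm_N: "smooth_on UNIV N"
    unfolding N_def by (intro smooth_intros)
  have sm_a: "smooth_on UNIV a"
    unfolding a_def by (intro smooth_intros)
  define O1 where "O1 = {P \<in> UNIV. invertible (N P)}"
  have O1: "open O1"
    unfolding O1_def by (rule open_invertible[OF sm_N]) simp
  have sm_\<phi>: "smooth_on O1 \<phi>"
    unfolding \<phi>_def
    by (intro smooth_intros smooth_on_matrix_inv smooth_on_subset[OF sm_N] O1)
       (auto simp: O1_def invertible_det_nz)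
  have U_O1: "U = S \<inter> O1"
    by (auto simp: U_def O1_def)
  have EJ: "E ** J = 0"
    using JD by (simp add: E_def matrix_mult_distrib)
  have \<phi>_off: "\<phi> P \<in> off_block \<iota>" for P
    unfolding off_block_iff J_def[symmetric] by (simp add: \<phi>_def matrix_expand EJ)
  have gram_a: "Y\<^sup>T ** a B = mat 1" "invertible ((a B)\<^sup>T ** a B)" if B: "B \<in> off_block \<iota>" for B
  proof -
    have "J\<^sup>T ** B\<^sup>T = (B ** J)\<^sup>T"
      by (simp add: matrix_transpose_mul)
    then have "J\<^sup>T ** B\<^sup>T = 0"
      using B unfolding off_block_iff J_def[symmetric] by (simp add: transpose_distrib)
    then show "Y\<^sup>T ** a B = mat 1"
      using JD by (simp add: Y_def a_def matrix_expand matrix_mult_left_cong[OF VV(1)])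
    then show "invertible ((a B)\<^sup>T ** a B)"
      by (rule gram_invertible_left_inverse)
  qed
  have sm_\<psi>: "smooth_ext (off_block \<iota>) \<psi>"
  proof (rule smooth_on_imp_smooth_ext)
    let ?O = "{B \<in> UNIV. invertible ((a B)\<^sup>T ** a B)}"
    show "open ?O"
      by (rule open_invertible) (intro smooth_intros sm_a, simp)
    then show "smooth_on ?O \<psi>"
      unfolding \<psi>_def by (intro smooth_on_col_proj smooth_on_subset[OF sm_a]) auto
    show "off_block \<iota> \<subseteq> ?O"
      using gram_a by auto
  qed
  have \<psi>: "\<psi> B \<in> U" "\<phi> (\<psi> B) = B" if B: "B \<in> off_block \<iota>" for B
  proof -
    let ?G = "matrix_inv ((a B)\<^sup>T ** a B)"
    note inv = gram_a(2)[OF B]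
    have aY: "(a B)\<^sup>T ** Y = mat 1"
      using arg_cong[OF gram_a(1)[OF B], of transpose] by (simp add: matrix_transpose_mul)
    \<comment> \<open>Since \<open>Y\<^sup>T ** a B = mat 1\<close>, compressing the projection by
      \<open>Y\<close> leaves exactly the inverse Gram matrix.\<close>
    have N\<psi>: "N (\<psi> B) = ?G"
      using aY gram_a(1)[OF B]
      by (simp add: N_def \<psi>_def col_proj_def matrix_mul_assoc[symmetric] matrix_mult_left_cong[OF gram_a(1)[OF B]])
    have invG: "invertible ?G" "matrix_inv ?G = (a B)\<^sup>T ** a B"
      using matrix_inv_mult[OF inv] by (auto simp: invertible_def intro: matrix_inv_unique)
    have "\<psi> B \<in> S"
      using col_proj_in_projections[OF inv] by (simp add: \<psi>_def S_def)
    with N\<psi> invG show "\<psi> B \<in> U"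
      by (simp add: U_def)
    have BE: "B ** E = B" "J\<^sup>T ** E = 0"
      using B JD unfolding off_block_iff J_def[symmetric] JD(6)[symmetric]
      by (simp_all add: E_def matrix_mult_distrib matrix_mul_assoc flip: JD(6))
    have "(a B)\<^sup>T ** (V ** E) = B"
      using BE by (simp add: a_def matrix_expand matrix_mult_left_cong[OF VV(1)])
    then have "Y\<^sup>T ** (\<psi> B ** (V ** E)) = ?G ** B"
      by (simp add: \<psi>_def col_proj_def matrix_mul_assoc[symmetric] matrix_mult_left_cong[OF gram_a(1)[OF B]])
    then have "\<phi> (\<psi> B) = matrix_inv ?G ** (?G ** B)"
      by (simp add: \<phi>_def N\<psi>)
    also have "\<dots> = B"
      by (simp add: matrix_mul_assoc matrix_inv_mult[OF invG(1)])
    finally show "\<phi> (\<psi> B) = B" .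
  qed
  have \<psi>\<phi>: "\<psi> (\<phi> P) = P" if P: "P \<in> U" for P
  proof -
    have PS: "P \<in> projections CARD('k)" and inv: "invertible (N P)"
      using P by (simp_all add: U_def S_def)
    note P' = projectionsD[OF PS]
    let ?I = "matrix_inv (N P)"
    have "(N P)\<^sup>T = N P"
      using P' by (simp add: N_def matrix_expand)
    then have "?I\<^sup>T = ?I"
      using transpose_matrix_inv[OF inv] by simp
    moreover have "E\<^sup>T = E"
      using JD by (simp add: E_def transpose_distrib)
    \<comment> \<open>\<open>V ** E ** V\<^sup>T\<close> is \<open>mat 1 - P0\<close>, and
      \<open>P0 ** (P ** (Y ** ?I))\<close> is \<open>Y\<close>, so the two terms add up to
      \<open>P ** (Y ** ?I)\<close>.\<close>
    ultimately have "a (\<phi> P) = Y + V ** (E ** (V\<^sup>T ** (P ** (Y ** ?I))))"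
      using P' by (simp add: a_def \<phi>_def Y_def matrix_expand)
    also have "V ** (E ** (V\<^sup>T ** X)) = X - P0 ** X" for X :: "real^'k^'n"
    proof -
      have "V ** (D ** (V\<^sup>T ** X)) = P0 ** V ** (V\<^sup>T ** X)"
        by (simp add: V(2) matrix_mul_assoc[symmetric])
      then show ?thesis
        by (simp add: E_def matrix_expand matrix_mult_left_cong[OF VV(2)])
    qed
    also have "P0 ** (P ** (Y ** ?I)) = Y ** (N P ** ?I)"
      by (simp add: P0_eq N_def matrix_mul_assoc[symmetric])
    finally have a: "a (\<phi> P) = P ** (Y ** ?I)"
      by (simp add: matrix_inv_mult[OF inv])
    have "P ** a (\<phi> P) = a (\<phi> P)"
      by (simp add: a matrix_mult_left_cong[OF P'(2)])
    then show ?thesis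
      unfolding \<psi>_def by (intro col_proj_eqI PS gram_a \<phi>_off)
  qed
  have "openin (top_of_set S) U"
    unfolding U_O1 using O1 by (simp add: openin_open_Int)
  moreover have "P0 \<in> U"
  proof -
    have "N P0 = mat 1"
      using YY by (simp add: N_def P0_eq matrix_mul_assoc[symmetric] matrix_mult_left_cong[OF YY])
    then show ?thesis
      using P0 by (simp add: U_def S_def invertible_def)
  qed
  moreover have "diffeomorphism (embedded U) (embedded (off_block \<iota>)) \<phi>"
    unfolding diffeomorphism_def smooth_map_embedded_iff
    using \<phi>_off \<psi> \<psi>\<phi> sm_\<psi> smooth_on_imp_smooth_ext[OF sm_\<phi> O1, of U]
    by (intro conjI exI[of _ \<psi>]) (auto simp: U_O1)
  ultimately show ?thesis
    unfolding S_def by blast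
qed

lemma subspace_off_block: "subspace (off_block \<iota>)"
  by (auto simp: subspace_def off_block_def)

text \<open>The components of the ambient vector are the values of the field on coordinate
  functions, which are smooth by the definition of a vector field.\<close>

lemma smooth_ext_ambient_vector:
  assumes X: "vector_field_on (embedded S) U X" and U: "openin (top_of_set S) U"
  shows "smooth_ext U (\<lambda>p. ambient_vector (X p))"
proof -
  have "smooth_ext U (\<lambda>p. X p (\<lambda>y. y \<bullet> b))" for b
  proof -
    have "smooth_fun (embedded S) U (\<lambda>y. y \<bullet> b)"
      using U smooth_fun_coordinate[of S b] openin_imp_subset[OF U] smooth_ext_subset
      by (auto simp: smooth_fun_embedded)
    then have "smooth_fun (embedded S) U (\<lambda>p. X p (\<lambda>y. y \<bullet> b))"
      using X by (simp add: vector_field_on_def)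
    then show ?thesis
      by (simp add: smooth_fun_embedded)
  qed
  then show ?thesis
    unfolding ambient_vector_def
    by (intro smooth_ext_sum smooth_ext_scaleR smooth_ext_const) auto
qed

lemma trace_scaleR: "trace (r *\<^sub>R X) = r * trace X" for X :: "real^'n^'n"
  by (simp add: trace_def sum_distrib_left)

lemma bilinear_trace_mult: "bilinear (\<lambda>X Y :: real^'n^'n. trace (X ** Y))"
  by (simp add: bilinear_def linear_iff matrix_mult_distrib trace_add trace_scaleR)

lemma second_countable_euclidean:
  "second_countable (euclidean :: 'a::second_countable_topology topology)"
proof -
  obtain \<B> :: "'a set set" where \<B>: "countable \<B>" "topological_basis \<B>"
    using ex_countable_basis by blast
  have "\<exists>V\<in>\<B>. x \<in> V \<and> V \<subseteq> U" if "open U" "x \<in> U" for U x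
    by (rule topological_basisE[OF \<B>(2) that]) blast
  moreover have "\<forall>V\<in>\<B>. open V"
    using \<B>(2) by (simp add: topological_basis_open)
  ultimately show ?thesis
    unfolding second_countable_def open_openin[symmetric] using \<B>(1)
    by (intro exI[of _ \<B>]) blast
qed

lemma riemannian_manifold_projection_model:
  fixes \<iota> :: "'k::finite \<Rightarrow> 'n::finite"
  assumes inj: "inj \<iota>"
  shows "riemannian_manifold (off_block \<iota>) (projection_model CARD('k) :: (real^'n^'n) riemannian_space)"
proof -
  define S where "S = (projections CARD('k) :: (real^'n^'n) set)"
  define h where "h = (\<lambda>X Y :: real^'n^'n. trace (X ** Y))"
  have M: "projection_model CARD('k) = submanifold S h"
    by (simp add: projection_model_eq S_def h_def)
  have bil: "bilinear h"
    unfolding h_def by (rule bilinear_trace_mult)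
  have sm: "smooth_manifold (off_block \<iota>) (embedded S)"
    unfolding smooth_manifold_def
  proof (intro conjI allI ballI)
    show "subspace (off_block \<iota>)"
      by (rule subspace_off_block)
    show "Hausdorff_space (space_top (embedded S))"
      by (simp add: Hausdorff_space_subtopology)
    show "second_countable (space_top (embedded S))"
      by (simp add: second_countable_subtopology second_countable_euclidean)
    show "smooth_fun (embedded S) U f \<longleftrightarrow> openin (space_top (embedded S)) U \<and>
        (\<forall>p\<in>U. \<exists>V. p \<in> V \<and> V \<subseteq> U \<and> smooth_fun (embedded S) V f)" for U f
      unfolding space_top_embedded by (rule smooth_fun_embedded_local)
    fix P assume "P \<in> points (embedded S)"
    then obtain U \<phi> where "openin (top_of_set S) U" "P \<in> U"
      "diffeomorphism (embedded U) (embedded (off_block \<iota>)) \<phi>"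
      using projections_chart[OF inj, of P] by (auto simp: S_def)
    then show "\<exists>U W' \<phi>. openin (space_top (embedded S)) U \<and> P \<in> U \<and>
        openin (top_of_set (off_block \<iota>)) W' \<and>
        diffeomorphism (restrict_to (embedded S) U) (embedded W') \<phi>"
      by (intro exI[of _ U] exI[of _ "off_block \<iota>"] exI[of _ \<phi>]) (simp add: restrict_to_embedded)
  qed
  \<comment> \<open>Tangent matrices are symmetric, so \<open>h X X\<close> is the squared Frobenius
    norm; a nonzero velocity has a nonzero ambient vector.\<close>
  have pos: "h (ambient_vector D) (ambient_vector D) > 0"
    if "D \<in> tangent_space (embedded S) P" "D \<noteq> (\<lambda>f. 0)" for D P
  proof -
    have "ambient_vector D \<noteq> 0"
      using tangent_embedded_zero that by blast
    moreover have "(ambient_vector D)\<^sup>T = ambient_vector D"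
      using ambient_in_proj_tangent that(1) by (force simp: proj_tangent_def S_def)
    ultimately show ?thesis
      using trace_gram_pos[of "ambient_vector D"] by (simp add: h_def)
  qed
  have smooth: "smooth_fun (embedded S) U (\<lambda>p. h (ambient_vector (X p)) (ambient_vector (Y p)))"
    if U: "openin (top_of_set S) U" and "vector_field_on (embedded S) U X" "vector_field_on (embedded S) U Y"
    for U X Y
    unfolding smooth_fun_embedded
    by (intro conjI U smooth_ext_binop[where h = h] smooth_on_bilinear[OF bil]
        smooth_ext_ambient_vector[OF _ U] that)
  have sym: "h X Y = h Y X" for X Y
    unfolding h_def by (rule trace_mul_sym)
  show ?thesis
    unfolding M riemannian_manifold_def submanifold_structure submanifold_simps
    by (intro conjI ballI allI impI sm sym pos smooth)
       (auto simp: ambient_vector_combination bilinear_ladd[OF bil] bilinear_lmul[OF bil])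
qed

lemma riemannian_manifold_via_projection_model:
  fixes \<iota> :: "'k::finite \<Rightarrow> 'n::finite"
  assumes "inj \<iota>" "homothetic M (projection_model CARD('k) :: (real^'n^'n) riemannian_space)"
    and "values_only M" "\<And>U h. smooth_fun M U h \<Longrightarrow> openin (space_top M) U"
  shows "riemannian_manifold (off_block \<iota>) M"
proof (rule riemannian_manifold_transfer[OF riemannian_manifold_projection_model[OF assms(1)] assms(2-4)])
  show "values_only (projection_model CARD('k) :: (real^'n^'n) riemannian_space)"
    by (simp add: projection_model_eq submanifold_structure values_only_embedded)
qed (auto simp: projection_model_eq submanifold_structure tangent_projections_combination submanifold_scale)

subsection \<open>The involution model\<close>

lemma ambient_differential:
  assumes f: "smooth_map (embedded S) (embedded T) f" and D: "D \<in> tangent_space (embedded S) p"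
    and f': "(f has_derivative f') (at p)"
  shows "ambient_vector (differential (embedded T) f p D) = f' (ambient_vector D)"
proof -
  obtain \<gamma> where \<gamma>: "D = velocity (embedded S) \<gamma>" "\<gamma> 0 = p" "smooth_curve (embedded S) \<gamma>"
    "(\<gamma> has_vector_derivative ambient_vector D) (at 0)"
    using tangent_embeddedE[OF D] by metis
  have "differential (embedded T) f p D = velocity (embedded T) (f \<circ> \<gamma>)"
    using differential_velocity[OF f, of \<gamma>] smooth_curve_points[OF \<gamma>(3)] \<gamma> by simp
  moreover have "((f \<circ> \<gamma>) has_vector_derivative f' (ambient_vector D)) (at 0)"
    using has_derivative_compose[OF \<gamma>(4)[unfolded has_vector_derivative_def], of f f'] f' \<gamma>(2)
      linear_scale[OF has_derivative_linear[OF f']]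
    by (simp add: has_vector_derivative_def o_def)
  ultimately show ?thesis
    using ambient_velocity[OF smooth_curve_compose[OF \<gamma>(3) f]] by simp
qed

text \<open>A symmetric orthogonal matrix squares to the identity, so its eigenvalues are 1 and -1;
  the affine map \<open>f\<close> sends them to 1 and 0.\<close>

lemma homothetic_involution_projection:
  "homothetic (involution_model k :: (real^'n^'n) riemannian_space)
    (projection_model k :: (real^'n^'n) riemannian_space)"
proof -
  let ?Q = "{Q :: real^'n^'n. orthogonal_matrix Q \<and> Q\<^sup>T = Q \<and> trace Q = 2 * real k - real CARD('n)}"
  let ?h = "\<lambda>X Y :: real^'n^'n. trace (X ** Y)"
  define f where "f Q = (1 / 2) *\<^sub>R (Q + mat 1)" for Q :: "real^'n^'n"
  define g where "g P = 2 *\<^sub>R P - mat 1" for P :: "real^'n^'n"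
  note tr = trace_scaleR
  have gf: "g (f Q) = Q" and fg: "f (g P) = P" for P Q
    by (simp_all add: f_def g_def)
  have fQ: "f Q \<in> projections k" if "Q \<in> ?Q" for Q
  proof -
    have "Q ** Q = mat 1"
      using that by (auto simp: orthogonal_matrix_def)
    then have "f Q ** f Q = (1 / 2) *\<^sub>R ((1 / 2) *\<^sub>R ((Q + Q) + (mat 1 + mat 1)))"
      by (simp add: f_def matrix_mult_distrib algebra_simps)
    also have "\<dots> = f Q"
      by (simp add: f_def algebra_simps flip: scaleR_2)
    finally show ?thesis
      using that by (simp add: projections_def f_def tr trace_add trace_I transpose_scalar transpose_distrib)
  qed
  have gP: "g P \<in> ?Q" if "P \<in> projections k" for P
  proof -
    note P = projectionsD[OF that]
    have "(g P)\<^sup>T = g P"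
      using P by (simp add: g_def transpose_distrib transpose_scalar)
    moreover have "g P ** g P = 2 *\<^sub>R (2 *\<^sub>R P) - 2 *\<^sub>R P - (2 *\<^sub>R P - mat 1)"
      by (simp only: g_def matrix_mult_distrib P matrix_mul_lid matrix_mul_rid scaleR_right_diff_distrib)
    then have "g P ** g P = mat 1"
      by (simp only: scaleR_2 add_diff_cancel_right' diff_diff_eq2 add_diff_cancel_left')
    ultimately show ?thesis
      using P by (simp add: orthogonal_matrix g_def trace_sub tr trace_I)
  qed
  have sm_f: "smooth_map (embedded ?Q) (embedded (projections k)) f"
    unfolding smooth_map_embedded_iff f_def[abs_def]
    using fQ by (intro conjI smooth_on_imp_smooth_ext[of UNIV] smooth_intros) (auto simp: f_def)
  have sm_g: "smooth_map (embedded (projections k)) (embedded ?Q) g"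
    unfolding smooth_map_embedded_iff g_def[abs_def]
    using gP by (intro conjI smooth_on_imp_smooth_ext[of UNIV] smooth_intros) (auto simp: g_def)
  have "diffeomorphism (embedded ?Q) (embedded (projections k)) f"
    unfolding diffeomorphism_def using sm_f sm_g gf fg by blast
  moreover have "?h (ambient_vector (differential (embedded (projections k)) f Q D))
      (ambient_vector (differential (embedded (projections k)) f Q D'))
      = 1 / 4 * ?h (ambient_vector D) (ambient_vector D')"
    if "D \<in> tangent_space (embedded ?Q) Q" "D' \<in> tangent_space (embedded ?Q) Q" for Q D D'
  proof -
    have "(f has_derivative (\<lambda>X. (1 / 2) *\<^sub>R X)) (at Q)"
      unfolding f_def by (auto intro!: derivative_eq_intros)
    from ambient_differential[OF sm_f that(1) this] ambient_differential[OF sm_f that(2) this]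
    show ?thesis
      by (simp add: matrix_mult_distrib tr)
  qed
  ultimately show ?thesis
    unfolding homothetic_def involution_model_def projection_model_eq submanifold_structure submanifold_simps
    by (intro exI[of _ f] exI[of _ "1 / 4"]) auto
qed

subsection \<open>Quotient models\<close>

lemma quotient_manifold_simps:
  "space_top (quotient_manifold E G H h) = space_top (quotient_space (embedded E) (orbit G))"
  "smooth_fun (quotient_manifold E G H h) = smooth_fun (quotient_space (embedded E) (orbit G))"
  "metric (quotient_manifold E G H h) p D D' = (THE r. \<exists>x v v'. x \<in> E \<and> orbit G x = p \<and>
     is_horizontal_lift E G H x D v \<and> is_horizontal_lift E G H x D' v' \<and> r = h x v v')"
  by (simp_all add: quotient_manifold_def smooth_space.extend_def riemannian_space.fields_def
      quotient_space_def)

lemmas quotient_manifold_structure =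
  same_structure[of "quotient_manifold E G H h" "quotient_space (embedded E) (orbit G)" for E G H h,
    unfolded quotient_manifold_simps, OF refl refl]

lemma points_quotient_space: "points (quotient_space M \<pi>) = \<pi> ` points M"
  by (simp add: quotient_space_def topspace_quotient_top)

lemma smooth_fun_quotient_space:
  "smooth_fun (quotient_space M \<pi>) U f \<longleftrightarrow> openin (space_top (quotient_space M \<pi>)) U \<and>
     smooth_fun M {x \<in> points M. \<pi> x \<in> U} (f \<circ> \<pi>)"
  by (simp add: quotient_space_def)

lemma openin_quotient_space:
  "openin (space_top (quotient_space M \<pi>)) U \<longleftrightarrow>
     U \<subseteq> \<pi> ` points M \<and> openin (space_top M) {x \<in> points M. \<pi> x \<in> U}"
  by (simp add: quotient_space_def openin_quotient_top)

lemma values_only_quotient_space: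
  assumes "values_only M"
  shows "values_only (quotient_space M \<pi>)"
  unfolding values_only_def smooth_fun_quotient_space
proof (intro allI impI, elim conjE, intro conjI)
  fix U f g
  assume f: "smooth_fun M {x \<in> points M. \<pi> x \<in> U} (f \<circ> \<pi>)" and eq: "\<forall>x\<in>U. f x = g x"
  show "smooth_fun M {x \<in> points M. \<pi> x \<in> U} (g \<circ> \<pi>)"
    by (rule values_only_cong[OF assms f]) (use eq in auto)
qed

lemma smooth_map_quotient: "smooth_map M (quotient_space M \<pi>) \<pi>"
  unfolding smooth_map_def smooth_fun_quotient_space
  by (auto simp: continuous_map_def openin_quotient_space points_quotient_space)

text \<open>What the three quotients share: each \<open>x\<close> in \<open>E\<close> has a frame
  \<open>x ** J\<close> with independent columns, and an orbit consists of the points whose frames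
  have the same column space. The group acts on the right, so orthogonal curves may act on the left
  by \<open>left_orthogonal\<close>. By \<open>generator_horizontal\<close>, the generator of a
  tangent matrix \<open>X\<close> moves \<open>x\<close> horizontally, which yields lifts;
  \<open>horizontal\<close> and \<open>metric_eq\<close> reduce the geometry of \<open>E\<close> to
  that of full-rank frames.\<close>

locale frame_quotient =
  fixes E :: "(real^'m^'n) set" and G :: "(real^'m^'m) set" and H :: "real^'m^'n \<Rightarrow> (real^'m^'n) set"
    and h :: "real^'m^'n \<Rightarrow> real^'m^'n \<Rightarrow> real^'m^'n \<Rightarrow> real" and J :: "real^'k^'m"
  assumes gram: "x \<in> E \<Longrightarrow> invertible ((x ** J)\<^sup>T ** (x ** J))"
    and orbit_eq: "x \<in> E \<Longrightarrow> orbit G x = {y \<in> E. col_proj (y ** J) = col_proj (x ** J)}"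
    and local_section: "p \<in> projections CARD('k) \<Longrightarrow> \<exists>A \<sigma>. open A \<and> p \<in> A \<and> smooth_on A \<sigma> \<and>
      (\<forall>q\<in>A \<inter> projections CARD('k). \<sigma> q \<in> E \<and> col_proj (\<sigma> q ** J) = q)"
    and left_orthogonal: "x \<in> E \<Longrightarrow> orthogonal_matrix U \<Longrightarrow> U ** x \<in> E"
    and generator_horizontal: "x \<in> E \<Longrightarrow> X \<in> proj_tangent (col_proj (x ** J)) \<Longrightarrow>
      (X ** col_proj (x ** J) - col_proj (x ** J) ** X) ** x \<in> H x"
    and horizontal: "x \<in> E \<Longrightarrow> v \<in> H x \<Longrightarrow> (x ** J)\<^sup>T ** (v ** J) = 0"
    and metric_eq: "x \<in> E \<Longrightarrow> v \<in> H x \<Longrightarrow> v' \<in> H x \<Longrightarrow>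
      h x v v' = trace (matrix_inv ((x ** J)\<^sup>T ** (x ** J)) ** ((v ** J)\<^sup>T ** (v' ** J)))"
begin

abbreviation \<pi> :: "real^'m^'n \<Rightarrow> (real^'m^'n) set" where "\<pi> \<equiv> orbit G"

abbreviation M :: "(real^'m^'n) set smooth_space" where "M \<equiv> quotient_space (embedded E) \<pi>"

definition F :: "real^'m^'n \<Rightarrow> real^'n^'n" where "F x = col_proj (x ** J)"

definition Fbar :: "(real^'m^'n) set \<Rightarrow> real^'n^'n" where "Fbar c = F (SOME x. x \<in> E \<and> \<pi> x = c)"

definition Fbar_inv :: "real^'n^'n \<Rightarrow> (real^'m^'n) set" where "Fbar_inv p = \<pi> (SOME x. x \<in> E \<and> F x = p)"

lemma F_in: "x \<in> E \<Longrightarrow> F x \<in> projections CARD('k)"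
  unfolding F_def by (intro col_proj_in_projections gram)

lemma F_surj:
  assumes "p \<in> projections CARD('k)"
  obtains x where "x \<in> E" "F x = p"
proof -
  from local_section[OF assms] show thesis
    using assms that unfolding F_def by (elim exE conjE) blast
qed

lemma orbit_eq_iff: "x \<in> E \<Longrightarrow> y \<in> E \<Longrightarrow> \<pi> x = \<pi> y \<longleftrightarrow> F x = F y"
  using orbit_eq[of x] orbit_eq[of y] unfolding F_def by auto

lemma Fbar_orbit [simp]: "x \<in> E \<Longrightarrow> Fbar (\<pi> x) = F x"
  unfolding Fbar_def using someI[of "\<lambda>y. y \<in> E \<and> \<pi> y = \<pi> x" x] orbit_eq_iff by blast

lemma Fbar_inv_F [simp]: "x \<in> E \<Longrightarrow> Fbar_inv (F x) = \<pi> x"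
  unfolding Fbar_inv_def using someI[of "\<lambda>y. y \<in> E \<and> F y = F x" x] orbit_eq_iff by blast

lemma points_M: "points M = \<pi> ` E"
  by (simp add: points_quotient_space)

lemma smooth_map_F: "smooth_map (embedded E) (embedded (projections CARD('k))) F"
proof -
  let ?O = "{x \<in> UNIV. invertible ((x ** J)\<^sup>T ** (x ** J))}"
  have "open ?O"
    by (rule open_invertible) (intro smooth_intros, simp)
  moreover from this have "smooth_on ?O F"
    unfolding F_def by (intro smooth_on_col_proj smooth_intros) auto
  ultimately have "smooth_ext E F"
    by (rule_tac smooth_on_imp_smooth_ext) (use gram in auto)
  then show ?thesis
    using F_in by (auto simp: smooth_map_embedded_iff)
qed

text \<open>The universal property of the quotient: preimages and compositions along
  \<open>\<pi>\<close> turn statements about \<open>Fbar\<close> into statements about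
  \<open>F\<close>.\<close>

lemma smooth_map_Fbar: "smooth_map M (embedded (projections CARD('k))) Fbar"
proof -
  have preimage: "{x \<in> E. \<pi> x \<in> \<pi> ` E \<and> Fbar (\<pi> x) \<in> W} = {x \<in> E. F x \<in> W}" for W
    by auto
  have "openin (space_top M) {c \<in> points M. Fbar c \<in> W}" if "openin (top_of_set (projections CARD('k))) W" for W
    using smooth_map_F that openin_continuous_map_preimage[of "top_of_set E" "top_of_set (projections CARD('k))" F W]
    by (auto simp: openin_quotient_space points_M preimage smooth_map_def)
  then have cont: "continuous_map (space_top M) (top_of_set (projections CARD('k))) Fbar"
    using F_in by (auto simp: continuous_map_def points_M)
  show ?thesis
    unfolding smooth_map_def
  proof (intro conjI allI impI)
    show "continuous_map (space_top M) (space_top (embedded (projections CARD('k)))) Fbar"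
      using cont by simp
  next
    fix V and f :: "real^'n^'n \<Rightarrow> real"
    assume f: "smooth_fun (embedded (projections CARD('k))) V f"
    have "smooth_fun (embedded E) {x \<in> E. F x \<in> V} (f \<circ> F)"
      using smooth_map_pullback[OF smooth_map_F f] by simp
    then have "smooth_fun (embedded E) {x \<in> E. F x \<in> V} (f \<circ> Fbar \<circ> \<pi>)"
      by (rule values_only_cong[OF values_only_embedded]) simp
    moreover have "openin (space_top M) {c \<in> points M. Fbar c \<in> V}"
      using openin_continuous_map_preimage[OF cont, of V] f by (simp add: smooth_fun_embedded)
    ultimately show "smooth_fun M {c \<in> points M. Fbar c \<in> V} (f \<circ> Fbar)"
      by (simp add: smooth_fun_quotient_space points_M preimage)
  qed
qed

text \<open>Near each point the inverse is \<open>\<pi> \<circ> \<sigma>\<close> for a local section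
  \<open>\<sigma>\<close>. All sections give the same orbit, so the representative chosen in
  \<open>Fbar_inv\<close> is irrelevant.\<close>

lemma smooth_map_Fbar_inv: "smooth_map (embedded (projections CARD('k))) M Fbar_inv"
proof (rule smooth_map_embedded_local)
  fix p :: "real^'n^'n"
  assume p: "p \<in> projections CARD('k)"
  from local_section[OF p] obtain A \<sigma> where A: "open A" "p \<in> A" "smooth_on A \<sigma>"
    and \<sigma>: "\<forall>q\<in>A \<inter> projections CARD('k). \<sigma> q \<in> E \<and> col_proj (\<sigma> q ** J) = q"
    by (elim exE conjE) (rule that)
  have "smooth_map (embedded (projections CARD('k) \<inter> A)) (embedded E) \<sigma>"
    unfolding smooth_map_embedded_iff
    using \<sigma> by (intro conjI smooth_on_imp_smooth_ext[OF A(3,1)]) auto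
  then have "smooth_map (embedded (projections CARD('k) \<inter> A)) M (\<pi> \<circ> \<sigma>)"
    by (rule smooth_map_compose[OF _ smooth_map_quotient])
  then have "smooth_map (embedded (projections CARD('k) \<inter> A)) M Fbar_inv"
  proof (rule smooth_map_embedded_cong)
    fix q assume "q \<in> projections CARD('k) \<inter> A"
    then have "\<sigma> q \<in> E" "F (\<sigma> q) = q"
      using \<sigma> by (auto simp: F_def)
    then show "(\<pi> \<circ> \<sigma>) q = Fbar_inv q"
      using Fbar_inv_F[of "\<sigma> q"] by simp
  qed
  with A show "\<exists>V. open V \<and> p \<in> V \<and> smooth_map (embedded (projections CARD('k) \<inter> V)) M Fbar_inv"
    by blast
qed

lemma Fbar_inv_Fbar: "c \<in> points M \<Longrightarrow> Fbar_inv (Fbar c) = c"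
  by (auto simp: points_M)

lemma Fbar_Fbar_inv: "p \<in> projections CARD('k) \<Longrightarrow> Fbar (Fbar_inv p) = p"
  by (erule F_surj) auto

lemma diffeomorphism_Fbar: "diffeomorphism M (embedded (projections CARD('k))) Fbar"
  unfolding diffeomorphism_def
  using smooth_map_Fbar smooth_map_Fbar_inv Fbar_inv_Fbar Fbar_Fbar_inv
  by (intro conjI exI[of _ Fbar_inv]) auto

text \<open>For horizontal \<open>v\<close> this is the part \<open>X ** F x\<close> of the
  derivative \<open>X\<close> of \<open>F\<close> in direction \<open>v\<close>; the other part
  \<open>F x ** X\<close> is its transpose.\<close>

definition half_differential :: "real^'m^'n \<Rightarrow> real^'m^'n \<Rightarrow> real^'n^'n" where
  "half_differential x v = (v ** J) ** matrix_inv ((x ** J)\<^sup>T ** (x ** J)) ** (x ** J)\<^sup>T"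

text \<open>Differentiating \<open>F (\<gamma> t) ** (\<gamma> t ** J) = \<gamma> t ** J\<close> along a horizontal curve determines the
  derivative of \<open>F \<circ> \<gamma>\<close> on the range of \<open>F x\<close>, hence everywhere.\<close>

lemma ambient_differential_Fbar:
  assumes x: "x \<in> E" and lift: "is_horizontal_lift E G H x D v"
  shows "ambient_vector (differential (embedded (projections CARD('k))) Fbar (\<pi> x) D) =
    half_differential x v + (half_differential x v)\<^sup>T"
proof -
  obtain L where L: "L \<in> tangent_space (embedded E) x" "ambient_vector L = v" "v \<in> H x"
    "differential M \<pi> x L = D"
    using lift unfolding is_horizontal_lift_def by blast
  obtain \<gamma> where \<gamma>: "L = velocity (embedded E) \<gamma>" "\<gamma> 0 = x" "smooth_curve (embedded E) \<gamma>"
    "(\<gamma> has_vector_derivative v) (at 0)"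
    using tangent_embeddedE[OF L(1)] L(2) by metis
  obtain e where e: "e > 0" "\<And>t. \<bar>t\<bar> < e \<Longrightarrow> \<gamma> t \<in> E"
    using smooth_curve_embeddedE[OF \<gamma>(3)] by metis
  define \<delta> where "\<delta> = F \<circ> \<gamma>"
  have sm_\<delta>: "smooth_curve (embedded (projections CARD('k))) \<delta>"
    unfolding \<delta>_def by (rule smooth_curve_compose[OF \<gamma>(3) smooth_map_F])
  have "differential (embedded (projections CARD('k))) Fbar (\<pi> x) D = differential (embedded (projections CARD('k))) (Fbar \<circ> \<pi>) x L"
    using differential_compose[OF smooth_map_quotient smooth_map_Fbar L(1)] L(4) by simp
  also have "\<dots> = velocity (embedded (projections CARD('k))) ((Fbar \<circ> \<pi>) \<circ> \<gamma>)"
    using differential_velocity[OF smooth_map_compose[OF smooth_map_quotient smooth_map_Fbar], of \<gamma>]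
      x \<gamma>(1,2) by simp
  \<comment> \<open>\<open>Fbar \<circ> \<pi>\<close> agrees with \<open>F\<close> on
    \<open>E\<close>, where the curve stays for small times.\<close>
  also have "\<dots> = velocity (embedded (projections CARD('k))) \<delta>"
    using e(2) by (intro velocity_cong[OF e(1)]) (simp add: \<delta>_def abs_less_iff)
  finally have D: "differential (embedded (projections CARD('k))) Fbar (\<pi> x) D = velocity (embedded (projections CARD('k))) \<delta>" .
  have \<delta>0: "\<delta> 0 = F x"
    by (simp add: \<delta>_def \<gamma>(2))
  obtain X where X: "(\<delta> has_vector_derivative X) (at 0)"
    using smooth_curve_embeddedE[OF sm_\<delta>] by metis
  then have amb: "ambient_vector (velocity (embedded (projections CARD('k))) \<delta>) = X"
    by (rule ambient_velocity[OF sm_\<delta>])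
  have "velocity (embedded (projections CARD('k))) \<delta> \<in> tangent_space (embedded (projections CARD('k))) (F x)"
    using sm_\<delta> \<delta>0 unfolding tangent_space_iff by blast
  then have tangent: "X \<in> proj_tangent (F x)"
    using ambient_in_proj_tangent amb by blast
  have vJ: "((\<lambda>t. \<gamma> t ** J) has_vector_derivative (v ** J)) (at 0)"
    using matrix_mult_has_vector_derivative[OF \<gamma>(4) has_vector_derivative_const[of J]]
    by (simp add: matrix_mult_distrib)
  have "\<delta> 0 ** (v ** J) + X ** (\<gamma> 0 ** J) = v ** J"
  proof (rule has_vector_derivative_local_unique[OF matrix_mult_has_vector_derivative[OF X vJ] vJ e(1)])
    show "\<delta> t ** (\<gamma> t ** J) = \<gamma> t ** J" if "\<bar>t\<bar> < e" for t
      unfolding \<delta>_def o_def F_def by (rule col_proj_mult[OF gram[OF e(2)[OF that]]])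
  qed
  \<comment> \<open>Horizontality enters here: the frame moves orthogonally to its column
    space.\<close>
  moreover have "F x ** (v ** J) = 0"
    using horizontal[OF x L(3)] by (simp add: F_def col_proj_def matrix_mul_assoc[symmetric] matrix_mult_distrib)
  ultimately have XJ: "X ** (x ** J) = v ** J"
    by (simp add: \<delta>0 \<gamma>(2))
  have XF: "X ** F x = half_differential x v"
    unfolding F_def col_proj_def half_differential_def XJ[symmetric] by (simp add: matrix_mul_assoc)
  have FT: "(F x)\<^sup>T = F x"
    using projectionsD(1)[OF F_in[OF x]] .
  have "X = X ** F x + (X ** F x)\<^sup>T"
    using tangent FT by (simp add: proj_tangent_def matrix_transpose_mul)
  then show ?thesis
    unfolding D amb XF .
qed

lemma trace_half_differential:
  assumes x: "x \<in> E" and v: "v \<in> H x" "v' \<in> H x"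
  shows "trace ((half_differential x v + (half_differential x v)\<^sup>T) **
    (half_differential x v' + (half_differential x v')\<^sup>T)) = 2 * h x v v'"
proof -
  define A where "A = x ** J"
  define K where "K = matrix_inv (A\<^sup>T ** A)"
  define Z where "Z = v ** J"
  define Z' where "Z' = v' ** J"
  have inv: "invertible (A\<^sup>T ** A)"
    unfolding A_def by (rule gram[OF x])
  have K: "K\<^sup>T = K" "(A\<^sup>T ** A) ** K = mat 1" "K ** (A\<^sup>T ** A) = mat 1"
    using gram_inv_symmetric[OF inv] matrix_inv_mult[OF inv] by (simp_all add: K_def)
  have AZ: "A\<^sup>T ** Z = 0" "A\<^sup>T ** Z' = 0"
    using horizontal[OF x v(1)] horizontal[OF x v(2)] by (simp_all add: A_def Z_def Z'_def)
  have hd: "half_differential x v = Z ** (K ** A\<^sup>T)" "half_differential x v' = Z' ** (K ** A\<^sup>T)"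
    by (simp_all add: half_differential_def A_def K_def Z_def Z'_def matrix_mul_assoc)
  have hxv: "h x v v' = trace (K ** (Z\<^sup>T ** Z'))"
    using metric_eq[OF x v] by (simp add: K_def A_def Z_def Z'_def)
  have AAK: "A\<^sup>T ** (A ** (K ** X)) = X" for X :: "real^'n^'k"
    using matrix_mult_left_cong[OF K(2)] by (simp add: matrix_mul_assoc[symmetric])
  have ZA: "Z\<^sup>T ** A = 0"
    using arg_cong[OF AZ(1), of transpose] by (simp add: matrix_transpose_mul transpose_distrib)
  \<comment> \<open>Of the four products two vanish, as they contain \<open>A\<^sup>T ** Z'\<close>
    or \<open>Z\<^sup>T ** A\<close>; each of the others contributes the metric once, whence the
    factor 2.\<close>
  have "(Z ** (K ** A\<^sup>T) + (Z ** (K ** A\<^sup>T))\<^sup>T) ** (Z' ** (K ** A\<^sup>T) + (Z' ** (K ** A\<^sup>T))\<^sup>T)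
      = Z ** (K ** Z'\<^sup>T) + A ** (K ** (Z\<^sup>T ** (Z' ** (K ** A\<^sup>T))))"
    by (simp add: matrix_expand K AAK matrix_mult_left_cong[OF AZ(2)] matrix_mult_left_cong[OF ZA])
  moreover have "trace (Z ** (K ** Z'\<^sup>T)) = trace (K ** (Z\<^sup>T ** Z'))"
  proof -
    have "trace (Z ** (K ** Z'\<^sup>T)) = trace ((Z ** (K ** Z'\<^sup>T))\<^sup>T)"
      by (simp only: trace_transpose)
    also have "\<dots> = trace (Z' ** (K ** Z\<^sup>T))"
      by (simp add: matrix_expand K)
    also have "\<dots> = trace (K ** Z\<^sup>T ** Z')"
      by (rule trace_mul_sym)
    finally show ?thesis
      by (simp add: matrix_mul_assoc)
  qed
  moreover have "trace (A ** (K ** (Z\<^sup>T ** (Z' ** (K ** A\<^sup>T))))) = trace (K ** (Z\<^sup>T ** Z'))"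
  proof -
    have "trace (A ** (K ** (Z\<^sup>T ** (Z' ** (K ** A\<^sup>T))))) = trace (K ** (Z\<^sup>T ** (Z' ** (K ** A\<^sup>T))) ** A)"
      by (rule trace_mul_sym)
    then show ?thesis
      by (simp add: matrix_mul_assoc[symmetric] K)
  qed
  ultimately show ?thesis
    by (simp add: hd hxv trace_add)
qed

text \<open>The lift is found on the projection side: \<open>D\<close> has image \<open>X\<close>
  there, the generator of \<open>X\<close> moves \<open>x\<close> horizontally, and the velocity of
  the resulting curve of orbits has the same image \<open>X\<close>. As the differential of
  \<open>Fbar\<close> is injective, this velocity is \<open>D\<close>.\<close>

lemma horizontal_lift_exists:
  assumes x: "x \<in> E" and D: "D \<in> tangent_space M (\<pi> x)"
  obtains v where "is_horizontal_lift E G H x D v"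
proof -
  let ?dF = "differential (embedded (projections CARD('k))) Fbar (\<pi> x)"
  note P = projectionsD[OF F_in[OF x]]
  define X where "X = ambient_vector (?dF D)"
  define \<Omega> where "\<Omega> = X ** F x - F x ** X"
  have dFD: "?dF D \<in> tangent_space (embedded (projections CARD('k))) (F x)"
    using differential_in_tangent_space[OF smooth_map_Fbar D] x by simp
  have X: "X \<in> proj_tangent (F x)"
    unfolding X_def by (rule ambient_in_proj_tangent[OF dFD])
  note \<Omega> = proj_tangent_generator[OF P(1,2) X, folded \<Omega>_def]
  obtain C where C: "smooth_on UNIV C" "\<And>t. orthogonal_matrix (C t)" "C 0 = mat 1"
    "(C has_vector_derivative \<Omega>) (at 0)"
    using orthogonal_curve_exists[OF \<Omega>(1)] by metis
  define \<gamma> where "\<gamma> t = C t ** x" for t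
  have sm: "smooth_curve (embedded E) \<gamma>"
    using C(1,2) left_orthogonal[OF x]
    by (intro smooth_curve_embeddedI) (auto simp: \<gamma>_def[abs_def] intro: smooth_intros)
  have der: "(\<gamma> has_vector_derivative \<Omega> ** x) (at 0)"
    using matrix_mult_has_vector_derivative[OF C(4) has_vector_derivative_const[of x]]
    by (simp add: \<gamma>_def[abs_def] matrix_mult_distrib)
  define L where "L = velocity (embedded E) \<gamma>"
  have L: "L \<in> tangent_space (embedded E) x" "ambient_vector L = \<Omega> ** x"
    unfolding L_def using sm der ambient_velocity C(3)
    by (auto simp: tangent_space_iff \<gamma>_def intro!: exI[of _ \<gamma>])
  have "\<Omega> ** x \<in> H x"
    using generator_horizontal[OF x] X by (simp add: \<Omega>_def F_def)
  then have lift: "is_horizontal_lift E G H x (differential M \<pi> x L) (\<Omega> ** x)"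
    unfolding is_horizontal_lift_def using L by blast
  have "half_differential x (\<Omega> ** x) = X ** F x"
  proof -
    have "F x ** (x ** J) = x ** J"
      unfolding F_def by (rule col_proj_mult[OF gram[OF x]])
    then have "\<Omega> ** x ** J = X ** (x ** J)"
      using \<Omega>(2) by (simp add: matrix_mul_assoc[symmetric])
    then show ?thesis
      by (simp add: half_differential_def F_def col_proj_def matrix_mul_assoc)
  qed
  then have "ambient_vector (?dF (differential M \<pi> x L)) = X"
    using ambient_differential_Fbar[OF x lift] X P(1) by (simp add: proj_tangent_def matrix_transpose_mul)
  moreover have dL: "differential M \<pi> x L \<in> tangent_space M (\<pi> x)"
    by (rule differential_in_tangent_space[OF smooth_map_quotient L(1)])
  have "?dF (differential M \<pi> x L) \<in> tangent_space (embedded (projections CARD('k))) (F x)"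
    using differential_in_tangent_space[OF smooth_map_Fbar dL] x by simp
  ultimately have "?dF (differential M \<pi> x L) = ?dF D"
    using tangent_embedded_eqI[OF _ dFD] by (simp add: X_def)
  then have "differential M \<pi> x L = D"
    using differential_inverse[OF smooth_map_Fbar smooth_map_Fbar_inv Fbar_inv_Fbar D]
      differential_inverse[OF smooth_map_Fbar smooth_map_Fbar_inv Fbar_inv_Fbar dL] by simp
  with lift that show thesis
    by simp
qed

text \<open>The left-hand side depends on \<open>D\<close> and \<open>D'\<close> alone and is twice
  \<open>h y v v'\<close> for every representative \<open>y\<close> and all lifts. This gives
  uniqueness in the definite description; existence of lifts gives the rest.\<close>

lemma metric_quotient:
  assumes x: "x \<in> E" and D: "D \<in> tangent_space M (\<pi> x)" "D' \<in> tangent_space M (\<pi> x)"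
  shows "trace (ambient_vector (differential (embedded (projections CARD('k))) Fbar (\<pi> x) D) **
      ambient_vector (differential (embedded (projections CARD('k))) Fbar (\<pi> x) D'))
    = 2 * metric (quotient_manifold E G H h) (\<pi> x) D D'"
proof -
  let ?t = "trace (ambient_vector (differential (embedded (projections CARD('k))) Fbar (\<pi> x) D) **
      ambient_vector (differential (embedded (projections CARD('k))) Fbar (\<pi> x) D'))"
  have lift: "?t = 2 * h y v v'"
    if "y \<in> E" "\<pi> y = \<pi> x" "is_horizontal_lift E G H y D v" "is_horizontal_lift E G H y D' v'" for y v v'
  proof -
    have "v \<in> H y" "v' \<in> H y"
      using that by (auto simp: is_horizontal_lift_def)
    then show ?thesis
      using ambient_differential_Fbar[OF that(1,3)] ambient_differential_Fbar[OF that(1,4)]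
        trace_half_differential[OF that(1)] that(2) by simp
  qed
  obtain v v' where v: "is_horizontal_lift E G H x D v" "is_horizontal_lift E G H x D' v'"
    using horizontal_lift_exists[OF x D(1)] horizontal_lift_exists[OF x D(2)] by metis
  have "metric (quotient_manifold E G H h) (\<pi> x) D D' = ?t / 2"
    unfolding quotient_manifold_simps
  proof (rule the_equality)
    show "\<exists>y w w'. y \<in> E \<and> \<pi> y = \<pi> x \<and> is_horizontal_lift E G H y D w \<and>
        is_horizontal_lift E G H y D' w' \<and> ?t / 2 = h y w w'"
      using x v lift[OF x refl v] by (intro exI[of _ x] exI[of _ v] exI[of _ v']) simp
  next
    fix r
    assume "\<exists>y w w'. y \<in> E \<and> \<pi> y = \<pi> x \<and> is_horizontal_lift E G H y D w \<and>
        is_horizontal_lift E G H y D' w' \<and> r = h y w w'"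
    then show "r = ?t / 2"
      using lift by force
  qed
  then show ?thesis
    by simp
qed

lemma homothetic_projection_model:
  "homothetic (quotient_manifold E G H h) (projection_model CARD('k) :: (real^'n^'n) riemannian_space)"
  unfolding homothetic_def projection_model_eq submanifold_structure submanifold_simps
    quotient_manifold_structure
proof (intro exI[of _ Fbar] exI[of _ 2] conjI ballI)
  fix p D D'
  assume "p \<in> points (quotient_manifold E G H h)"
    and D: "D \<in> tangent_space M p" "D' \<in> tangent_space M p"
  then obtain x where "x \<in> E" "p = \<pi> x"
    by (auto simp: quotient_manifold_simps points_M)
  with D show "trace (ambient_vector (differential (embedded (projections CARD('k))) Fbar p D) **
      ambient_vector (differential (embedded (projections CARD('k))) Fbar p D')) = 2 * metric (quotient_manifold E G H h) p D D'"
    using metric_quotient by blast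
qed (auto intro: diffeomorphism_Fbar)

lemma riemannian_manifold_quotient:
  fixes \<iota> :: "'k \<Rightarrow> 'n"
  assumes "inj \<iota>"
  shows "riemannian_manifold (off_block \<iota>) (quotient_manifold E G H h)"
proof (rule riemannian_manifold_via_projection_model[OF assms homothetic_projection_model])
  show "values_only (quotient_manifold E G H h)"
    unfolding quotient_manifold_structure by (intro values_only_quotient_space values_only_embedded)
  show "openin (space_top (quotient_manifold E G H h)) U"
    if "smooth_fun (quotient_manifold E G H h) U f" for U f
    using that by (simp add: quotient_manifold_simps smooth_fun_quotient_space)
qed

end

section \<open>The full-rank, Stiefel and orthogonal quotients as instances\<close>

lemma matrix_inv_mat_1: "matrix_inv (mat 1) = (mat 1 :: real^'n^'n)"
  by (simp add: matrix_inv_unique)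

lemma invertible_mat_1: "invertible (mat 1 :: real^'n^'n)"
  by (auto simp: invertible_def)

lemma col_proj_orthonormal: "A\<^sup>T ** A = mat 1 \<Longrightarrow> col_proj A = A ** A\<^sup>T"
  for A :: "real^'k^'n"
  by (simp add: col_proj_def matrix_inv_mat_1)

lemma orthogonal_emb_gram:
  assumes "inj \<iota>" "orthogonal_matrix V"
  shows "(V ** emb \<iota>)\<^sup>T ** (V ** emb \<iota>) = mat 1"
  using assms emb_gram
  by (simp add: matrix_expand orthogonal_matrix_def matrix_mult_left_cong[of "V\<^sup>T" V "mat 1"])

text \<open>A projection that fixes the orthonormal frame \<open>\<sigma> q ** emb \<iota>\<close>
  is its column projection. All three quotients take their local sections from here.\<close>

lemma projection_section:
  fixes \<iota> :: "'k::finite \<Rightarrow> 'n::finite" and p :: "real^'n^'n"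
  assumes inj: "inj \<iota>" and p: "p \<in> projections CARD('k)"
  obtains A \<sigma> where "open A" "p \<in> A" "smooth_on A \<sigma>"
    "\<And>q. q \<in> A \<Longrightarrow> q \<in> projections CARD('k) \<Longrightarrow> orthogonal_matrix (\<sigma> q)"
    "\<And>q. q \<in> A \<Longrightarrow> q \<in> projections CARD('k) \<Longrightarrow> col_proj (\<sigma> q ** emb \<iota>) = q"
proof -
  obtain A \<sigma> where A: "open A" "p \<in> A" "smooth_on A \<sigma>"
    and \<sigma>: "\<And>q. q \<in> A \<Longrightarrow> q \<in> projections CARD('k) \<Longrightarrow> orthogonal_matrix (\<sigma> q)"
      "\<And>q. q \<in> A \<Longrightarrow> q \<in> projections CARD('k) \<Longrightarrow> q ** (\<sigma> q ** emb \<iota>) = \<sigma> q ** emb \<iota>"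
    using orthogonal_section[OF inj p] by blast
  have "col_proj (\<sigma> q ** emb \<iota>) = q" if q: "q \<in> A" "q \<in> projections CARD('k)" for q
    using orthogonal_emb_gram[OF inj \<sigma>(1)[OF q]]
    by (intro col_proj_eqI q \<sigma>(2)) (simp add: invertible_mat_1)
  with A \<sigma>(1) that show thesis
    by blast
qed

text \<open>Like \<open>X\<close> itself, its commutator with \<open>P\<close> is off-diagonal with
  respect to the range and the kernel of \<open>P\<close>.\<close>

lemma generator_sandwich:
  assumes "P ** P = P" "X \<in> proj_tangent P"
  defines "\<Omega> \<equiv> X ** P - P ** X"
  shows "P ** (\<Omega> ** P) = 0" "\<Omega> = P ** \<Omega> + \<Omega> ** P"
proof -
  note X = proj_tangent_sandwich[OF assms(1,2)]
  show "P ** (\<Omega> ** P) = 0"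
    using X by (simp add: \<Omega>_def matrix_expand assms(1) matrix_mult_left_cong[OF assms(1)])
  show "\<Omega> = P ** \<Omega> + \<Omega> ** P"
    using X by (simp add: \<Omega>_def matrix_expand assms(1) matrix_mult_left_cong[OF assms(1)])
qed

text \<open>As \<open>x\<close> lies in the range of \<open>P\<close>, inserting \<open>P\<close> on
  both sides reduces the claim to the sandwich identity. This is the horizontality condition of the
  Stiefel and full-rank models.\<close>

lemma generator_orthogonal_to_frame:
  assumes "P\<^sup>T = P" "P ** P = P" "X \<in> proj_tangent P" "P ** x = x"
  shows "x\<^sup>T ** ((X ** P - P ** X) ** x) = 0"
proof -
  have xP: "x\<^sup>T ** P = x\<^sup>T"
    using arg_cong[OF assms(4), of transpose] assms(1) by (simp add: matrix_transpose_mul)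
  have "x\<^sup>T ** ((X ** P - P ** X) ** x) = x\<^sup>T ** (P ** ((X ** P - P ** X) ** P)) ** x"
    by (simp add: matrix_mul_assoc[symmetric] matrix_mult_left_cong[OF xP] assms(4))
  then show ?thesis
    using generator_sandwich(1)[OF assms(2,3)] by (simp add: matrix_mult_distrib)
qed

lemma frame_quotient_full_rank:
  fixes \<iota> :: "'k::finite \<Rightarrow> 'n::finite"
  assumes inj: "inj \<iota>"
  shows "frame_quotient {A :: real^'k^'n. rank A = CARD('k)} {X. invertible X} (\<lambda>A. {Z. A\<^sup>T ** Z = 0})
    (\<lambda>A Z\<^sub>1 Z\<^sub>2. trace (matrix_inv (A\<^sup>T ** A) ** (Z\<^sub>1\<^sup>T ** Z\<^sub>2))) (mat 1 :: real^'k^'k)"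
proof (unfold_locales, unfold matrix_mul_rid mem_Collect_eq gram_invertible_iff[symmetric])
  fix x :: "real^'k^'n"
  assume x: "invertible (x\<^sup>T ** x)"
  show "invertible (x\<^sup>T ** x)"
    by (rule x)
  note xx = matrix_inv_mult[OF x]
  show "orbit {X. invertible X} x = {y. invertible (y\<^sup>T ** y) \<and> col_proj y = col_proj x}"
  proof (intro equalityI subsetI)
    fix y :: "real^'k^'n" assume "y \<in> orbit {X. invertible X} x"
    then obtain g where g: "invertible g" "y = x ** g"
      by (auto simp: orbit_def)
    have "y\<^sup>T ** y = g\<^sup>T ** (x\<^sup>T ** x) ** g"
      by (simp add: g(2) matrix_expand)
    then have inv: "invertible (y\<^sup>T ** y)"
      using g(1) x by (simp add: invertible_mult transpose_invertible)
    moreover have "col_proj x ** y = y"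
      using col_proj_mult[OF x] by (simp add: g(2) matrix_mul_assoc)
    ultimately have "col_proj y = col_proj x"
      by (intro col_proj_eqI col_proj_in_projections x)
    with inv show "y \<in> {y. invertible (y\<^sup>T ** y) \<and> col_proj y = col_proj x}"
      by simp
  next
    fix y :: "real^'k^'n" assume "y \<in> {y. invertible (y\<^sup>T ** y) \<and> col_proj y = col_proj x}"
    then have y: "invertible (y\<^sup>T ** y)" and eq: "col_proj y = col_proj x"
      by simp_all
    \<comment> \<open>The coefficients of \<open>y\<close> in the frame \<open>x\<close>, by the
      normal equations; \<open>g'\<close> exchanges the roles and turns out to be the inverse of
      \<open>g\<close>.\<close>
    define g where "g = matrix_inv (x\<^sup>T ** x) ** (x\<^sup>T ** y)"
    define g' where "g' = matrix_inv (y\<^sup>T ** y) ** (y\<^sup>T ** x)"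
    have "x ** g = col_proj x ** y"
      by (simp add: g_def col_proj_def matrix_mul_assoc)
    then have xg: "x ** g = y"
      using col_proj_mult[OF y] eq by simp
    have "y ** g' = col_proj y ** x"
      by (simp add: g'_def col_proj_def matrix_mul_assoc)
    then have yg: "y ** g' = x"
      using col_proj_mult[OF x] eq by simp
    have "g ** g' = matrix_inv (x\<^sup>T ** x) ** (x\<^sup>T ** (y ** g'))"
      by (simp add: g_def matrix_mul_assoc)
    then have "g ** g' = mat 1"
      using yg xx(2) by simp
    then have "invertible g"
      using invertible_right_inverse[of g] by blast
    then show "y \<in> orbit {X. invertible X} x"
      unfolding orbit_def by (intro image_eqI[of _ _ g]) (simp_all add: xg)
  qed
  show "invertible ((U ** x)\<^sup>T ** (U ** x))" if "orthogonal_matrix U" for U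
    using x that by (simp add: matrix_expand orthogonal_matrix_def matrix_mult_left_cong[of "U\<^sup>T" U "mat 1"])
  show "x\<^sup>T ** ((X ** col_proj x - col_proj x ** X) ** x) = 0" if "X \<in> proj_tangent (col_proj x)" for X
    using projectionsD[OF col_proj_in_projections[OF x]] that col_proj_mult[OF x]
    by (intro generator_orthogonal_to_frame)
next
  fix p :: "real^'n^'n" assume p: "p \<in> projections CARD('k)"
  obtain A \<sigma> where A: "open A" "p \<in> A" "smooth_on A \<sigma>"
    and \<sigma>: "\<And>q. q \<in> A \<Longrightarrow> q \<in> projections CARD('k) \<Longrightarrow> orthogonal_matrix (\<sigma> q)"
      "\<And>q. q \<in> A \<Longrightarrow> q \<in> projections CARD('k) \<Longrightarrow> col_proj (\<sigma> q ** emb \<iota>) = q"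
    using projection_section[OF inj p] by blast
  show "\<exists>A \<sigma>. open A \<and> p \<in> A \<and> smooth_on A \<sigma> \<and>
      (\<forall>q\<in>A \<inter> projections CARD('k). invertible ((\<sigma> q :: real^'k^'n)\<^sup>T ** \<sigma> q) \<and> col_proj (\<sigma> q) = q)"
    using A \<sigma> orthogonal_emb_gram[OF inj]
    by (intro exI[of _ A] exI[of _ "\<lambda>q. \<sigma> q ** emb \<iota>"])
       (auto intro: smooth_on_matrix_mult smooth_on_const simp: invertible_mat_1)
next
  fix x v v' :: "real^'k^'n"
  show "trace (matrix_inv (x\<^sup>T ** x) ** (v\<^sup>T ** v')) = trace (matrix_inv (x\<^sup>T ** x) ** (v\<^sup>T ** v'))"
    by (rule refl)
qed

lemma frame_quotient_stiefel:
  fixes \<iota> :: "'k::finite \<Rightarrow> 'n::finite"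
  assumes inj: "inj \<iota>"
  shows "frame_quotient {Y :: real^'k^'n. Y\<^sup>T ** Y = mat 1} {U. orthogonal_matrix U} (\<lambda>Y. {\<Delta>. Y\<^sup>T ** \<Delta> = 0})
    (\<lambda>Y \<Delta>\<^sub>1 \<Delta>\<^sub>2. trace (\<Delta>\<^sub>1\<^sup>T ** \<Delta>\<^sub>2)) (mat 1 :: real^'k^'k)"
proof (unfold_locales, unfold matrix_mul_rid mem_Collect_eq)
  fix x :: "real^'k^'n"
  assume x: "x\<^sup>T ** x = mat 1"
  note Px = col_proj_orthonormal[OF x]
  show inv: "invertible (x\<^sup>T ** x)"
    by (simp add: x invertible_mat_1)
  show "trace (v\<^sup>T ** v') = trace (matrix_inv (x\<^sup>T ** x) ** (v\<^sup>T ** v'))" for v v' :: "real^'k^'n"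
    by (simp add: x matrix_inv_mat_1)
  show "orbit {U. orthogonal_matrix U} x = {y. y\<^sup>T ** y = mat 1 \<and> col_proj y = col_proj x}"
  proof (intro equalityI subsetI)
    fix y :: "real^'k^'n" assume "y \<in> orbit {U. orthogonal_matrix U} x"
    then obtain g where g: "g\<^sup>T ** g = mat 1" "g ** g\<^sup>T = mat 1" "y = x ** g"
      by (auto simp: orbit_def orthogonal_matrix_def)
    then have y: "y\<^sup>T ** y = mat 1"
      using x by (simp add: matrix_expand matrix_mult_left_cong[OF x])
    moreover have "y ** y\<^sup>T = x ** x\<^sup>T"
      by (simp add: g(3) matrix_expand matrix_mult_left_cong[OF g(2)])
    ultimately show "y \<in> {y. y\<^sup>T ** y = mat 1 \<and> col_proj y = col_proj x}"
      by (simp add: col_proj_orthonormal[OF y] Px)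
  next
    fix y :: "real^'k^'n" assume "y \<in> {y. y\<^sup>T ** y = mat 1 \<and> col_proj y = col_proj x}"
    then have y: "y\<^sup>T ** y = mat 1" and "col_proj y = col_proj x"
      by simp_all
    then have eq: "y ** y\<^sup>T = x ** x\<^sup>T"
      using col_proj_orthonormal[OF y] Px by simp
    \<comment> \<open>\<open>x ** x\<^sup>T\<close> is also the projection onto the column space of
      \<open>y\<close>, hence fixes \<open>y\<close>; so \<open>x\<^sup>T ** y\<close> is the change
      of frame.\<close>
    have xg: "x ** (x\<^sup>T ** y) = y"
      using matrix_mul_assoc[of x "x\<^sup>T" y] matrix_mul_assoc[of y "y\<^sup>T" y] eq y by simp
    then have "(x\<^sup>T ** y)\<^sup>T ** (x\<^sup>T ** y) = mat 1"
      using y by (simp add: matrix_expand)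
    then show "y \<in> orbit {U. orthogonal_matrix U} x"
      unfolding orbit_def by (intro image_eqI[of _ _ "x\<^sup>T ** y"]) (simp_all add: xg orthogonal_matrix)
  qed
  show "(U ** x)\<^sup>T ** (U ** x) = mat 1" if "orthogonal_matrix U" for U
    using x that by (simp add: matrix_expand orthogonal_matrix_def matrix_mult_left_cong[of "U\<^sup>T" U "mat 1"])
  show "x\<^sup>T ** ((X ** col_proj x - col_proj x ** X) ** x) = 0" if "X \<in> proj_tangent (col_proj x)" for X
    using projectionsD[OF col_proj_in_projections[OF inv]] that col_proj_mult[OF inv]
    by (intro generator_orthogonal_to_frame)
next
  fix p :: "real^'n^'n" assume p: "p \<in> projections CARD('k)"
  obtain A \<sigma> where A: "open A" "p \<in> A" "smooth_on A \<sigma>"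
    and \<sigma>: "\<And>q. q \<in> A \<Longrightarrow> q \<in> projections CARD('k) \<Longrightarrow> orthogonal_matrix (\<sigma> q)"
      "\<And>q. q \<in> A \<Longrightarrow> q \<in> projections CARD('k) \<Longrightarrow> col_proj (\<sigma> q ** emb \<iota>) = q"
    using projection_section[OF inj p] by blast
  show "\<exists>A \<sigma>. open A \<and> p \<in> A \<and> smooth_on A \<sigma> \<and>
      (\<forall>q\<in>A \<inter> projections CARD('k). (\<sigma> q :: real^'k^'n)\<^sup>T ** \<sigma> q = mat 1 \<and> col_proj (\<sigma> q) = q)"
    using A \<sigma> orthogonal_emb_gram[OF inj]
    by (intro exI[of _ A] exI[of _ "\<lambda>q. \<sigma> q ** emb \<iota>"])
       (auto intro: smooth_on_matrix_mult smooth_on_const)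
qed

lemma block_diag_orthogonal_iff:
  assumes "inj \<iota>"
  shows "U \<in> block_diag_orthogonal \<iota> \<longleftrightarrow> orthogonal_matrix U \<and> emb_proj \<iota> ** U = U ** emb_proj \<iota>"
  unfolding block_diagonal_iff_commute[OF assms, symmetric]
  by (auto simp: block_diag_orthogonal_def block_diagonal_def)

lemma emb_skew_block:
  assumes "inj \<iota>" "B \<in> off_block \<iota>"
  shows "skew_block \<iota> B ** emb \<iota> = - B\<^sup>T" "(emb \<iota>)\<^sup>T ** skew_block \<iota> B = B" "(emb \<iota>)\<^sup>T ** B\<^sup>T = 0"
proof -
  note J = emb_gram[OF assms(1)]
  have BJ: "B ** emb \<iota> = 0"
    using assms(2) by (simp add: off_block_iff)
  then show JB: "(emb \<iota>)\<^sup>T ** B\<^sup>T = 0"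
    by (simp add: matrix_transpose_mul[symmetric] transpose_distrib)
  show "skew_block \<iota> B ** emb \<iota> = - B\<^sup>T" "(emb \<iota>)\<^sup>T ** skew_block \<iota> B = B"
    unfolding skew_block_eq[OF assms]
    by (simp_all add: matrix_expand J BJ matrix_mult_left_cong[OF J] matrix_mult_left_cong[OF JB])
qed

text \<open>Uniqueness in the definite description: \<open>V\<close> cancels, and the rows of
  \<open>skew_block \<iota> B\<close> in the first block form \<open>B\<close>.\<close>

lemma off_block_coord_eq:
  assumes "inj \<iota>" "B \<in> off_block \<iota>" "orthogonal_matrix V"
  shows "off_block_coord \<iota> V (V ** skew_block \<iota> B) = B"
  unfolding off_block_coord_def
proof (rule the_equality)
  fix B' assume B': "B' \<in> off_block \<iota> \<and> V ** skew_block \<iota> B = V ** skew_block \<iota> B'"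
  then have "V\<^sup>T ** (V ** skew_block \<iota> B) = V\<^sup>T ** (V ** skew_block \<iota> B')"
    by simp
  then have "skew_block \<iota> B = skew_block \<iota> B'"
    using assms(3) by (simp add: matrix_mul_assoc orthogonal_matrix_def)
  then show "B' = B"
    using emb_skew_block(2)[OF assms(1,2)] emb_skew_block(2)[OF assms(1) conjunct1[OF B']] by metis
qed (use assms in simp)

text \<open>Multiplication by \<open>emb \<iota>\<close> forgets the columns outside the first
  block. The remaining ones still determine the orbit: if the first columns of two orthogonal
  matrices span the same space, then so do the complementary columns.\<close>

lemma frame_quotient_orthogonal:
  fixes \<iota> :: "'k::finite \<Rightarrow> 'n::finite"
  assumes inj: "inj \<iota>"
  shows "frame_quotient {V :: real^'n^'n. orthogonal_matrix V} (block_diag_orthogonal \<iota>)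
    (\<lambda>V. {V ** skew_block \<iota> B | B. B \<in> off_block \<iota>})
    (\<lambda>V X\<^sub>1 X\<^sub>2. trace ((off_block_coord \<iota> V X\<^sub>1)\<^sup>T ** off_block_coord \<iota> V X\<^sub>2)) (emb \<iota>)"
proof (unfold_locales, unfold mem_Collect_eq)
  note D = emb_proj_simps[OF inj]
  have cp: "col_proj (V ** emb \<iota>) = V ** (emb_proj \<iota> ** V\<^sup>T)" if "orthogonal_matrix V" for V
    using col_proj_orthonormal[OF orthogonal_emb_gram[OF inj that]] D
    by (simp add: matrix_expand matrix_mult_left_cong[OF D(5)])
  fix V :: "real^'n^'n"
  assume V: "orthogonal_matrix V"
  then have VV: "V\<^sup>T ** V = mat 1" "V ** V\<^sup>T = mat 1"
    by (simp_all add: orthogonal_matrix_def)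
  note gram = orthogonal_emb_gram[OF inj V]
  show inv: "invertible ((V ** emb \<iota>)\<^sup>T ** (V ** emb \<iota>))"
    by (simp add: gram invertible_mat_1)
  show "orbit (block_diag_orthogonal \<iota>) V =
      {y. orthogonal_matrix y \<and> col_proj (y ** emb \<iota>) = col_proj (V ** emb \<iota>)}"
  proof (intro equalityI subsetI)
    fix y :: "real^'n^'n" assume "y \<in> orbit (block_diag_orthogonal \<iota>) V"
    then obtain g where g: "orthogonal_matrix g" "emb_proj \<iota> ** g = g ** emb_proj \<iota>" "y = V ** g"
      by (auto simp: orbit_def block_diag_orthogonal_iff[OF inj])
    have y: "orthogonal_matrix y"
      using g V by (simp add: orthogonal_matrix_mul)
    have "y ** (emb_proj \<iota> ** y\<^sup>T) = V ** (g ** emb_proj \<iota>) ** (g\<^sup>T ** V\<^sup>T)"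
      by (simp add: g(3) matrix_expand)
    also have "\<dots> = V ** (emb_proj \<iota> ** ((g ** g\<^sup>T) ** V\<^sup>T))"
      by (simp add: g(2)[symmetric] matrix_mul_assoc)
    finally have "y ** (emb_proj \<iota> ** y\<^sup>T) = V ** (emb_proj \<iota> ** V\<^sup>T)"
      using g(1) by (simp add: orthogonal_matrix_def)
    then show "y \<in> {y. orthogonal_matrix y \<and> col_proj (y ** emb \<iota>) = col_proj (V ** emb \<iota>)}"
      using y V by (simp add: cp)
  next
    fix y :: "real^'n^'n" assume "y \<in> {y. orthogonal_matrix y \<and> col_proj (y ** emb \<iota>) = col_proj (V ** emb \<iota>)}"
    then have y: "orthogonal_matrix y" and "col_proj (y ** emb \<iota>) = col_proj (V ** emb \<iota>)"
      by simp_all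
    then have eq: "y ** (emb_proj \<iota> ** y\<^sup>T) = V ** (emb_proj \<iota> ** V\<^sup>T)"
      using cp[OF y] cp[OF V] by simp
    have yy: "y\<^sup>T ** y = mat 1" "y ** y\<^sup>T = mat 1"
      using y by (simp_all add: orthogonal_matrix_def)
    have "emb_proj \<iota> ** (V\<^sup>T ** y) = V\<^sup>T ** ((V ** (emb_proj \<iota> ** V\<^sup>T)) ** y)"
      by (simp add: matrix_expand matrix_mult_left_cong[OF VV(1)])
    also have "\<dots> = V\<^sup>T ** y ** emb_proj \<iota>"
      unfolding eq[symmetric] by (simp add: matrix_expand yy)
    finally have "emb_proj \<iota> ** (V\<^sup>T ** y) = V\<^sup>T ** y ** emb_proj \<iota>" .
    moreover have "orthogonal_matrix (V\<^sup>T ** y)"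
      using V y by (simp add: orthogonal_matrix_mul)
    moreover have "V ** (V\<^sup>T ** y) = y"
      by (simp add: matrix_mult_left_cong[OF VV(2)])
    ultimately show "y \<in> orbit (block_diag_orthogonal \<iota>) V"
      unfolding orbit_def
      by (intro image_eqI[of _ _ "V\<^sup>T ** y"]) (simp_all add: block_diag_orthogonal_iff[OF inj])
  qed
  show "orthogonal_matrix (U ** V)" if "orthogonal_matrix U" for U
    using that V by (simp add: orthogonal_matrix_mul)
  have horizontal: "V ** skew_block \<iota> B ** emb \<iota> = - (V ** B\<^sup>T)" if "B \<in> off_block \<iota>" for B
    using emb_skew_block(1)[OF inj that] by (simp add: matrix_expand)
  show "(V ** emb \<iota>)\<^sup>T ** (v ** emb \<iota>) = 0" if v: "\<exists>B. v = V ** skew_block \<iota> B \<and> B \<in> off_block \<iota>" for v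
  proof -
    obtain B where B: "v = V ** skew_block \<iota> B" "B \<in> off_block \<iota>"
      using v by blast
    then have "v ** emb \<iota> = - (V ** B\<^sup>T)"
      using horizontal by simp
    then show ?thesis
      using emb_skew_block(3)[OF inj B(2)]
      by (simp add: matrix_expand matrix_mult_left_cong[OF VV(1)])
  qed
  show "trace ((off_block_coord \<iota> V v)\<^sup>T ** off_block_coord \<iota> V v') =
      trace (matrix_inv ((V ** emb \<iota>)\<^sup>T ** (V ** emb \<iota>)) ** ((v ** emb \<iota>)\<^sup>T ** (v' ** emb \<iota>)))"
    if v: "\<exists>B. v = V ** skew_block \<iota> B \<and> B \<in> off_block \<iota>" "\<exists>B. v' = V ** skew_block \<iota> B \<and> B \<in> off_block \<iota>"
    for v v'
  proof -
    obtain B B' where B: "v = V ** skew_block \<iota> B" "B \<in> off_block \<iota>"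
      "v' = V ** skew_block \<iota> B'" "B' \<in> off_block \<iota>"
      using v by blast
    have vJ: "v ** emb \<iota> = - (V ** B\<^sup>T)" "v' ** emb \<iota> = - (V ** B'\<^sup>T)"
      using B horizontal by simp_all
    have coord: "off_block_coord \<iota> V v = B" "off_block_coord \<iota> V v' = B'"
      unfolding B(1,3) by (intro off_block_coord_eq inj V B)+
    \<comment> \<open>The frame velocities are \<open>- (V ** B\<^sup>T)\<close> and
      \<open>- (V ** B'\<^sup>T)\<close>, which gives \<open>trace (B ** B'\<^sup>T)\<close>;
      transposition and cyclicity match it with the metric in the parameters.\<close>
    have "trace (B\<^sup>T ** B') = trace ((B\<^sup>T ** B')\<^sup>T)"
      by (simp only: trace_transpose)
    also have "\<dots> = trace (B ** B'\<^sup>T)"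
      unfolding matrix_transpose_mul transpose_transpose by (rule trace_mul_sym)
    finally show ?thesis
      unfolding coord vJ gram matrix_inv_mat_1
      by (simp add: matrix_expand matrix_mult_left_cong[OF VV(1)])
  qed
  let ?P = "col_proj (V ** emb \<iota>)"
  show "\<exists>B. (X ** ?P - ?P ** X) ** V = V ** skew_block \<iota> B \<and> B \<in> off_block \<iota>"
    if X: "X \<in> proj_tangent ?P" for X
  proof -
    note P = projectionsD[OF col_proj_in_projections[OF inv]]
    define \<Omega> where "\<Omega> = X ** ?P - ?P ** X"
    note \<Omega> = proj_tangent_generator(1)[OF P(1,2) X, folded \<Omega>_def]
      generator_sandwich[OF P(2) X, folded \<Omega>_def]
    \<comment> \<open>The generator written in the frame \<open>V\<close> is skew, and the sandwich
      identities make both of its diagonal blocks vanish. It is thus a \<open>skew_block\<close>,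
      with \<open>B\<close> as its upper right block.\<close>
    define T where "T = V\<^sup>T ** (\<Omega> ** V)"
    define B where "B = (emb \<iota>)\<^sup>T ** T"
    have PV: "?P ** V = V ** emb_proj \<iota>" and VP: "V\<^sup>T ** ?P = emb_proj \<iota> ** V\<^sup>T"
      by (simp_all add: cp[OF V] matrix_mul_assoc[symmetric] VV matrix_mult_left_cong[OF VV(1)])
    have TT: "T\<^sup>T = - T"
      using \<Omega>(1) by (simp add: T_def matrix_expand)
    have "T = V\<^sup>T ** ((?P ** \<Omega> + \<Omega> ** ?P) ** V)"
      unfolding T_def using \<Omega>(3) by simp
    also have "\<dots> = (V\<^sup>T ** ?P) ** (\<Omega> ** V) + V\<^sup>T ** (\<Omega> ** (?P ** V))"
      by (simp add: matrix_mult_distrib matrix_mul_assoc)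
    finally have T: "T = emb_proj \<iota> ** T + T ** emb_proj \<iota>"
      unfolding PV VP by (simp add: T_def matrix_mul_assoc)
    have "emb_proj \<iota> ** T ** emb_proj \<iota> = (emb_proj \<iota> ** V\<^sup>T) ** (\<Omega> ** (V ** emb_proj \<iota>))"
      by (simp add: T_def matrix_mul_assoc)
    also have "\<dots> = V\<^sup>T ** (?P ** (\<Omega> ** ?P)) ** V"
      unfolding PV[symmetric] VP[symmetric] by (simp add: matrix_mul_assoc)
    finally have DTD: "emb_proj \<iota> ** T ** emb_proj \<iota> = 0"
      using \<Omega>(2) by (simp add: matrix_mult_distrib)
    have "B ** emb \<iota> = (emb \<iota>)\<^sup>T ** (emb_proj \<iota> ** T ** emb_proj \<iota>) ** emb \<iota>"
      by (simp add: B_def matrix_mul_assoc[symmetric] D matrix_mult_left_cong[OF D(4)])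
    then have B: "B \<in> off_block \<iota>"
      by (simp add: off_block_iff DTD matrix_mult_distrib)
    have "skew_block \<iota> B = emb_proj \<iota> ** T + T ** emb_proj \<iota>"
      unfolding skew_block_eq[OF inj B]
      by (simp add: B_def matrix_expand TT D matrix_mult_left_cong[OF D(5)])
    then have "V ** skew_block \<iota> B = V ** T"
      using T by simp
    also have "\<dots> = \<Omega> ** V"
      by (simp add: T_def matrix_mult_left_cong[OF VV(2)])
    finally show ?thesis
      using B unfolding \<Omega>_def by metis
  qed
next
  fix p :: "real^'n^'n" assume p: "p \<in> projections CARD('k)"
  obtain A \<sigma> where "open A" "p \<in> A" "smooth_on A \<sigma>"
    "\<And>q. q \<in> A \<Longrightarrow> q \<in> projections CARD('k) \<Longrightarrow> orthogonal_matrix (\<sigma> q)"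
    "\<And>q. q \<in> A \<Longrightarrow> q \<in> projections CARD('k) \<Longrightarrow> col_proj (\<sigma> q ** emb \<iota>) = q"
    using projection_section[OF inj p] by blast
  then show "\<exists>A \<sigma>. open A \<and> p \<in> A \<and> smooth_on A \<sigma> \<and>
      (\<forall>q\<in>A \<inter> projections CARD('k). orthogonal_matrix (\<sigma> q) \<and> col_proj (\<sigma> q ** emb \<iota>) = q)"
    by (intro exI[of _ A] exI[of _ \<sigma>]) auto
qed

text \<open>\<open>inj \<iota>\<close> encodes \<open>k \<le> n\<close>, and
  \<open>k \<ge> 1\<close> holds because types are nonempty. The model space
  \<open>off_block \<iota>\<close> has dimension \<open>k * (n - k)\<close>, so the manifold clauses
  also fix the common dimension.\<close>

theorem proposition3p5:
  fixes \<iota> :: "'k::finite \<Rightarrow> 'n::finite"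
    and M1 :: "(real^'n^'n) set riemannian_space"
    and M2 M3 :: "(real^'k^'n) set riemannian_space"
    and M4 M5 :: "(real^'n^'n) riemannian_space"
  assumes "inj \<iota>"
  defines "M1 \<equiv> orthogonal_model \<iota>"
    and "M2 \<equiv> stiefel_model"
    and "M3 \<equiv> full_rank_model"
    and "M4 \<equiv> projection_model CARD('k)"
    and "M5 \<equiv> involution_model CARD('k)"
  shows "riemannian_manifold (off_block \<iota>) M1 \<and> riemannian_manifold (off_block \<iota>) M2 \<and>
         riemannian_manifold (off_block \<iota>) M3 \<and> riemannian_manifold (off_block \<iota>) M4 \<and>
         riemannian_manifold (off_block \<iota>) M5 \<and>
         homothetic M1 M2 \<and> homothetic M1 M3 \<and> homothetic M1 M4 \<and> homothetic M1 M5 \<and>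
         homothetic M2 M1 \<and> homothetic M2 M3 \<and> homothetic M2 M4 \<and> homothetic M2 M5 \<and>
         homothetic M3 M1 \<and> homothetic M3 M2 \<and> homothetic M3 M4 \<and> homothetic M3 M5 \<and>
         homothetic M4 M1 \<and> homothetic M4 M2 \<and> homothetic M4 M3 \<and> homothetic M4 M5 \<and>
         homothetic M5 M1 \<and> homothetic M5 M2 \<and> homothetic M5 M3 \<and> homothetic M5 M4"
proof -
  note frames = frame_quotient_orthogonal[OF assms(1)] frame_quotient_stiefel[OF assms(1)]
    frame_quotient_full_rank[OF assms(1)]
  note models = M1_def orthogonal_model_def M2_def stiefel_model_def M3_def full_rank_model_def
  \<comment> \<open>Homotheties into \<open>M4\<close> suffice: symmetry and transitivity yield all
    other pairs.\<close>
  have to: "homothetic M1 M4" "homothetic M2 M4" "homothetic M3 M4" "homothetic M5 M4"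
    unfolding models M4_def M5_def
    by (intro frames[THEN frame_quotient.homothetic_projection_model] homothetic_involution_projection)+
  note from_M4 = to[THEN homothetic_sym]
  have "riemannian_manifold (off_block \<iota>) M1" "riemannian_manifold (off_block \<iota>) M2"
    "riemannian_manifold (off_block \<iota>) M3"
    unfolding models
    by (intro frames[THEN frame_quotient.riemannian_manifold_quotient] assms(1))+
  moreover have "riemannian_manifold (off_block \<iota>) M4"
    unfolding M4_def by (rule riemannian_manifold_projection_model[OF assms(1)])
  moreover have "riemannian_manifold (off_block \<iota>) M5"
  proof (rule riemannian_manifold_via_projection_model[OF assms(1) to(4)[unfolded M4_def]])
    show "values_only M5"
      by (simp add: M5_def involution_model_def submanifold_structure values_only_embedded)
    show "openin (space_top M5) U" if "smooth_fun M5 U f" for U f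
      using that by (simp add: M5_def involution_model_def submanifold_simps smooth_fun_embedded)
  qed
  ultimately show ?thesis
    using to from_M4 by (intro conjI) (blast intro: homothetic_trans)+
qed

end
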